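(* There is a polynomial-time algorithm for $Q|G=\mathrm{bipartite}|C_{\max}$ which, on every instance, returns a feasible schedule with makespan at most $\sqrt{p_{\mathrm{sum}}}\cdot C^*_{\max}$, where $p_{\mathrm{sum}}=\sum_{j=1}^n p_j$.
   Context: Problem $Q|G=\mathrm{bipartite}|C_{\max}$: there are $m$ uniform machines $M_1,\dots,M_m$ ($m$ part of the input) with speeds $s_1\ge\dots\ge s_m\ge 1$, jobs $J=\{J_1,\dots,J_n\}$ with positive integer processing requirements $p_j$, and a bipartite incompatibility graph $G=(J,E)$. A feasible schedule assigns each job to exactly one machine so that the jobs on each machine form an independent set in $G$. Job $J_j$ on $M_i$ takes time $p_j/s_i$; the makespan is the maximum over machines of the total processing time of the jobs assigned to it. $C^*_{\max}$ denotes the minimum makespan over all feasible schedules. *)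

theory Defs
  imports Complex_Main "HOL-Library.Log_Nat" "HOL-Computational_Algebra.Polynomial"
begin

section \<open>Random access programs with logarithmic cost\<close>

text \<open>
  The model of computation is the random access machine over the natural numbers with the
  logarithmic cost criterion of Aho, Hopcroft and Ullman, programmed by while programs.
  It is polynomially equivalent to the multitape Turing machine. The memory consists of
  unbounded arrays of natural numbers that are indirectly addressable, i.e. the index of an
  access is itself computed; a scalar variable is cell \<open>0\<close> of an array. A program mentions only
  finitely many arrays.
\<close>

type_synonym store = "nat \<Rightarrow> nat \<Rightarrow> nat"

datatype aexp =
    Const nat
  | Read nat aexp \<comment> \<open>array name, index\<close>
  | Plus aexp aexp
  | Monus aexp aexp
  | Times aexp aexp
  | Quot aexp aexp

datatype com =
    Skip
  | Write nat aexp aexp \<comment> \<open>array name, index, value\<close>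
  | Seq com com
  | If aexp com com \<comment> \<open>a condition holds iff its value is nonzero\<close>
  | While aexp com

text \<open>The length of the binary representation, where \<open>0\<close> is written with one digit.\<close>

definition bits :: "nat \<Rightarrow> nat" where
  "bits n = max 1 (floorlog 2 n)"

fun aval :: "aexp \<Rightarrow> store \<Rightarrow> nat" where
  "aval (Const k) s = k"
| "aval (Read a e) s = s a (aval e s)"
| "aval (Plus e1 e2) s = aval e1 s + aval e2 s"
| "aval (Monus e1 e2) s = aval e1 s - aval e2 s"
| "aval (Times e1 e2) s = aval e1 s * aval e2 s"
| "aval (Quot e1 e2) s = aval e1 s div aval e2 s"

text \<open>Every value that occurs during the evaluation, including every address, is charged
  with its length.\<close>

fun acost :: "aexp \<Rightarrow> store \<Rightarrow> nat" where
  "acost (Const k) s = bits k"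
| "acost (Read a e) s = acost e s + bits (aval (Read a e) s)"
| "acost (Plus e1 e2) s = acost e1 s + acost e2 s + bits (aval (Plus e1 e2) s)"
| "acost (Monus e1 e2) s = acost e1 s + acost e2 s + bits (aval (Monus e1 e2) s)"
| "acost (Times e1 e2) s = acost e1 s + acost e2 s + bits (aval (Times e1 e2) s)"
| "acost (Quot e1 e2) s = acost e1 s + acost e2 s + bits (aval (Quot e1 e2) s)"

text \<open>\<open>exec c s t s'\<close>: started in \<open>s\<close>, the program \<open>c\<close> halts in \<open>s'\<close> after time \<open>t\<close>.\<close>

inductive exec :: "com \<Rightarrow> store \<Rightarrow> nat \<Rightarrow> store \<Rightarrow> bool" where
  Skip: "exec Skip s 1 s"
| Write: "exec (Write a i e) s (acost i s + acost e s)
    (s(a := (s a)(aval i s := aval e s)))"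
| Seq: "exec c1 s t1 s1 \<Longrightarrow> exec c2 s1 t2 s2 \<Longrightarrow> exec (Seq c1 c2) s (t1 + t2) s2"
| IfTrue: "aval b s \<noteq> 0 \<Longrightarrow> exec c1 s t s' \<Longrightarrow> exec (If b c1 c2) s (acost b s + t) s'"
| IfFalse: "aval b s = 0 \<Longrightarrow> exec c2 s t s' \<Longrightarrow> exec (If b c1 c2) s (acost b s + t) s'"
| WhileFalse: "aval b s = 0 \<Longrightarrow> exec (While b c) s (acost b s) s"
| WhileTrue: "aval b s \<noteq> 0 \<Longrightarrow> exec c s t1 s1 \<Longrightarrow> exec (While b c) s1 t2 s2
    \<Longrightarrow> exec (While b c) s (acost b s + t1 + t2) s2"

inductive_cases exec_SkipE: "exec Skip s t s'"
  and exec_WriteE: "exec (Write a i e) s t s'"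
  and exec_SeqE: "exec (Seq c1 c2) s t s'"
  and exec_IfE: "exec (If b c1 c2) s t s'"
  and exec_WhileE: "exec (While b c) s t s'"

lemma exec_deterministic:
  "exec c s t s' \<Longrightarrow> exec c s u s'' \<Longrightarrow> u = t \<and> s'' = s'"
proof (induction arbitrary: u s'' rule: exec.induct)
  case (Skip s)
  then show ?case by (rule exec_SkipE) simp
next
  case (Write a i e s)
  then show ?case by (rule exec_WriteE) simp
next
  case (Seq c1 s t1 s1 c2 t2 s2)
  from Seq.prems obtain u1 r u2 where "exec c1 s u1 r" "exec c2 r u2 s''" "u = u1 + u2"
    by (rule exec_SeqE)
  with Seq.IH show ?case by metis
next
  case (IfTrue b s c1 t s' c2)
  from IfTrue.prems IfTrue.hyps(1) obtain u1 where "exec c1 s u1 s''" "u = acost b s + u1"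
    by (elim exec_IfE) auto
  with IfTrue.IH show ?case by metis
next
  case (IfFalse b s c2 t s' c1)
  from IfFalse.prems IfFalse.hyps(1) obtain u1 where "exec c2 s u1 s''" "u = acost b s + u1"
    by (elim exec_IfE) auto
  with IfFalse.IH show ?case by metis
next
  case (WhileFalse b s c)
  from WhileFalse.prems show ?case
    by (rule exec_WhileE) (use WhileFalse.hyps in simp_all)
next
  case (WhileTrue b s c t1 s1 t2 s2)
  from WhileTrue.prems obtain u1 r u2
    where "exec c s u1 r" "exec (While b c) r u2 s''" "u = acost b s + u1 + u2"
    by (rule exec_WhileE) (use WhileTrue.hyps(1) in simp_all)
  with WhileTrue.IH show ?case by metis
qed

text \<open>The input is a word over the natural numbers stored in array \<open>0\<close>, all other cells being
  \<open>0\<close>; its size is its total binary length. The output is read off array \<open>1\<close>.\<close>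

definition input_store :: "nat list \<Rightarrow> store" where
  "input_store xs = (\<lambda>a i. if a = 0 \<and> i < length xs then xs ! i else 0)"

definition input_size :: "nat list \<Rightarrow> nat" where
  "input_size xs = (\<Sum>x\<leftarrow>xs. bits x)"

definition output_word :: "nat \<Rightarrow> store \<Rightarrow> nat list" where
  "output_word n s = map (s 1) [0..<n]"

definition polynomial_time_on :: "nat list set \<Rightarrow> com \<Rightarrow> bool" where
  "polynomial_time_on D c \<longleftrightarrow>
    (\<exists>q :: nat poly. \<forall>xs\<in>D. \<exists>t s. exec c (input_store xs) t s \<and> t \<le> poly q (input_size xs))"


section \<open>Scheduling on uniform machines with bipartite incompatibility graphs\<close>

text \<open>Jobs are numbered \<open>0..<n\<close> and machines \<open>0..<m\<close>. The speeds are rational so that an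
  instance is a finite object. An edge of the incompatibility graph is a two-element set
  of jobs.\<close>

record sched_inst =
  requirements :: "nat list"
  speeds :: "rat list"
  incompat :: "nat set set"

definition jobs :: "sched_inst \<Rightarrow> nat set" where
  "jobs I = {..<length (requirements I)}"

definition machines :: "sched_inst \<Rightarrow> nat set" where
  "machines I = {..<length (speeds I)}"

definition bipartite_graph :: "'a set \<Rightarrow> 'a set set \<Rightarrow> bool" where
  "bipartite_graph V E \<longleftrightarrow>
    (\<exists>A B. A \<union> B = V \<and> A \<inter> B = {} \<and> (\<forall>e\<in>E. \<exists>a\<in>A. \<exists>b\<in>B. e = {a, b}))"

definition independent_set :: "'a set set \<Rightarrow> 'a set \<Rightarrow> bool" where
  "independent_set E S \<longleftrightarrow> (\<forall>e\<in>E. \<not> e \<subseteq> S)"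

definition bipartite_instance :: "sched_inst \<Rightarrow> bool" where
  "bipartite_instance I \<longleftrightarrow>
    (\<forall>p\<in>set (requirements I). p > 0) \<and>
    speeds I \<noteq> [] \<and> sorted_wrt (\<ge>) (speeds I) \<and> (\<forall>v\<in>set (speeds I). v \<ge> 1) \<and>
    bipartite_graph (jobs I) (incompat I)"

text \<open>A schedule is the list of the machines to which the jobs are assigned.\<close>

definition jobs_on :: "sched_inst \<Rightarrow> nat list \<Rightarrow> nat \<Rightarrow> nat set" where
  "jobs_on I \<sigma> i = {j \<in> jobs I. \<sigma> ! j = i}"

definition feasible_schedules :: "sched_inst \<Rightarrow> nat list set" where
  "feasible_schedules I =
    {\<sigma>. length \<sigma> = length (requirements I) \<and> set \<sigma> \<subseteq> machines I \<and>
      (\<forall>i\<in>machines I. independent_set (incompat I) (jobs_on I \<sigma> i))}"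

definition makespan :: "sched_inst \<Rightarrow> nat list \<Rightarrow> real" where
  "makespan I \<sigma> =
    Max ((\<lambda>i. \<Sum>j\<in>jobs_on I \<sigma> i. real (requirements I ! j) / real_of_rat (speeds I ! i)) ` machines I)"

text \<open>If there is no feasible schedule (which for bipartite graphs happens only for a single
  machine and a nonempty edge set), this value is unspecified.\<close>

definition opt_makespan :: "sched_inst \<Rightarrow> real" where
  "opt_makespan I = Min (makespan I ` feasible_schedules I)"

definition p_sum :: "sched_inst \<Rightarrow> nat" where
  "p_sum I = sum_list (requirements I)"

lemma finite_feasible_schedules: "finite (feasible_schedules I)"
  by (rule finite_subset[OF _ finite_lists_length_eq[of "machines I" "length (requirements I)"]])
    (auto simp: feasible_schedules_def machines_def)

lemma opt_makespan_attained:
  assumes "feasible_schedules I \<noteq> {}"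
  obtains \<sigma> where "\<sigma> \<in> feasible_schedules I" "makespan I \<sigma> = opt_makespan I"
    "\<And>\<tau>. \<tau> \<in> feasible_schedules I \<Longrightarrow> opt_makespan I \<le> makespan I \<tau>"
proof -
  have fin: "finite (makespan I ` feasible_schedules I)"
    by (simp add: finite_feasible_schedules)
  with assms have "opt_makespan I \<in> makespan I ` feasible_schedules I"
    unfolding opt_makespan_def by (intro Min_in) auto
  then obtain \<sigma> where "\<sigma> \<in> feasible_schedules I" "makespan I \<sigma> = opt_makespan I"
    by (elim imageE) simp
  moreover have "opt_makespan I \<le> makespan I \<tau>" if "\<tau> \<in> feasible_schedules I" for \<tau>
    unfolding opt_makespan_def by (rule Min_le[OF fin]) (rule imageI[OF that])
  ultimately show thesis
    by (rule that)
qed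

text \<open>The numbers of jobs and machines, the processing requirements, the speeds as reduced
  fractions, and the adjacency matrix row by row.\<close>

definition encode :: "sched_inst \<Rightarrow> nat list" where
  "encode I =
    (let n = length (requirements I) in
      [n, length (speeds I)] @ requirements I @
      concat (map (\<lambda>v. let (a, b) = quotient_of v in [nat a, nat b]) (speeds I)) @
      concat (map (\<lambda>u. map (\<lambda>v. if {u, v} \<in> incompat I then 1 else 0) [0..<n]) [0..<n]))"

end

theory Submission
  imports Defs
begin

text \<open>
  Let \<open>r\<close> be the square root of \<open>p_sum\<close>, \<open>C\<close> the optimal makespan and \<open>f i\<close> the work that machine
  \<open>i\<close> (counted from \<open>0\<close>) can do in time \<open>C\<close>. An optimal schedule uses only machines with
  \<open>f i \<ge> 1\<close>. If \<open>p_sum < 100\<close>, there are fewer than 100 jobs and all schedules can be tried in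
  polynomial time. Otherwise the best of three schedules is taken.

  The first one 2-colours every component, with the heavier class on machine \<open>0\<close> and the lighter
  one on machine \<open>1\<close>. It is good if \<open>f 0 \<ge> r\<close> and \<open>f 1 \<ge> r / 2\<close>, and also if the optimum uses at
  most two machines, since it minimises the load of machine \<open>1\<close> among all 2-colourings.

  If \<open>f 0 \<ge> r\<close> and \<open>f 1 < r / 2\<close>, machine \<open>0\<close> may take any independent set of jobs, and the jobs
  that the optimum puts elsewhere form a vertex cover of jobs smaller than \<open>r / 2\<close>. The local ratio
  method finds a cover each of whose two colour classes weighs no more than this one. The classes
  are distributed greedily, one to the machines of odd and one to those of positive even number.
  If \<open>f 0 < r\<close>, all jobs are smaller than \<open>r\<close>, and all of them are distributed in this way, those
  of size at least \<open>r / 2\<close> first. In both cases a job that would exceed the makespan \<open>r * C\<close>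
  everywhere finds its machines filled beyond the total weight of its colour class.
\<close>

section \<open>Loop programs\<close>

text \<open>The optimal makespan is never guessed: \<open>C\<close> and \<open>f\<close> occur only
  in the analysis, which is why all candidates are built and the best is kept.

  Why the greedy step works: let A be the machines of one parity with \<open>f i \<ge> 1\<close>,
  and S the sum of \<open>f\<close> over A, so that A has at most S members. If a job of size q fits
  nowhere on A, then r * S is at most the load on A plus card A * q. For q < r / 2 the load on A is
  thus at least r * S / 2. But it belongs to one colour class, of weight at most 2 * S up to terms
  of order r, since the two parities of a decreasing sequence are nearly balanced. The gap is a
  factor of order r, and 100 makes r large enough. Jobs of size between r / 2 and r would spoil
  this; placed first, they are charged to the big jobs already present on every machine of A.

  As the colours use disjoint machines, a cover has to be light only in each colour. So the factor 2
  of a local ratio cover costs nothing, and no minimum weight cover is computed.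

  The running time is settled by syntax: loop limits are fixed on entry, and stored values are never
  products.\<close>

datatype prog =
    Nop
  | Assign nat aexp aexp
  | Comp prog prog (infixr ";;" 60)
  | Cond aexp prog prog
  | For nat nat prog

abbreviation cell :: "nat \<Rightarrow> aexp" where
  "cell a \<equiv> Read a (Const 0)"

text \<open>Array \<open>2\<close> is reserved for loop bounds: the loop \<open>For v c p\<close> counts cell \<open>0\<close> of array \<open>v\<close>
  from \<open>0\<close> up to the content of cell \<open>c\<close> of array \<open>2\<close>.\<close>

fun compile :: "prog \<Rightarrow> com" where
  "compile Nop = Skip"
| "compile (Assign a i e) = Write a i e"
| "compile (p ;; q) = Seq (compile p) (compile q)"
| "compile (Cond b p q) = If b (compile p) (compile q)"
| "compile (For v c p) =
    Seq (Write v (Const 0) (Const 0))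
      (While (Monus (Read 2 (Const c)) (cell v))
        (Seq (compile p) (Write v (Const 0) (Plus (cell v) (Const 1)))))"

definition upd :: "nat \<Rightarrow> nat \<Rightarrow> nat \<Rightarrow> store \<Rightarrow> store" where
  "upd a i x s = s(a := (s a)(i := x))"

lemma upd_apply: "upd a i x s b = (if b = a then (s a)(i := x) else s b)"
  by (simp add: upd_def)

lemma upd_same [simp]: "upd a i x s a = (s a)(i := x)"
  by (simp add: upd_def)

lemma upd_other [simp]: "b \<noteq> a \<Longrightarrow> upd a i x s b = s b"
  by (simp add: upd_def)

text \<open>A loop fixes its number of rounds on entry and ignores what the body does to its
  counter. This agrees with the compiled while loop if the body writes neither array
  \<open>2\<close> nor the counter, which is what \<open>wf_prog\<close> secures.\<close>

fun run :: "prog \<Rightarrow> store \<Rightarrow> store" where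
  "run Nop s = s"
| "run (Assign a i e) s = upd a (aval i s) (aval e s) s"
| "run (p ;; q) s = run q (run p s)"
| "run (Cond b p q) s = (if aval b s \<noteq> 0 then run p s else run q s)"
| "run (For v c p) s = ((\<lambda>s. upd v 0 (s v 0 + 1) (run p s)) ^^ s 2 c) (upd v 0 0 s)"

declare run.simps(5) [simp del]

fun writes :: "prog \<Rightarrow> nat set" where
  "writes Nop = {}"
| "writes (Assign a i e) = {a}"
| "writes (p ;; q) = writes p \<union> writes q"
| "writes (Cond b p q) = writes p \<union> writes q"
| "writes (For v c p) = insert v (writes p)"

text \<open>The value of an additive expression is only a constant number of bits longer than the
  memory cells; products are harmless in addresses and subtrahends. If only such values are
  stored, memory cells remain polynomially long in the number of steps, whatever the program
  computes.\<close>

fun additive_aexp :: "aexp \<Rightarrow> bool" where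
  "additive_aexp (Const k) = True"
| "additive_aexp (Read a e) = True"
| "additive_aexp (Plus e1 e2) = (additive_aexp e1 \<and> additive_aexp e2)"
| "additive_aexp (Monus e1 e2) = additive_aexp e1"
| "additive_aexp (Times e1 e2) = False"
| "additive_aexp (Quot e1 e2) = additive_aexp e1"

fun wf_prog :: "prog \<Rightarrow> bool" where
  "wf_prog Nop = True"
| "wf_prog (Assign a i e) = (a \<noteq> 2 \<and> additive_aexp e)"
| "wf_prog (p ;; q) = (wf_prog p \<and> wf_prog q)"
| "wf_prog (Cond b p q) = (wf_prog p \<and> wf_prog q)"
| "wf_prog (For v c p) = (v \<noteq> 2 \<and> v \<notin> writes p \<and> wf_prog p)"

lemma wf_prog_writes: "wf_prog p \<Longrightarrow> 2 \<notin> writes p"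
  by (induction p) auto

lemma run_frame: "a \<notin> writes p \<Longrightarrow> run p s a = s a"
proof (induction p arbitrary: s)
  case (For v c p)
  have "((\<lambda>s. upd v 0 (s v 0 + 1) (run p s)) ^^ k) s' a = s' a" for k s'
    using For by (induction k) auto
  with For.prems show ?case by (simp add: run.simps(5))
qed auto

text \<open>\<open>indep\<close> makes the invariant blind to the counter, which is incremented
  between rounds. The frame facts offered to \<open>step\<close> keep unmodified arrays out of the
  invariants.\<close>

lemma run_For_induct:
  assumes "v \<notin> writes p" "s 2 c = N"
    and base: "I 0 s"
    and indep: "\<And>i s k. I i (upd v 0 k s) = I i s"
    and step: "\<And>i s'. i < N \<Longrightarrow> I i s' \<Longrightarrow> s' v 0 = i
      \<Longrightarrow> (\<And>a. a \<noteq> v \<Longrightarrow> a \<notin> writes p \<Longrightarrow> s' a = s a) \<Longrightarrow> I (Suc i) (run p s')"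
  shows "I N (run (For v c p) s)"
proof -
  let ?f = "\<lambda>s. upd v 0 (s v 0 + 1) (run p s)"
  let ?s = "\<lambda>i. (?f ^^ i) (upd v 0 0 s)"
  have "i \<le> N \<Longrightarrow> I i (?s i) \<and> ?s i v 0 = i \<and>
      (\<forall>a. a \<noteq> v \<longrightarrow> a \<notin> writes p \<longrightarrow> ?s i a = s a)" for i
  proof (induction i)
    case 0
    then show ?case using base indep by simp
  next
    case (Suc i)
    then have "I (Suc i) (run p (?s i))"
      by (intro step) auto
    then show ?case
      using Suc indep assms(1) by (simp add: run_frame)
  qed
  then show ?thesis
    using assms(2) by (simp add: run.simps(5))
qed

section \<open>Polynomial running time of loop programs\<close>

definition poly_bounded :: "(nat \<Rightarrow> nat) \<Rightarrow> bool" where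
  "poly_bounded f \<longleftrightarrow> (\<exists>q :: nat poly. \<forall>x. f x \<le> poly q x)"

lemma poly_bounded_const [intro]: "poly_bounded (\<lambda>x. c)"
  unfolding poly_bounded_def by (rule exI[of _ "[:c:]"]) simp

lemma poly_bounded_id [intro]: "poly_bounded (\<lambda>x. x)"
  unfolding poly_bounded_def by (rule exI[of _ "[:0, 1:]"]) simp

lemma poly_bounded_add [intro]:
  assumes "poly_bounded f" "poly_bounded g"
  shows "poly_bounded (\<lambda>x. f x + g x)"
proof -
  obtain p q where "\<And>x. f x \<le> poly p x" "\<And>x. g x \<le> poly q x"
    using assms unfolding poly_bounded_def by blast
  then show ?thesis unfolding poly_bounded_def
    by (intro exI[of _ "p + q"]) (simp add: add_mono)
qed

lemma poly_bounded_mult [intro]: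
  assumes "poly_bounded f" "poly_bounded g"
  shows "poly_bounded (\<lambda>x. f x * g x)"
proof -
  obtain p q where "\<And>x. f x \<le> poly p x" "\<And>x. g x \<le> poly q x"
    using assms unfolding poly_bounded_def by blast
  then show ?thesis unfolding poly_bounded_def
    by (intro exI[of _ "p * q"]) (simp add: mult_mono)
qed

lemma poly_bounded_power [intro]: "poly_bounded f \<Longrightarrow> poly_bounded (\<lambda>x. f x ^ k)"
  by (induction k) (auto)

lemma poly_nat_mono: "(x :: nat) \<le> y \<Longrightarrow> poly q x \<le> poly q y"
  by (induction q) (auto intro!: add_mono mult_mono)

text \<open>Since only upper bounds are known, composition relies on polynomials with natural
  coefficients being monotone.\<close>

lemma poly_bounded_compose:
  assumes "poly_bounded f" "poly_bounded g"
  shows "poly_bounded (\<lambda>x. f (g x))"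
proof -
  obtain p q where pq: "\<And>x. f x \<le> poly p x" "\<And>x. g x \<le> poly q x"
    using assms unfolding poly_bounded_def by blast
  have "f (g x) \<le> poly (pcompose p q) x" for x
    using pq(1)[of "g x"] poly_nat_mono[OF pq(2)[of x], of p] by (simp add: poly_pcompose)
  then show ?thesis unfolding poly_bounded_def by blast
qed

section \<open>Lengths of values and costs of expressions\<close>

lemma bits_le: "x \<le> 2 ^ k \<Longrightarrow> bits x \<le> Suc k"
proof -
  assume "x \<le> 2 ^ k"
  also have "(2 :: nat) ^ k < 2 ^ Suc k" by simp
  finally have "floorlog 2 x \<le> Suc k" using floorlog_le_iff[of 2 x "Suc k"] by simp
  then show ?thesis by (simp add: bits_def)
qed

lemma less_two_power_bits: "x < 2 ^ bits x"
proof -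
  have "x < 2 ^ floorlog 2 x"
    using floorlog_le_iff[of 2 x "floorlog 2 x"] by simp
  also have "\<dots> \<le> 2 ^ bits x"
    unfolding bits_def by (intro power_increasing) auto
  finally show ?thesis .
qed

text \<open>Evaluation may multiply the bit length by a constant, products included. This is good
  enough for costs, but not for stored values, whose lengths would be multiplied again in every
  round of a loop.\<close>

fun aexp_weight :: "aexp \<Rightarrow> nat" where
  "aexp_weight (Const k) = Suc k"
| "aexp_weight (Read a e) = 1"
| "aexp_weight (Plus e1 e2) = aexp_weight e1 + aexp_weight e2"
| "aexp_weight (Monus e1 e2) = aexp_weight e1 + aexp_weight e2"
| "aexp_weight (Times e1 e2) = aexp_weight e1 + aexp_weight e2"
| "aexp_weight (Quot e1 e2) = aexp_weight e1 + aexp_weight e2"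

fun aexp_cost :: "aexp \<Rightarrow> nat" where
  "aexp_cost (Const k) = k + 2"
| "aexp_cost (Read a e) = aexp_cost e + 2"
| "aexp_cost (Plus e1 e2) = aexp_cost e1 + aexp_cost e2 + aexp_weight (Plus e1 e2) + 1"
| "aexp_cost (Monus e1 e2) = aexp_cost e1 + aexp_cost e2 + aexp_weight (Monus e1 e2) + 1"
| "aexp_cost (Times e1 e2) = aexp_cost e1 + aexp_cost e2 + aexp_weight (Times e1 e2) + 1"
| "aexp_cost (Quot e1 e2) = aexp_cost e1 + aexp_cost e2 + aexp_weight (Quot e1 e2) + 1"

text \<open>Bits added to the length, so that they accumulate only linearly over the rounds of a
  loop. The value for \<open>Times\<close> is a dummy: in an additive expression, products occur
  only in addresses, subtrahends and divisors, where the recursion does not go.\<close>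

fun aexp_growth :: "aexp \<Rightarrow> nat" where
  "aexp_growth (Const k) = k"
| "aexp_growth (Read a e) = 0"
| "aexp_growth (Plus e1 e2) = Suc (aexp_growth e1 + aexp_growth e2)"
| "aexp_growth (Monus e1 e2) = aexp_growth e1"
| "aexp_growth (Times e1 e2) = 0"
| "aexp_growth (Quot e1 e2) = aexp_growth e1"

definition bounded_store :: "nat \<Rightarrow> store \<Rightarrow> bool" where
  "bounded_store L s \<longleftrightarrow> (\<forall>a i. s a i \<le> 2 ^ L)"

lemma bounded_store_mono: "bounded_store L s \<Longrightarrow> L \<le> L' \<Longrightarrow> bounded_store L' s"
  unfolding bounded_store_def by (meson order_trans power_increasing one_le_numeral)

lemma bounded_store_upd:
  "bounded_store L s \<Longrightarrow> x \<le> 2 ^ L \<Longrightarrow> bounded_store L (upd a i x s)"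
  unfolding bounded_store_def by (simp add: upd_apply)

lemma two_power_add_le: "a \<ge> 1 \<Longrightarrow> b \<ge> 1 \<Longrightarrow> (2 :: nat) ^ a + 2 ^ b \<le> 2 ^ (a + b)"
proof -
  assume "a \<ge> 1" "b \<ge> 1"
  then have "(2 :: nat) ^ 1 \<le> 2 ^ a" "(2 :: nat) ^ 1 \<le> 2 ^ b"
    by (intro power_increasing; simp)+
  then obtain x y where "(2 :: nat) ^ a = 2 + x" "(2 :: nat) ^ b = 2 + y"
    by (metis le_Suc_ex power_one_right)
  then show ?thesis by (simp add: power_add)
qed

lemma aexp_weight_pos: "aexp_weight e \<ge> 1"
  by (induction e) auto

lemma aval_le:
  assumes "bounded_store L s" "L \<ge> 1"
  shows "aval e s \<le> 2 ^ (L * aexp_weight e)"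
proof (induction e)
  case (Const k)
  have "k \<le> 2 ^ k" by (simp add: less_imp_le)
  also have "\<dots> \<le> 2 ^ (L * Suc k)"
    by (intro power_increasing) (use \<open>L \<ge> 1\<close> in \<open>auto simp: trans_le_add2\<close>)
  finally show ?case by simp
next
  case (Read a e)
  then show ?case using assms by (simp add: bounded_store_def)
next
  case (Plus e1 e2)
  have "2 ^ (L * aexp_weight e1) + 2 ^ (L * aexp_weight e2)
      \<le> (2 :: nat) ^ (L * aexp_weight e1 + L * aexp_weight e2)"
    using aexp_weight_pos[of e1] aexp_weight_pos[of e2] \<open>L \<ge> 1\<close>
    by (intro two_power_add_le) auto
  then show ?case using Plus by (simp add: distrib_left)
next
  case (Monus e1 e2)
  have "(2 :: nat) ^ (L * aexp_weight e1) \<le> 2 ^ (L * aexp_weight (Monus e1 e2))"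
    by (intro power_increasing) auto
  then show ?case using Monus by (metis aval.simps(4) diff_le_self order_trans)
next
  case (Times e1 e2)
  then show ?case by (simp add: distrib_left power_add mult_mono)
next
  case (Quot e1 e2)
  have "(2 :: nat) ^ (L * aexp_weight e1) \<le> 2 ^ (L * aexp_weight (Quot e1 e2))"
    by (intro power_increasing) auto
  moreover have "aval (Quot e1 e2) s \<le> aval e1 s" by simp
  ultimately show ?case using Quot by linarith
qed

lemma acost_le:
  assumes "bounded_store L s" "L \<ge> 1"
  shows "acost e s \<le> aexp_cost e * L"
proof -
  have b: "bits (aval e s) \<le> (aexp_weight e + 1) * L" for e
    using bits_le[OF aval_le[OF assms, of e]] \<open>L \<ge> 1\<close> by (simp add: algebra_simps)
  show ?thesis
  proof (induction e)
    case (Const k)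
    then show ?case using b[of "Const k"] by simp
  next
    case (Read a e)
    then show ?case using b[of "Read a e"] by (simp add: algebra_simps)
  next
    case (Plus e1 e2)
    then show ?case using b[of "Plus e1 e2"] by (simp add: algebra_simps)
  next
    case (Monus e1 e2)
    then show ?case using b[of "Monus e1 e2"] by (simp add: algebra_simps)
  next
    case (Times e1 e2)
    then show ?case using b[of "Times e1 e2"] by (simp add: algebra_simps)
  next
    case (Quot e1 e2)
    then show ?case using b[of "Quot e1 e2"] by (simp add: algebra_simps)
  qed
qed

lemma aval_additive_le:
  assumes "bounded_store L s" "additive_aexp e"
  shows "aval e s \<le> 2 ^ (L + aexp_growth e)"
  using assms(2)
proof (induction e)
  case (Const k)
  have "k \<le> 2 ^ k" by (simp add: less_imp_le)
  also have "\<dots> \<le> 2 ^ (L + k)"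
    by (intro power_increasing) auto
  finally show ?case by simp
next
  case (Read a e)
  then show ?case using assms by (simp add: bounded_store_def)
next
  case (Plus e1 e2)
  have "(2 :: nat) ^ (L + aexp_growth e1) \<le> 2 ^ (L + (aexp_growth e1 + aexp_growth e2))"
    "(2 :: nat) ^ (L + aexp_growth e2) \<le> 2 ^ (L + (aexp_growth e1 + aexp_growth e2))"
    by (intro power_increasing; simp)+
  then show ?case using Plus by (simp add: mult_2 add_mono order_trans[OF add_mono])
next
  case (Quot e1 e2)
  moreover have "aval (Quot e1 e2) s \<le> aval e1 s" by simp
  ultimately show ?case by (metis additive_aexp.simps(6) aexp_growth.simps(6) order_trans)
qed auto

declare acost.simps [simp del]

text \<open>\<open>growth p N\<close> bounds the number of bits by which memory cells get longer, and
  \<open>run_time p N\<close> the running time per bit of the initial memory cells, if no loop is iterated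
  more than \<open>N\<close> times.\<close>

fun growth :: "prog \<Rightarrow> nat \<Rightarrow> nat" where
  "growth Nop N = 0"
| "growth (Assign a i e) N = aexp_growth e"
| "growth (p ;; q) N = growth p N + growth q N"
| "growth (Cond b p q) N = growth p N + growth q N"
| "growth (For v c p) N = N * (growth p N + 1)"

fun run_time :: "prog \<Rightarrow> nat \<Rightarrow> nat" where
  "run_time Nop N = 1"
| "run_time (Assign a i e) N = aexp_cost i + aexp_cost e"
| "run_time (p ;; q) N = run_time p N + run_time q N * (1 + growth p N)"
| "run_time (Cond b p q) N = aexp_cost b + run_time p N + run_time q N"
| "run_time (For v c p) N = 2 +
    (N + 1) * ((c + 24 + run_time p N + 13 * growth p N) * (1 + N * (growth p N + 1)))"

lemma poly_bounded_growth [intro]: "poly_bounded (\<lambda>N. growth p N)"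
  by (induction p) (simp_all del: mult_Suc_right add_Suc_right
    add: poly_bounded_mult poly_bounded_add poly_bounded_id poly_bounded_const)

lemma poly_bounded_run_time [intro]: "poly_bounded (\<lambda>N. run_time p N)"
proof (induction p)
  case Nop
  show ?case unfolding run_time.simps by (rule poly_bounded_const)
next
  case (Assign a i e)
  show ?case unfolding run_time.simps by (rule poly_bounded_const)
next
  case (Comp p q)
  then show ?case unfolding run_time.simps
    by (intro poly_bounded_add poly_bounded_mult poly_bounded_const poly_bounded_growth)
next
  case (Cond b p q)
  then show ?case unfolding run_time.simps
    by (intro poly_bounded_add poly_bounded_const)
next
  case (For v c p)
  then show ?case unfolding run_time.simps
    by (intro poly_bounded_add poly_bounded_mult poly_bounded_id poly_bounded_const poly_bounded_growth)
qed

lemma exec_Write: "t = acost i s + acost e s \<Longrightarrow> s' = upd a (aval i s) (aval e s) s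
    \<Longrightarrow> exec (Write a i e) s t s'"
  unfolding upd_def using exec.Write by simp

text \<open>Time and memory are bounded together, because the second part of a composition runs in
  memory that the first part has lengthened. The bound \<open>N\<close> on the loop limits persists,
  as array \<open>2\<close> is not written.\<close>

theorem exec_compile:
  assumes "wf_prog p" "bounded_store L s" "L \<ge> 1" "\<And>c. s 2 c \<le> N"
  shows "(\<exists>t. exec (compile p) s t (run p s) \<and> t \<le> run_time p N * L)
    \<and> bounded_store (L + growth p N) (run p s)"
  using assms
proof (induction p arbitrary: s L)
  case Nop
  then show ?case using exec.Skip by auto
next
  case (Assign a i e)
  then have "bounded_store (L + aexp_growth e) s" "aval e s \<le> 2 ^ (L + aexp_growth e)"
    by (auto intro: bounded_store_mono aval_additive_le)
  then show ?case
    using Assign.prems acost_le[of L s i] acost_le[of L s e]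
    by (auto intro!: exI[of _ "acost i s + acost e s"] exec_Write bounded_store_upd simp: distrib_right)
next
  case (Comp p q)
  let ?L = "L + growth p N"
  obtain t1 where t1: "exec (compile p) s t1 (run p s)" "t1 \<le> run_time p N * L"
    and b: "bounded_store ?L (run p s)"
    using Comp.IH(1)[of L s] Comp.prems by auto
  have "run p s 2 = s 2"
    using Comp.prems(1) by (intro run_frame) (simp add: wf_prog_writes)
  then obtain t2 where t2: "exec (compile q) (run p s) t2 (run q (run p s))"
      "t2 \<le> run_time q N * ?L"
    and b2: "bounded_store (?L + growth q N) (run q (run p s))"
    using Comp.IH(2)[of ?L "run p s"] Comp.prems b by auto
  have "?L \<le> (1 + growth p N) * L"
    using \<open>L \<ge> 1\<close> by simp
  then have "run_time q N * ?L \<le> run_time q N * ((1 + growth p N) * L)"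
    by (rule mult_le_mono2)
  then have "t1 + t2 \<le> run_time p N * L + run_time q N * ((1 + growth p N) * L)"
    using t1(2) t2(2) by linarith
  then have "t1 + t2 \<le> run_time (p ;; q) N * L"
    by (simp only: run_time.simps distrib_right mult.assoc)
  then show ?case
    using exec.Seq[OF t1(1) t2(1)] b2 by (auto simp: add.assoc)
next
  case (Cond b p q)
  have c: "acost b s \<le> aexp_cost b * L"
    using Cond.prems by (intro acost_le)
  show ?case
  proof (cases "aval b s = 0")
    case True
    obtain t where "exec (compile q) s t (run q s)" "t \<le> run_time q N * L"
      and bd: "bounded_store (L + growth q N) (run q s)"
      using Cond.IH(2)[of L s] Cond.prems by auto
    then have "exec (compile (Cond b p q)) s (acost b s + t) (run (Cond b p q) s)"
      and "acost b s + t \<le> run_time (Cond b p q) N * L"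
      using True c unfolding run_time.simps distrib_right by (auto intro: exec.IfFalse)
    then show ?thesis
      using True bd by (auto intro: bounded_store_mono)
  next
    case False
    obtain t where "exec (compile p) s t (run p s)" "t \<le> run_time p N * L"
      and bd: "bounded_store (L + growth p N) (run p s)"
      using Cond.IH(1)[of L s] Cond.prems by auto
    then have "exec (compile (Cond b p q)) s (acost b s + t) (run (Cond b p q) s)"
      and "acost b s + t \<le> run_time (Cond b p q) N * L"
      using False c unfolding run_time.simps distrib_right by (auto intro: exec.IfTrue)
    then show ?thesis
      using False bd by (auto intro: bounded_store_mono)
  qed
next
  case (For v c p)
  define g where "g = growth p N"
  define n where "n = s 2 c"
  define F where "F = (\<lambda>s. upd v 0 (s v 0 + 1) (run p s))"
  define S where "S = (\<lambda>i. (F ^^ i) (upd v 0 0 s))"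
  define G where "G = Monus (Read 2 (Const c)) (cell v)"
  define Inc where "Inc = Plus (cell v) (Const 1)"
  define loop where "loop = While G (Seq (compile p) (Write v (Const 0) Inc))"
  have costs: "aexp_cost G = c + 11" "aexp_cost (Const 0) = 2" "aexp_cost Inc = 11"
    by (simp_all add: G_def Inc_def)
  define L' where "L' = (1 + N * (g + 1)) * L"
  \<comment> \<open>Per bit, the guard costs \<open>c + 11\<close> and the counter update
    \<open>2 + 11\<close>. The update sees memory that the body has lengthened by up to
    \<open>g\<close> bits, which accounts for \<open>13 * g\<close>.\<close>
  define K where "K = c + 24 + run_time p N + 13 * g"
  have wf: "v \<noteq> 2" "v \<notin> writes p" "wf_prog p" "2 \<notin> writes p"
    using For.prems(1) by (auto dest: wf_prog_writes)
  have nN: "n \<le> N" using For.prems by (simp add: n_def)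
  have S2: "S i 2 = s 2" for i
    by (induction i) (auto simp: S_def F_def run_frame wf)
  have Sv: "S i v 0 = i" for i
    by (induction i) (auto simp: S_def F_def run_frame wf)
  have SSuc: "S (Suc i) = upd v 0 (Suc i) (run p (S i))" for i
    using Sv[of i] by (simp add: S_def F_def)
  have IH: "(\<exists>t. exec (compile p) (S i) t (run p (S i)) \<and> t \<le> run_time p N * l)
      \<and> bounded_store (l + g) (run p (S i))" if "bounded_store l (S i)" "l \<ge> 1" for i l
    using For.IH[of l "S i"] that wf For.prems(4) by (simp add: S2 g_def)
  have Sb: "bounded_store (L + i * (g + 1)) (S i)" for i
  proof (induction i)
    case 0
    then show ?case using For.prems by (simp add: S_def bounded_store_upd)
  next
    case (Suc i)
    have "bounded_store (L + i * (g + 1) + g) (run p (S i))"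
      using IH[OF Suc] \<open>L \<ge> 1\<close> by simp
    then have b: "bounded_store (L + Suc i * (g + 1)) (run p (S i))"
      by (rule bounded_store_mono) simp
    have "i \<le> 2 ^ (L + i * (g + 1))"
      using Suc Sv[of i] unfolding bounded_store_def by metis
    moreover have "(1 :: nat) \<le> 2 ^ (L + i * (g + 1))" by simp
    ultimately have "Suc i \<le> 2 ^ Suc (L + i * (g + 1))"
      unfolding power_Suc by linarith
    also have "\<dots> \<le> 2 ^ (L + Suc i * (g + 1))"
      by (intro power_increasing) auto
    finally show ?case
      unfolding SSuc by (rule bounded_store_upd[OF b])
  qed
  have L'1: "L' \<ge> 1" using \<open>L \<ge> 1\<close> by (simp add: L'_def)
  have Sb': "bounded_store L' (S i)" if "i \<le> n" for i
  proof (rule bounded_store_mono[OF Sb])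
    have "i * (g + 1) \<le> N * (g + 1)"
      using that nN by (intro mult_le_mono1) simp
    also have "N * (g + 1) * 1 \<le> N * (g + 1) * L"
      using \<open>L \<ge> 1\<close> by (intro mult_le_mono2)
    finally show "L + i * (g + 1) \<le> L'"
      by (simp only: L'_def distrib_right mult_1 mult_1_right add_le_cancel_left)
  qed
  \<comment> \<open>Induction on the number \<open>j\<close> of rounds still to come, because
    \<open>exec.WhileTrue\<close> peels off the first round.\<close>
  have loop: "\<exists>t. exec loop (S (n - j)) t (S n) \<and> t \<le> (j + 1) * (K * L')" if "j \<le> n" for j
    using that
  proof (induction j)
    case 0
    have "acost G (S n) \<le> (c + 11) * L'"
      using acost_le[OF Sb'[of n] L'1, of G] by (simp only: costs)
    also have "\<dots> \<le> K * L'" by (intro mult_le_mono1) (simp add: K_def)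
    finally have "acost G (S n) \<le> (0 + 1) * (K * L')" by simp
    moreover have "exec loop (S n) (acost G (S n)) (S n)"
      unfolding loop_def by (rule exec.WhileFalse) (simp add: G_def S2 Sv n_def)
    ultimately show ?case by auto
  next
    case (Suc j)
    define i where "i = n - Suc j"
    have i: "i < n" "n - j = Suc i" using Suc.prems by (auto simp: i_def)
    obtain t1 where t1: "exec (compile p) (S i) t1 (run p (S i))" "t1 \<le> run_time p N * L'"
      and b1: "bounded_store (L' + g) (run p (S i))"
      using IH[OF Sb'[of i] L'1] i by auto
    define u where "u = acost (Const 0) (run p (S i)) + acost Inc (run p (S i))"
    have ex: "exec (Write v (Const 0) Inc) (run p (S i)) u (S (Suc i))"
      unfolding u_def by (rule exec_Write) (simp_all add: SSuc run_frame wf Sv Inc_def)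
    have "acost (Const 0) (run p (S i)) \<le> 2 * (L' + g)" "acost Inc (run p (S i)) \<le> 11 * (L' + g)"
      using acost_le[OF b1, of "Const 0"] acost_le[OF b1, of Inc] L'1 unfolding costs
      by (simp_all del: acost.simps)
    moreover obtain h where h: "g * L' = h" by blast
    moreover have "g \<le> h"
      using L'1 h by auto
    ultimately have u: "u \<le> 13 * L' + 13 * h"
      unfolding u_def by simp
    obtain t2 where t2: "exec loop (S (Suc i)) t2 (S n)" "t2 \<le> (j + 1) * (K * L')"
      using Suc.IH[OF Suc_leD[OF Suc.prems]] unfolding i(2) by blast
    have "acost G (S i) \<le> (c + 11) * L'"
      using acost_le[OF Sb'[OF less_imp_le[OF i(1)]] L'1, of G] by (simp only: costs)
    moreover have "K * L' = (c + 11) * L' + (run_time p N * L' + (13 * L' + 13 * h))"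
      by (simp add: K_def h[symmetric] algebra_simps)
    ultimately have "acost G (S i) + (t1 + u) \<le> K * L'"
      using t1(2) u by linarith
    moreover have "(Suc j + 1) * (K * L') = K * L' + (j + 1) * (K * L')"
      by simp
    ultimately have "acost G (S i) + (t1 + u) + t2 \<le> (Suc j + 1) * (K * L')"
      using t2(2) by linarith
    moreover have "exec loop (S i) (acost G (S i) + (t1 + u) + t2) (S n)"
      unfolding loop_def
      by (rule exec.WhileTrue[OF _ exec.Seq[OF t1(1) ex] t2(1)[unfolded loop_def]]) (use i in \<open>simp add: G_def S2 Sv n_def\<close>)
    ultimately show ?case unfolding i_def by blast
  qed
  obtain t where t: "exec loop (S 0) t (S n)" "t \<le> (n + 1) * (K * L')"
    using loop[of n] by auto
  have "exec (Write v (Const 0) (Const 0)) s 2 (S 0)"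
    by (rule exec_Write) (auto simp: S_def bits_def floorlog_def acost.simps)
  moreover have "compile (For v c p) = Seq (Write v (Const 0) (Const 0)) loop"
    by (simp add: loop_def G_def Inc_def)
  moreover have "run (For v c p) s = S n"
    by (simp only: run.simps S_def F_def n_def)
  ultimately have "exec (compile (For v c p)) s (2 + t) (run (For v c p) s)"
    using exec.Seq[OF _ t(1)] by metis
  moreover have "2 + t \<le> run_time (For v c p) N * L"
  proof -
    have "(n + 1) * (K * L') \<le> (N + 1) * (K * L')"
      using nN by (intro mult_le_mono1) simp
    moreover have "(2 + (N + 1) * (K * M)) * L = 2 * L + (N + 1) * (K * (M * L))" for M
      by (simp add: algebra_simps)
    then have "run_time (For v c p) N * L = 2 * L + (N + 1) * (K * L')"
      unfolding run_time.simps L'_def by (simp only: K_def g_def)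
    ultimately show ?thesis using t(2) \<open>L \<ge> 1\<close> by linarith
  qed
  moreover have "bounded_store (L + growth (For v c p) N) (run (For v c p) s)"
    unfolding \<open>run (For v c p) s = S n\<close>
  proof (rule bounded_store_mono[OF Sb])
    show "L + n * (g + 1) \<le> L + growth (For v c p) N"
      using mult_le_mono1[OF nN, of "g + 1"] by (simp only: growth.simps g_def add_le_cancel_left)
  qed
  ultimately show ?case by blast
qed

section \<open>Approximation guarantee\<close>

text \<open>Machine \<open>i\<close> has speed \<open>a i / b i\<close>. Programs handle natural
  numbers only, so speeds are given by numerators and denominators and compared by cross
  multiplication.\<close>

locale scheduling =
  fixes n m :: nat and p a b :: "nat \<Rightarrow> nat" and adj :: "nat \<Rightarrow> nat \<Rightarrow> bool"
  assumes p_pos: "j < n \<Longrightarrow> p j > 0"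
    and m_pos: "m > 0"
    and a_pos: "i < m \<Longrightarrow> a i > 0"
    and b_pos: "i < m \<Longrightarrow> b i > 0"
    and sorted_speeds: "i \<le> k \<Longrightarrow> k < m \<Longrightarrow> a k * b i \<le> a i * b k"
    and adj_sym: "adj u v \<Longrightarrow> adj v u"
    and adj_2colorable: "\<exists>f :: nat \<Rightarrow> bool. \<forall>u<n. \<forall>v<n. adj u v \<longrightarrow> f u \<noteq> f v"
begin

definition proper :: "(nat \<Rightarrow> bool) \<Rightarrow> bool" where
  "proper f \<longleftrightarrow> (\<forall>u<n. \<forall>v<n. adj u v \<longrightarrow> f u \<noteq> f v)"

definition total :: nat where
  "total = (\<Sum>j<n. p j)"

definition speed :: "nat \<Rightarrow> real" where
  "speed i = real (a i) / real (b i)"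

text \<open>The set \<open>X\<close> admits partial schedules: greedy decisions depend on the jobs
  placed so far.\<close>

definition load :: "nat set \<Rightarrow> (nat \<Rightarrow> nat) \<Rightarrow> nat \<Rightarrow> nat" where
  "load X \<sigma> i = (\<Sum>j\<in>{j\<in>X. \<sigma> j = i}. p j)"

definition feasible :: "(nat \<Rightarrow> nat) \<Rightarrow> bool" where
  "feasible \<sigma> \<longleftrightarrow> (\<forall>j<n. \<sigma> j < m) \<and> (\<forall>u<n. \<forall>v<n. adj u v \<longrightarrow> \<sigma> u \<noteq> \<sigma> v)"

definition cmax :: "(nat \<Rightarrow> nat) \<Rightarrow> real" where
  "cmax \<sigma> = Max ((\<lambda>i. load {..<n} \<sigma> i / speed i) ` {..<m})"

lemma speed_pos: "i < m \<Longrightarrow> speed i > 0"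
  by (simp add: speed_def a_pos b_pos)

lemma speed_mono: "i \<le> k \<Longrightarrow> k < m \<Longrightarrow> speed k \<le> speed i"
  using sorted_speeds[of i k] b_pos[of i] b_pos[of k]
  by (simp add: speed_def divide_simps flip: of_nat_mult)

lemma cmax_le_iff: "cmax \<sigma> \<le> T \<longleftrightarrow> (\<forall>i<m. load {..<n} \<sigma> i \<le> T * speed i)"
proof -
  have "cmax \<sigma> \<le> T \<longleftrightarrow> (\<forall>i<m. load {..<n} \<sigma> i / speed i \<le> T)"
    unfolding cmax_def using m_pos by (subst Max_le_iff) auto
  also have "\<dots> \<longleftrightarrow> (\<forall>i<m. load {..<n} \<sigma> i \<le> T * speed i)"
    using speed_pos by (auto simp: pos_divide_le_eq)
  finally show ?thesis .
qed

lemma sum_p_mono: "X \<subseteq> Y \<Longrightarrow> finite Y \<Longrightarrow> sum p X \<le> sum p Y"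
  by (rule sum_mono2) auto

lemma load_le_total: "load {..<n} \<sigma> i \<le> total"
  unfolding load_def total_def by (rule sum_p_mono) auto

lemma sum_load: "finite X \<Longrightarrow> finite A \<Longrightarrow> (\<Sum>i\<in>A. load X \<sigma> i) = (\<Sum>j\<in>{j\<in>X. \<sigma> j \<in> A}. p j)"
proof -
  assume "finite X" "finite A"
  then have "(\<Sum>j\<in>{j\<in>X. \<sigma> j \<in> A}. p j)
      = (\<Sum>i\<in>A. \<Sum>j\<in>{j\<in>{j\<in>X. \<sigma> j \<in> A}. \<sigma> j = i}. p j)"
    by (intro sum.group[symmetric]) auto
  also have "\<dots> = (\<Sum>i\<in>A. load X \<sigma> i)"
    unfolding load_def by (intro sum.cong refl arg_cong[of _ _ "sum p"]) auto
  finally show ?thesis by simp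
qed

text \<open>Minimality over all proper colourings is used twice: against the exchanged colouring it
  gives at most half of \<open>total\<close>, and against a schedule on two machines at most the
  load of that schedule on machine \<open>1\<close>.\<close>

definition two_machine_schedule :: "(nat \<Rightarrow> nat) \<Rightarrow> bool" where
  "two_machine_schedule \<sigma> \<longleftrightarrow> (\<forall>j<n. \<sigma> j \<le> 1) \<and> (\<forall>u<n. \<forall>v<n. adj u v \<longrightarrow> \<sigma> u \<noteq> \<sigma> v) \<and>
    (\<forall>f. proper f \<longrightarrow> load {..<n} \<sigma> 1 \<le> (\<Sum>j\<in>{j. j < n \<and> f j}. p j))"

definition coloring :: "(nat \<Rightarrow> nat) \<Rightarrow> bool" where
  "coloring col \<longleftrightarrow> (\<forall>j<n. col j \<le> 1) \<and> (\<forall>u<n. \<forall>v<n. adj u v \<longrightarrow> col u \<noteq> col v)"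

text \<open>Machine \<open>0\<close> is the fastest one. Splitting the others by parity gives each colour about half
  of the capacity, whatever number of machines the optimal schedule uses.\<close>

definition allowed :: "nat \<Rightarrow> nat \<Rightarrow> bool" where
  "allowed c i \<longleftrightarrow> 0 < i \<and> i < m \<and> i mod 2 \<noteq> c"

text \<open>The condition that \<open>p j\<close> is at least r / 2, squared so that it can be
  tested without roots.\<close>

definition big :: "nat \<Rightarrow> bool" where
  "big j \<longleftrightarrow> total \<le> 4 * (p j * p j)"

text \<open>The list is the order of placement, \<open>\<sigma>\<close> the final assignment. If no
  machine is allowed, the choice is free; for the colours 0 and 1 this can happen only if
  \<open>m \<le> 2\<close>.\<close>

inductive greedy :: "(nat \<Rightarrow> nat) \<Rightarrow> (nat \<Rightarrow> nat) \<Rightarrow> nat list \<Rightarrow> bool" for col \<sigma> where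
  Nil: "greedy col \<sigma> []"
| snoc: "greedy col \<sigma> xs \<Longrightarrow> j \<notin> set xs \<Longrightarrow>
    (\<exists>i. allowed (col j) i) \<longrightarrow> allowed (col j) (\<sigma> j) \<and> (\<forall>i. allowed (col j) i \<longrightarrow>
      (load (set xs) \<sigma> (\<sigma> j) + p j) / speed (\<sigma> j) \<le> (load (set xs) \<sigma> i + p j) / speed i)
    \<Longrightarrow> greedy col \<sigma> (xs @ [j])"

definition greedy_schedule :: "(nat \<Rightarrow> nat) \<Rightarrow> nat set \<Rightarrow> (nat \<Rightarrow> nat) \<Rightarrow> bool" where
  "greedy_schedule col X \<sigma> \<longleftrightarrow> X \<subseteq> {..<n} \<and> (\<forall>j<n. j \<notin> X \<longrightarrow> \<sigma> j = 0) \<and>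
    (\<exists>xs ys. set xs = {j\<in>X. big j} \<and> set ys = {j\<in>X. \<not> big j} \<and> greedy col \<sigma> (xs @ ys))"

definition cover :: "nat set \<Rightarrow> bool" where
  "cover X \<longleftrightarrow> X \<subseteq> {..<n} \<and> (\<forall>u<n. \<forall>v<n. adj u v \<longrightarrow> u \<in> X \<or> v \<in> X)"

text \<open>The whole cover may weigh twice as much as \<open>Y\<close>, but neither colour class is
  heavier than \<open>Y\<close>, and the greedy distribution treats the classes separately.
  Comparison with covers free of big jobs is enough, since the jobs that a good schedule keeps off
  machine \<open>0\<close> are such a cover when \<open>f 1 < r / 2\<close>.\<close>

definition balanced_cover :: "(nat \<Rightarrow> nat) \<Rightarrow> nat set \<Rightarrow> bool" where
  "balanced_cover col X \<longleftrightarrow> cover X \<and> (\<forall>Y. cover Y \<and> (\<forall>j\<in>Y. \<not> big j) \<longrightarrow>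
    (\<forall>j\<in>X. \<not> big j) \<and> (\<forall>c\<le>1. (\<Sum>j\<in>{j\<in>X. col j = c}. p j) \<le> (\<Sum>j\<in>Y. p j)))"

section \<open>Greedy distribution: loads and overflow\<close>

lemma load_insert: "finite X \<Longrightarrow> j \<notin> X \<Longrightarrow> load (insert j X) \<sigma> i = load X \<sigma> i + (if \<sigma> j = i then p j else 0)"
proof -
  assume "finite X" "j \<notin> X"
  moreover have "{j' \<in> insert j X. \<sigma> j' = i} = (if \<sigma> j = i then insert j {j\<in>X. \<sigma> j = i} else {j\<in>X. \<sigma> j = i})"
    by auto
  ultimately show ?thesis by (simp add: load_def)
qed

lemma greedy_prefix: "greedy col \<sigma> zs \<Longrightarrow> zs = xs @ ys \<Longrightarrow> greedy col \<sigma> xs"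
proof (induction arbitrary: ys rule: greedy.induct)
  case Nil
  then show ?case by (auto intro: greedy.Nil)
next
  case (snoc zs j)
  then show ?case
    by (cases ys rule: rev_cases) (auto intro: greedy.snoc)
qed

lemma greedy_distinct: "greedy col \<sigma> zs \<Longrightarrow> distinct zs"
  by (induction rule: greedy.induct) auto

lemma allowed_exists: "m \<ge> 3 \<Longrightarrow> c \<le> 1 \<Longrightarrow> allowed c (if c = 0 then 1 else 2)"
  by (auto simp: allowed_def)

lemma greedy_allowed:
  assumes "greedy col \<sigma> zs" "m \<ge> 3" "\<And>j. j \<in> set zs \<Longrightarrow> col j \<le> 1" "j \<in> set zs"
  shows "allowed (col j) (\<sigma> j)"
  using assms(1,3,4)
proof (induction rule: greedy.induct)
  case (snoc xs j')
  then show ?case using allowed_exists[OF assms(2), of "col j'"] by auto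
qed auto

text \<open>The chosen machine finishes no later than any allowed one. So it suffices that each job
  fits on some allowed machine, possibly not the one it is given to.\<close>

lemma greedy_load_le:
  assumes "greedy col \<sigma> zs"
    and "\<And>xs j ys. zs = xs @ j # ys
      \<Longrightarrow> \<exists>i. allowed (col j) i \<and> load (set xs) \<sigma> i + p j \<le> T * speed i"
    and "T \<ge> 0" "0 < i" "i < m"
  shows "load (set zs) \<sigma> i \<le> T * speed i"
  using assms(1,2)
proof (induction rule: greedy.induct)
  case Nil
  then show ?case using assms(3) speed_pos[OF \<open>i < m\<close>] by (simp add: load_def)
next
  case (snoc xs j)
  have IH: "load (set xs) \<sigma> i \<le> T * speed i"
    by (rule snoc.IH) (use snoc.prems in auto)
  obtain i' where i': "allowed (col j) i'" "load (set xs) \<sigma> i' + p j \<le> T * speed i'"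
    using snoc.prems[of xs j "[]"] by auto
  show ?case
  proof (cases "\<sigma> j = i")
    case True
    have "(load (set xs) \<sigma> i + p j) / speed i \<le> (load (set xs) \<sigma> i' + p j) / speed i'"
      using snoc.hyps(3) i'(1) True by auto
    also have "\<dots> \<le> T"
      using i' speed_pos[of i'] by (simp add: allowed_def pos_divide_le_eq)
    finally have "load (set xs) \<sigma> i + p j \<le> T * speed i"
      using speed_pos[OF \<open>i < m\<close>] by (simp add: pos_divide_le_eq)
    then show ?thesis using snoc.hyps(2) True by (simp add: load_insert)
  next
    case False
    then show ?thesis using snoc.hyps(2) IH by (simp add: load_insert)
  qed
qed

text \<open>Pairing odd indices with the following even ones, and even ones with the following odd
  ones, shows that the two sums of a decreasing sequence differ by at most
  \<open>f 1\<close>.\<close>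

lemma alternating_sum_le:
  fixes f :: "nat \<Rightarrow> real"
  assumes "\<And>i. 1 \<le> i \<Longrightarrow> Suc i < k \<Longrightarrow> f (Suc i) \<le> f i" "\<And>i. i < k \<Longrightarrow> 0 \<le> f i" "2 \<le> k" "c \<le> 1"
  shows "(\<Sum>i\<in>{1..<k}. f i) \<le> f 1 + 2 * (\<Sum>i\<in>{i\<in>{1..<k}. i mod 2 \<noteq> c}. f i)"
proof -
  define O' where "O' = (\<lambda>k. \<Sum>i\<in>{1..<k}. if odd i then f i else 0)"
  define E' where "E' = (\<lambda>k. \<Sum>i\<in>{1..<k}. if even i then f i else 0)"
  \<comment> \<open>The slack \<open>f (l - 1)\<close> is carried along to pay for the next term,
    which is of the other parity and no larger.\<close>
  have "E' l \<le> O' l \<and> O' l \<le> f 1 + E' l \<and> (odd (l - 1) \<longrightarrow> E' l + f (l - 1) \<le> O' l)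
      \<and> (even (l - 1) \<longrightarrow> O' l + f (l - 1) \<le> f 1 + E' l)" if "2 \<le> l" "l \<le> k" for l
    using that
  proof (induction l rule: dec_induct)
    case base
    then show ?case using assms(2)[of 1] by (simp add: O'_def E'_def numeral_2_eq_2)
  next
    case (step l)
    have "f l \<le> f (l - 1)" using assms(1)[of "l - 1"] step by simp
    moreover have "O' (Suc l) = O' l + (if odd l then f l else 0)" "E' (Suc l) = E' l + (if even l then f l else 0)"
      using step by (simp_all add: O'_def E'_def)
    moreover have "0 \<le> f l" using assms(2)[of l] step by simp
    moreover have "odd (l - 1) \<longleftrightarrow> even l" using step by auto
    ultimately show ?case using step.IH step.prems by (cases "even l") auto
  qed
  from this[of k] have k: "E' k \<le> O' k" "O' k \<le> f 1 + E' k" using assms(3) by auto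
  have all: "(\<Sum>i\<in>{1..<k}. f i) = O' k + E' k"
    unfolding O'_def E'_def sum.distrib[symmetric] by (rule sum.cong) auto
  have "(\<Sum>i\<in>{i\<in>{1..<k}. i mod 2 \<noteq> c}. f i) = (\<Sum>i\<in>{1..<k}. if i mod 2 \<noteq> c then f i else 0)"
    by (subst sum.inter_filter) auto
  also have "\<dots> = (if c = 0 then O' k else E' k)"
    using assms(4) unfolding O'_def E'_def
    by (auto intro!: sum.cong simp: le_Suc_eq odd_iff_mod_2_eq_one even_iff_mod_2_eq_zero)
  finally show ?thesis using k all assms(2)[of 1] assms(3) by auto
qed


text \<open>Here \<open>f i\<close> is the work that machine \<open>i\<close> can do within the optimal makespan, and the
  assumption \<open>1 \<le> f i\<close> allows the number of machines to be bounded by their capacity.\<close>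

lemma overflow:
  fixes f :: "nat \<Rightarrow> real"
  assumes "m \<ge> 3" "greedy col \<sigma> xs" "j \<notin> set xs" "\<And>j'. j' \<in> set (j # xs) \<Longrightarrow> col j' \<le> 1"
    and "k \<le> m" "2 \<le> k"
    and f: "\<And>i. 1 \<le> i \<Longrightarrow> Suc i < k \<Longrightarrow> f (Suc i) \<le> f i" "\<And>i. i < k \<Longrightarrow> 1 \<le> f i"
    and full: "\<And>i. allowed (col j) i \<Longrightarrow> i < k \<Longrightarrow> r * f i < load (set xs) \<sigma> i + p j"
    and W: "set (j # xs) \<subseteq> X" "finite X" "(\<Sum>j'\<in>{j'\<in>X. col j' = col j}. p j') \<le> W"
  obtains A where "A = {i. allowed (col j) i \<and> i < k}"
    and "(\<Sum>i\<in>A. load (set xs) \<sigma> i) + p j \<le> W"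
    and "r * (\<Sum>i\<in>A. f i) \<le> (\<Sum>i\<in>A. load (set xs) \<sigma> i) + card A * real (p j)"
    and "card A \<le> (\<Sum>i\<in>A. f i)"
    and "(\<Sum>i\<in>{1..<k}. f i) \<le> f 1 + 2 * (\<Sum>i\<in>A. f i)"
proof -
  define A where "A = {i. allowed (col j) i \<and> i < k}"
  have fin: "finite A" by (simp add: A_def)
  have "(\<Sum>i\<in>A. load (set xs) \<sigma> i) = (\<Sum>j'\<in>{j'\<in>set xs. \<sigma> j' \<in> A}. p j')"
    using fin by (simp add: sum_load)
  also have "\<dots> + p j = (\<Sum>j'\<in>insert j {j'\<in>set xs. \<sigma> j' \<in> A}. p j')"
    using assms(3) by simp
  also have "\<dots> \<le> (\<Sum>j'\<in>{j'\<in>X. col j' = col j}. p j')"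
  proof (rule sum_p_mono)
    \<comment> \<open>A machine accepts only the colour that differs from its parity, so everything
      on the machines of \<open>A\<close> has the colour of \<open>j\<close>.\<close>
    have "col j' = col j" if "j' \<in> set xs" "\<sigma> j' \<in> A" for j'
    proof -
      have "\<sigma> j' mod 2 \<noteq> col j'" "\<sigma> j' mod 2 \<noteq> col j"
        using greedy_allowed[OF assms(2,1) _ that(1)] assms(4) that by (auto simp: A_def allowed_def)
      moreover have "col j' \<le> 1" "col j \<le> 1" "\<sigma> j' mod 2 < 2" using assms(4) that by auto
      ultimately show ?thesis by linarith
    qed
    then show "insert j {j'\<in>set xs. \<sigma> j' \<in> A} \<subseteq> {j'\<in>X. col j' = col j}" using W(1) by auto
    show "finite {j'\<in>X. col j' = col j}" using W(2) by simp
  qed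
  also have "\<dots> \<le> W" by (rule W)
  finally have 1: "(\<Sum>i\<in>A. load (set xs) \<sigma> i) + p j \<le> W" .
  have "r * (\<Sum>i\<in>A. f i) = (\<Sum>i\<in>A. r * f i)" by (rule sum_distrib_left)
  also have "\<dots> \<le> (\<Sum>i\<in>A. real (load (set xs) \<sigma> i + p j))"
    using full by (intro sum_mono) (auto simp: A_def less_imp_le)
  also have "\<dots> = (\<Sum>i\<in>A. load (set xs) \<sigma> i) + card A * real (p j)"
    by (simp add: sum.distrib)
  finally have 2: "r * (\<Sum>i\<in>A. f i) \<le> (\<Sum>i\<in>A. load (set xs) \<sigma> i) + card A * real (p j)" .
  have "(\<Sum>i\<in>A. 1) \<le> (\<Sum>i\<in>A. f i)"
    by (rule sum_mono) (auto simp: A_def f)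
  then have 3: "card A \<le> (\<Sum>i\<in>A. f i)" by simp
  have "A = {i\<in>{1..<k}. i mod 2 \<noteq> col j}"
    using \<open>k \<le> m\<close> by (auto simp: A_def allowed_def)
  moreover have "\<And>i. i < k \<Longrightarrow> 0 \<le> f i"
    using f(2) by (meson dual_order.trans zero_le_one)
  ultimately have 4: "(\<Sum>i\<in>{1..<k}. f i) \<le> f 1 + 2 * (\<Sum>i\<in>A. f i)"
    using alternating_sum_le[of k f "col j"] f(1) \<open>2 \<le> k\<close> assms(4) by simp
  show thesis using that[OF A_def 1 2 3 4] .
qed

text \<open>Different colours lie on machines of different parity, and machine \<open>0\<close>
  receives the complement of a cover, which is independent.\<close>

lemma greedy_schedule_feasible:
  assumes "m \<ge> 3" "coloring col" "cover X" "greedy_schedule col X \<sigma>"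
  shows "feasible \<sigma>"
proof -
  have al: "allowed (col j) (\<sigma> j)" if "j \<in> X" for j
  proof -
    obtain xs ys where "set xs = {j\<in>X. big j}" "set ys = {j\<in>X. \<not> big j}" "greedy col \<sigma> (xs @ ys)"
      using assms(4) by (auto simp: greedy_schedule_def)
    moreover have "X \<subseteq> {..<n}" using assms(3) by (simp add: cover_def)
    ultimately show ?thesis
      using assms(1,2) that by (intro greedy_allowed[of col \<sigma> "xs @ ys"]) (auto simp: coloring_def)
  qed
  have out: "\<sigma> j = 0" if "j < n" "j \<notin> X" for j
    using assms(4) that by (simp add: greedy_schedule_def)
  show ?thesis unfolding feasible_def
  proof (intro conjI allI impI)
    fix j assume "j < n"
    then show "\<sigma> j < m" using al[of j] out[of j] m_pos by (cases "j \<in> X") (auto simp: allowed_def)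
  next
    fix u v assume uv: "u < n" "v < n" "adj u v"
    then have "u \<in> X \<or> v \<in> X" using assms(3) by (auto simp: cover_def)
    moreover have "col u \<noteq> col v" "col u \<le> 1" "col v \<le> 1"
      using uv assms(2) by (auto simp: coloring_def)
    ultimately show "\<sigma> u \<noteq> \<sigma> v"
      using al[of u] al[of v] out[OF uv(1)] out[OF uv(2)]
      by (cases "u \<in> X"; cases "v \<in> X") (auto simp: allowed_def)
  qed
qed

text \<open>The two obligations reflect the order of placement: a big job is preceded by big jobs
  only, a small job by any jobs.\<close>

lemma greedy_schedule_cmax_le:
  assumes "greedy_schedule col X \<sigma>" "T \<ge> 0"
    and "load {..<n} \<sigma> 0 \<le> T * speed 0"
    and "\<And>xs j. greedy col \<sigma> xs \<Longrightarrow> j \<notin> set xs \<Longrightarrow> set (j # xs) \<subseteq> X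
      \<Longrightarrow> big j \<Longrightarrow> (\<forall>j'\<in>set xs. big j')
      \<Longrightarrow> \<exists>i. allowed (col j) i \<and> load (set xs) \<sigma> i + p j \<le> T * speed i"
    and "\<And>xs j. greedy col \<sigma> xs \<Longrightarrow> j \<notin> set xs \<Longrightarrow> set (j # xs) \<subseteq> X
      \<Longrightarrow> \<not> big j
      \<Longrightarrow> \<exists>i. allowed (col j) i \<and> load (set xs) \<sigma> i + p j \<le> T * speed i"
  shows "cmax \<sigma> \<le> T"
  unfolding cmax_le_iff
proof (intro allI impI)
  fix i assume "i < m"
  obtain xs ys where xy: "set xs = {j\<in>X. big j}" "set ys = {j\<in>X. \<not> big j}" "greedy col \<sigma> (xs @ ys)"
    and X: "X \<subseteq> {..<n}" and out: "\<And>j. j < n \<Longrightarrow> j \<notin> X \<Longrightarrow> \<sigma> j = 0"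
    using assms(1) by (auto simp: greedy_schedule_def)
  show "load {..<n} \<sigma> i \<le> T * speed i"
  proof (cases "i = 0")
    case False
    have "{j\<in>{..<n}. \<sigma> j = i} = {j\<in>set (xs @ ys). \<sigma> j = i}"
      using False out X xy by auto
    then have "load {..<n} \<sigma> i = load (set (xs @ ys)) \<sigma> i"
      by (simp add: load_def)
    also have "\<dots> \<le> T * speed i"
    proof (rule greedy_load_le[OF xy(3) _ assms(2) _ \<open>i < m\<close>])
      fix us j vs assume eq: "xs @ ys = us @ j # vs"
      have g: "greedy col \<sigma> us" by (rule greedy_prefix[OF xy(3) eq])
      have d: "j \<notin> set us" using greedy_distinct[OF xy(3)] unfolding eq by simp
      have "set (us @ j # vs) = X"
        using xy unfolding eq[symmetric] by auto
      then have s: "set (j # us) \<subseteq> X" by auto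
      show "\<exists>i. allowed (col j) i \<and> load (set us) \<sigma> i + p j \<le> T * speed i"
      proof (cases "big j")
        case True
        then have "j \<notin> set ys" using xy(2) by auto
        with eq obtain vs' where "xs = us @ j # vs'"
          by (auto simp: append_eq_append_conv2 append_eq_Cons_conv)
        then have "set us \<subseteq> set xs" by auto
        then have "\<forall>j'\<in>set us. big j'" using xy(1) by auto
        then show ?thesis using assms(4)[OF g d s True] by simp
      next
        case False
        then show ?thesis using assms(5)[OF g d s] by simp
      qed
    qed (use False in simp)
    finally show ?thesis .
  qed (use assms(3) in simp)
qed

theorem candidates_approximate:
  assumes "total \<ge> 100" "feasible \<tau>" "coloring col"
    and \<sigma>0: "two_machine_schedule \<sigma>0"
    and \<sigma>1: "balanced_cover col X" "greedy_schedule col X \<sigma>1"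
    and \<sigma>2: "greedy_schedule col {..<n} \<sigma>2"
  shows "\<exists>\<sigma>\<in>{\<sigma>0, \<sigma>1, \<sigma>2}. feasible \<sigma> \<and> cmax \<sigma> \<le> sqrt total * cmax \<tau>"
proof -
  define C where "C = cmax \<tau>"
  define r where "r = sqrt total"
  define f where "f i = C * speed i" for i
  have rr: "r * r = total" by (simp add: r_def)
  \<comment> \<open>The most demanding estimate below, for big jobs if \<open>f 0 < r\<close>, would
    need \<open>r \<ge> 8\<close>; the threshold 100 leaves some room.\<close>
  have r: "r \<ge> 10" unfolding r_def using assms(1) real_sqrt_le_mono[of 100 total] by simp
  have load: "load {..<n} \<tau> i \<le> f i" if "i < m" for i
    using cmax_le_iff[of \<tau> C] that by (simp add: C_def f_def)
  have C: "C \<ge> 0"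
  proof -
    have "0 \<le> f 0" using load[of 0] m_pos by simp
    then show ?thesis using speed_pos[OF m_pos] by (simp add: f_def zero_le_mult_iff)
  qed
  have f_mono: "f k \<le> f i" if "i \<le> k" "k < m" for i k
    unfolding f_def using speed_mono[OF that] C by (rule mult_left_mono)
  \<comment> \<open>As \<open>f\<close> decreases, the machines with \<open>f i \<ge> 1\<close> are
    the first \<open>k\<close>. Any other machine has an integral load below 1, hence load
    0.\<close>
  define k where "k = (LEAST i. i \<ge> m \<or> f i < 1)"
  have km: "k \<le> m" unfolding k_def by (rule Least_le) simp
  have fk: "1 \<le> f i" if "i < k" for i
    using not_less_Least[OF that[unfolded k_def]] by auto
  have load0: "load {..<n} \<tau> i = 0" if "k \<le> i" "i < m" for i
  proof -
    have "k \<ge> m \<or> f k < 1" unfolding k_def by (rule LeastI[of _ m]) simp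
    then have "f i < 1" using f_mono[OF that] that by simp
    then show ?thesis using load[OF that(2)] by simp
  qed
  have \<tau>k: "\<tau> j < k" if "j < n" for j
  proof (rule ccontr)
    assume "\<not> \<tau> j < k"
    then have "load {..<n} \<tau> (\<tau> j) = 0"
      using \<open>feasible \<tau>\<close> that by (intro load0) (auto simp: feasible_def)
    then show False using p_pos[OF that] that by (auto simp: load_def)
  qed
  have tot: "total \<le> (\<Sum>i<k. f i)"
  proof -
    have "total = (\<Sum>i<k. load {..<n} \<tau> i)"
      unfolding total_def using \<tau>k by (subst sum_load) (auto intro: arg_cong[of _ _ "sum p"])
    also have "real \<dots> \<le> (\<Sum>i<k. f i)"
      unfolding of_nat_sum using load km by (intro sum_mono) auto
    finally show ?thesis .
  qed
  have split: "(\<Sum>i<k. f i) = f 0 + (\<Sum>i\<in>{1..<k}. f i)" if "k \<ge> 1"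
    using that by (simp add: lessThan_atLeast0 sum.atLeast_Suc_lessThan)
  have k1: "k \<ge> 1"
  proof (rule ccontr)
    assume "\<not> k \<ge> 1"
    then have "{..<k} = {}" by auto
    then show False using tot assms(1) by simp
  qed
  have not_big: "2 * p j < r" if "\<not> big j" for j
  proof (rule ccontr)
    assume "\<not> 2 * p j < r"
    then have "r * r \<le> (2 * real (p j)) * (2 * real (p j))"
      using r by (intro mult_mono) auto
    then have "real total \<le> real (4 * (p j * p j))" unfolding rr by simp
    then show False using that by (simp only: big_def of_nat_le_iff not_True_eq_False)
  qed
  have big: "r \<le> 2 * p j" if "big j" for j
  proof (rule ccontr)
    assume "\<not> r \<le> 2 * p j"
    then have "(2 * real (p j)) * (2 * real (p j)) < r * r"
      using r by (intro mult_strict_mono) auto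
    then have "real (4 * (p j * p j)) < real total" unfolding rr by simp
    then show False using that by (simp only: big_def of_nat_less_iff)
  qed
  have two: "feasible \<sigma>0" if "m \<ge> 2 \<or> k = 1"
    unfolding feasible_def
  proof (intro conjI allI impI)
    fix u v assume "u < n" "v < n" "adj u v"
    then show "\<sigma>0 u \<noteq> \<sigma>0 v" using \<sigma>0 by (auto simp: two_machine_schedule_def)
  next
    fix j assume j: "j < n"
    have "\<sigma>0 j \<le> 1" using \<sigma>0 j by (simp add: two_machine_schedule_def)
    moreover have "\<sigma>0 j \<noteq> 1" if "k = 1"
    proof
      assume "\<sigma>0 j = 1"
      \<comment> \<open>If \<open>\<tau>\<close> uses a single machine, there are no edges, so a
        constant colouring is proper and minimality leaves machine \<open>1\<close> empty. This
        makes \<open>\<sigma>0\<close> feasible even if machine \<open>1\<close> does not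
        exist.\<close>
      have "proper (\<lambda>_. False)" unfolding proper_def
        using \<open>feasible \<tau>\<close> \<tau>k \<open>k = 1\<close> unfolding feasible_def by (metis less_one)
      then have "load {..<n} \<sigma>0 1 = 0"
        using \<sigma>0 by (auto simp: two_machine_schedule_def)
      with \<open>\<sigma>0 j = 1\<close> j p_pos[OF j] show False by (auto simp: load_def)
    qed
    ultimately show "\<sigma>0 j < m" using that m_pos by (cases "\<sigma>0 j = 1") auto
  qed
  have two_cmax: "cmax \<sigma>0 \<le> r * C" if "m \<ge> 2 \<Longrightarrow> load {..<n} \<sigma>0 1 \<le> r * f 1" "total \<le> r * f 0"
    unfolding cmax_le_iff
  proof (intro allI impI)
    fix i assume "i < m"
    consider "i = 0" | "i = 1" | "i \<ge> 2" by linarith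
    then show "load {..<n} \<sigma>0 i \<le> r * C * speed i"
    proof cases
      case 1
      have "real (load {..<n} \<sigma>0 0) \<le> total" using load_le_total by simp
      also have "\<dots> \<le> r * f 0" by (rule that)
      finally show ?thesis using 1 by (simp add: f_def)
    next
      case 2
      then show ?thesis using that(1) \<open>i < m\<close> by (simp add: f_def)
    next
      case 3
      have "{j\<in>{..<n}. \<sigma>0 j = i} = {}"
        using \<sigma>0 3 by (fastforce simp: two_machine_schedule_def)
      then have "load {..<n} \<sigma>0 i = 0" unfolding load_def by (simp only: sum.empty)
      then show ?thesis using r C speed_pos[OF \<open>i < m\<close>] by simp
    qed
  qed
  have two_le: "load {..<n} \<sigma>0 1 \<le> (\<Sum>j\<in>{j. j < n \<and> g j}. p j)" if "proper g" for g
    using \<sigma>0 that by (auto simp: two_machine_schedule_def)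
  consider "f 0 < r" | "f 0 \<ge> r" "k \<le> 2" | "f 0 \<ge> r" "k \<ge> 3" "f 1 \<ge> r / 2"
    | "f 0 \<ge> r" "k \<ge> 3" "f 1 < r / 2"
    by linarith
  then show ?thesis
  proof cases
    case 1
    \<comment> \<open>At most two machines, each with capacity below \<open>r\<close>, cannot hold
      \<open>total\<close>, which is \<open>r * r\<close>.\<close>
    have k3: "k \<ge> 3"
    proof (rule ccontr)
      assume "\<not> k \<ge> 3"
      then have "(\<Sum>i<k. f i) \<le> 2 * r"
      proof -
        have "(\<Sum>i<k. f i) \<le> (\<Sum>i<k. r)"
          using f_mono[of 0] km 1 by (intro sum_mono) (meson lessThan_iff less_le_trans le0 less_imp_le order_trans)
        also have "\<dots> = k * r" by simp
        also have "\<dots> \<le> 2 * r" using \<open>\<not> k \<ge> 3\<close> r by (intro mult_right_mono) auto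
        finally show ?thesis .
      qed
      moreover have "2 * r < r * r" using r by simp
      ultimately show False using tot rr by linarith
    qed
    have f1: "f 1 < r" using f_mono[of 0 1] km k3 1 by simp
    have cov: "cover {..<n}" by (auto simp: cover_def)
    have "cmax \<sigma>2 \<le> r * C"
    proof (rule greedy_schedule_cmax_le[OF \<sigma>2])
      show "r * C \<ge> 0" using r C by simp
      have al: "allowed (col j) (\<sigma>2 j)" if "j < n" for j
      proof -
        obtain xs ys where "set xs = {j\<in>{..<n}. big j}" "set ys = {j\<in>{..<n}. \<not> big j}"
          "greedy col \<sigma>2 (xs @ ys)"
          using \<sigma>2 by (auto simp: greedy_schedule_def)
        then show ?thesis
          using k3 km assms(3) that by (intro greedy_allowed[of col \<sigma>2 "xs @ ys"]) (auto simp: coloring_def)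
      qed
      have "{j\<in>{..<n}. \<sigma>2 j = 0} = {}" using al by (fastforce simp: allowed_def)
      then have "load {..<n} \<sigma>2 0 = 0" unfolding load_def by (simp only: sum.empty)
      then show "load {..<n} \<sigma>2 0 \<le> r * C * speed 0"
        using r C speed_pos[OF m_pos] by simp
    next
      fix xs j assume g: "greedy col \<sigma>2 xs" "j \<notin> set xs" "set (j # xs) \<subseteq> {..<n}"
      have pj: "p j < r"
      proof -
        have "\<tau> j < m" using \<open>feasible \<tau>\<close> g(3) by (auto simp: feasible_def)
        have "p j \<le> load {..<n} \<tau> (\<tau> j)"
          unfolding load_def using g(3) by (intro member_le_sum) auto
        also have "real \<dots> \<le> f 0"
          using load[OF \<open>\<tau> j < m\<close>] f_mono[of 0 "\<tau> j"] \<open>\<tau> j < m\<close> by simp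
        finally show ?thesis using 1 by simp
      qed
      have *: False if ov: "\<not> (\<exists>i. allowed (col j) i \<and> load (set xs) \<sigma>2 i + p j \<le> r * C * speed i)"
        and jj: "(\<forall>j'\<in>set xs. big j') \<or> \<not> big j"
      proof -
        obtain A where A: "A = {i. allowed (col j) i \<and> i < k}"
          "(\<Sum>i\<in>A. load (set xs) \<sigma>2 i) + p j \<le> total"
          "r * (\<Sum>i\<in>A. f i) \<le> (\<Sum>i\<in>A. load (set xs) \<sigma>2 i) + card A * real (p j)"
          "card A \<le> (\<Sum>i\<in>A. f i)"
          "(\<Sum>i\<in>{1..<k}. f i) \<le> f 1 + 2 * (\<Sum>i\<in>A. f i)"
        proof (rule overflow[where W = total])
          show "m \<ge> 3" "greedy col \<sigma>2 xs" "j \<notin> set xs" "k \<le> m" "2 \<le> k"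
            "set (j # xs) \<subseteq> {..<n}" "finite {..<n}"
            using k3 km g by auto
          show "col j' \<le> 1" if "j' \<in> set (j # xs)" for j'
            using that g(3) assms(3) by (auto simp: coloring_def)
          show "f (Suc i) \<le> f i" if "Suc i < k" for i
            using that km by (intro f_mono) auto
          show "1 \<le> f i" if "i < k" for i using fk that .
          show "r * f i < load (set xs) \<sigma>2 i + p j" if "allowed (col j) i" for i
            using ov that by (auto simp: f_def not_le mult.assoc)
          show "sum p {j' \<in> {..<n}. col j' = col j} \<le> total"
            unfolding total_def by (rule sum_p_mono) auto
        qed auto
        define S where "S = (\<Sum>i\<in>A. f i)"
        define L where "L = real (\<Sum>i\<in>A. load (set xs) \<sigma>2 i)"
        \<comment> \<open>The capacities \<open>f 0\<close> and \<open>f 1\<close>, which are not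
          accounted for by \<open>S\<close>, are both below \<open>r\<close>.\<close>
        have S: "r * r \<le> 2 * r + 2 * S"
          using tot split[OF k1] A(5) 1 f1 unfolding S_def rr by linarith
        have L: "L + p j \<le> r * r"
          using A(2) unfolding L_def rr of_nat_add[symmetric] of_nat_le_iff .
        have LS: "r * S \<le> L + card A * real (p j)" using A(3) by (simp add: L_def S_def)
        have cA: "card A \<le> S" using A(4) by (simp add: S_def)
        have pj0: "real (p j) > 0" using p_pos[of j] g(3) by simp
        have rr0: "0 \<le> r * r" by simp
        have r10: "10 * r \<le> r * r" using r by simp
        have S4: "4 * r \<le> S" using S r10 by linarith
        have rS: "r * (r * r) \<le> 2 * (r * r) + 2 * (r * S)"
          using mult_left_mono[OF S, of r] r by (simp add: algebra_simps)
        have r3: "10 * (r * r) \<le> r * (r * r)" using r by simp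
        show False
        proof (cases "big j")
          case False
          \<comment> \<open>As \<open>card A \<le> S\<close>, the term for \<open>j\<close> absorbs
            at most half of \<open>r * S\<close>. The load on \<open>A\<close> must provide the
            other half, which is more than \<open>total\<close>.\<close>
          have "card A * real (p j) \<le> card A * (r / 2)"
            using not_big[OF False] by (intro mult_left_mono) auto
          also have "\<dots> \<le> S * (r / 2)" using cA r by (intro mult_right_mono) auto
          finally have "r * S \<le> 2 * L" using LS by (simp add: algebra_simps)
          then show False using rS r3 L pj0 rr0 by linarith
        next
          case True
          \<comment> \<open>For a big job, the term for \<open>j\<close> may be nearly
            \<open>r * S\<close>. But \<open>j\<close> alone would not exceed
            \<open>r * f i\<close>, so every machine of \<open>A\<close> already holds a job. That
            job is big as well, so the load on \<open>A\<close> is at least r / 2 per machine and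
            controls this term.\<close>
          have "real (card A) * (r / 2) = (\<Sum>i\<in>A. r / 2)" by simp
          also have "\<dots> \<le> (\<Sum>i\<in>A. real (load (set xs) \<sigma>2 i))"
          proof (rule sum_mono)
            fix i assume i: "i \<in> A"
            have "r * 1 \<le> r * f i" using i r fk by (intro mult_left_mono) (auto simp: A(1))
            also have "\<dots> < load (set xs) \<sigma>2 i + p j"
              using ov i by (auto simp: A(1) f_def not_le mult.assoc)
            finally have "load (set xs) \<sigma>2 i \<noteq> 0" using pj by auto
            then obtain j' where j': "j' \<in> set xs" "\<sigma>2 j' = i"
              unfolding load_def by (metis (mono_tags, lifting) mem_Collect_eq sum.neutral)
            then have "p j' \<le> load (set xs) \<sigma>2 i"
              unfolding load_def by (intro member_le_sum) auto
            moreover have "r \<le> 2 * p j'" using jj True j' by (intro big) auto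
            ultimately show "r / 2 \<le> load (set xs) \<sigma>2 i" by simp
          qed
          finally have "card A * r \<le> 2 * L" by (simp add: L_def)
          moreover have "card A * real (p j) \<le> card A * r" using pj by (intro mult_left_mono) auto
          ultimately have "r * S \<le> 3 * L" using LS by linarith
          then show False using rS r3 L pj0 rr0 by linarith
        qed
      qed
      show "\<exists>i. allowed (col j) i \<and> load (set xs) \<sigma>2 i + p j \<le> r * C * speed i"
        if "big j" "\<forall>j'\<in>set xs. big j'"
        using * that by blast
      show "\<exists>i. allowed (col j) i \<and> load (set xs) \<sigma>2 i + p j \<le> r * C * speed i"
        if "\<not> big j"
        using * that by blast
    qed
    moreover have "feasible \<sigma>2"
      using k3 km assms(3) cov \<sigma>2 by (intro greedy_schedule_feasible) auto
    ultimately show ?thesis by (auto simp: r_def C_def)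
  next
    case 2
    have "load {..<n} \<sigma>0 1 \<le> r * f 1" if "m \<ge> 2"
    proof -
      define g where "g j \<longleftrightarrow> \<tau> j = 1" for j
      have "proper g" unfolding proper_def
      proof (intro allI impI)
        fix u v assume uv: "u < n" "v < n" "adj u v"
        then have "\<tau> u \<noteq> \<tau> v" using \<open>feasible \<tau>\<close> by (auto simp: feasible_def)
        moreover have "\<tau> u < 2" "\<tau> v < 2" using \<tau>k[OF uv(1)] \<tau>k[OF uv(2)] 2 by auto
        ultimately show "g u \<noteq> g v" unfolding g_def by linarith
      qed
      then have "load {..<n} \<sigma>0 1 \<le> (\<Sum>j\<in>{j. j < n \<and> g j}. p j)" by (rule two_le)
      also have "\<dots> = load {..<n} \<tau> 1" by (simp add: load_def g_def)
      also have "real \<dots> \<le> f 1" using load[of 1] that by simp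
      also have "\<dots> \<le> r * f 1" using load[of 1] that r by (simp add: mult_le_cancel_right1)
      finally show ?thesis by simp
    qed
    moreover have "total \<le> r * f 0"
    proof -
      have "(\<Sum>i<k. f i) \<le> (\<Sum>i<k. f 0)"
        using f_mono[of 0] km by (intro sum_mono) auto
      also have "\<dots> = k * f 0" by simp
      also have "\<dots> \<le> r * f 0" using 2 r by (intro mult_right_mono) auto
      finally show ?thesis using tot by linarith
    qed
    ultimately have "cmax \<sigma>0 \<le> r * C" by (rule two_cmax)
    moreover have "feasible \<sigma>0" using two 2 km k1 by fastforce
    ultimately show ?thesis by (auto simp: r_def C_def)
  next
    case 3
    have "load {..<n} \<sigma>0 1 \<le> r * f 1"
    proof -
      define Z where "Z = {j\<in>{..<n}. \<sigma>0 j = 1}"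
      \<comment> \<open>Exchanging the two machines gives another proper colouring, so by minimality
        machine \<open>1\<close> carries at most half of \<open>total\<close>.\<close>
      have "proper (\<lambda>j. \<sigma>0 j = 0)" unfolding proper_def
      proof (intro allI impI)
        fix u v assume uv: "u < n" "v < n" "adj u v"
        then have "\<sigma>0 u \<noteq> \<sigma>0 v" "\<sigma>0 u \<le> 1" "\<sigma>0 v \<le> 1"
          using \<sigma>0 by (auto simp: two_machine_schedule_def)
        then show "(\<sigma>0 u = 0) \<noteq> (\<sigma>0 v = 0)" by linarith
      qed
      then have "load {..<n} \<sigma>0 1 \<le> load {..<n} \<sigma>0 0"
        using two_le[of "\<lambda>j. \<sigma>0 j = 0"] by (simp add: load_def)
      moreover have "load {..<n} \<sigma>0 0 + load {..<n} \<sigma>0 1 \<le> total"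
      proof -
        have "(\<Sum>i\<in>{0, 1}. load {..<n} \<sigma>0 i) \<le> total"
          unfolding total_def by (subst sum_load) (auto intro: sum_p_mono)
        then show ?thesis by simp
      qed
      ultimately have "real (2 * load {..<n} \<sigma>0 1) \<le> total" by linarith
      also have "\<dots> = r * r" by (simp add: rr)
      also have "\<dots> \<le> r * (2 * f 1)" using 3 r by (intro mult_left_mono) auto
      finally show ?thesis by simp
    qed
    moreover have "total \<le> r * f 0"
      unfolding rr[symmetric] using 3 r by (intro mult_left_mono) auto
    ultimately have "cmax \<sigma>0 \<le> r * C" by (intro two_cmax)
    moreover have "feasible \<sigma>0" using two 3 km by linarith
    ultimately show ?thesis by (auto simp: r_def C_def)
  next
    case 4
    define Y where "Y = {j\<in>{..<n}. \<tau> j \<noteq> 0}"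
    have covX: "cover X" using \<sigma>1(1) by (simp add: balanced_cover_def)
    then have Xn: "X \<subseteq> {..<n}" by (simp add: cover_def)
    have "cover Y"
      using \<open>feasible \<tau>\<close> unfolding cover_def Y_def feasible_def by fastforce
    \<comment> \<open>A job off machine \<open>0\<close> has size at most some \<open>f i\<close>
      with \<open>i \<ge> 1\<close>, hence at most \<open>f 1 < r / 2\<close>.\<close>
    moreover have "\<not> big j" if "j \<in> Y" for j
    proof
      assume "big j"
      have j: "j < n" "1 \<le> \<tau> j" "\<tau> j < m"
        using that \<open>feasible \<tau>\<close> by (auto simp: Y_def feasible_def)
      have "p j \<le> load {..<n} \<tau> (\<tau> j)"
        unfolding load_def using j by (intro member_le_sum) auto
      also have "real \<dots> \<le> f 1"
        using load[OF j(3)] f_mono[OF j(2,3)] by simp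
      finally show False using big[OF \<open>big j\<close>] 4 by simp
    qed
    ultimately have Xsmall: "\<And>j. j \<in> X \<Longrightarrow> \<not> big j"
      and XY: "\<And>c. c \<le> 1 \<Longrightarrow> (\<Sum>j\<in>{j\<in>X. col j = c}. p j) \<le> (\<Sum>j\<in>Y. p j)"
      using \<sigma>1(1) unfolding balanced_cover_def by blast+
    have Y: "(\<Sum>j\<in>Y. p j) \<le> (\<Sum>i\<in>{1..<k}. f i)"
    proof -
      have "(\<Sum>j\<in>Y. p j) = (\<Sum>i\<in>{1..<k}. load {..<n} \<tau> i)"
        unfolding Y_def using \<tau>k by (subst sum_load) (auto intro!: arg_cong[of _ _ "sum p"])
      also have "real \<dots> \<le> (\<Sum>i\<in>{1..<k}. f i)"
        unfolding of_nat_sum using load km by (intro sum_mono) auto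
      finally show ?thesis .
    qed
    have "cmax \<sigma>1 \<le> r * C"
    proof (rule greedy_schedule_cmax_le[OF \<sigma>1(2)])
      show "r * C \<ge> 0" using r C by simp
      have "real (load {..<n} \<sigma>1 0) \<le> total" using load_le_total by simp
      also have "\<dots> \<le> r * f 0"
        unfolding rr[symmetric] using 4 r by (intro mult_left_mono) auto
      finally show "load {..<n} \<sigma>1 0 \<le> r * C * speed 0" by (simp add: f_def)
    next
      fix xs j assume g: "greedy col \<sigma>1 xs" "j \<notin> set xs" "set (j # xs) \<subseteq> X"
      show "\<exists>i. allowed (col j) i \<and> load (set xs) \<sigma>1 i + p j \<le> r * C * speed i"
      proof (rule ccontr)
        assume ov: "\<not> (\<exists>i. allowed (col j) i \<and> load (set xs) \<sigma>1 i + p j \<le> r * C * speed i)"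
        have c1: "col j \<le> 1" "j < n" using g(3) Xn assms(3) by (auto simp: coloring_def)
        obtain A where A: "A = {i. allowed (col j) i \<and> i < k}"
          "(\<Sum>i\<in>A. load (set xs) \<sigma>1 i) + p j \<le> (\<Sum>j\<in>Y. p j)"
          "r * (\<Sum>i\<in>A. f i) \<le> (\<Sum>i\<in>A. load (set xs) \<sigma>1 i) + card A * real (p j)"
          "card A \<le> (\<Sum>i\<in>A. f i)"
          "(\<Sum>i\<in>{1..<k}. f i) \<le> f 1 + 2 * (\<Sum>i\<in>A. f i)"
        proof (rule overflow[where W = "\<Sum>j\<in>Y. p j"])
          show "m \<ge> 3" "greedy col \<sigma>1 xs" "j \<notin> set xs" "k \<le> m" "2 \<le> k" "set (j # xs) \<subseteq> X"
            using 4 km g by auto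
          show "finite X" using Xn finite_subset by blast
          show "col j' \<le> 1" if "j' \<in> set (j # xs)" for j'
            using that g(3) Xn assms(3) by (auto simp: coloring_def)
          show "f (Suc i) \<le> f i" if "Suc i < k" for i
            using that km by (intro f_mono) auto
          show "1 \<le> f i" if "i < k" for i using fk that .
          show "r * f i < load (set xs) \<sigma>1 i + p j" if "allowed (col j) i" for i
            using ov that by (auto simp: f_def not_le mult.assoc)
          show "sum p {j' \<in> X. col j' = col j} \<le> (\<Sum>j\<in>Y. p j)"
            using XY[OF c1(1)] .
        qed auto
        define S where "S = (\<Sum>i\<in>A. f i)"
        define L where "L = real (\<Sum>i\<in>A. load (set xs) \<sigma>1 i)"
        have "(if col j = 0 then 1 else 2) \<in> A"
          unfolding A(1) using allowed_exists[OF _ c1(1)] 4 km by auto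
        moreover have "finite A" using A(1) by simp
        ultimately have "card A \<ge> 1" using card_0_eq[of A] by fastforce
        then have S1: "1 \<le> S" "real (card A) - 1 \<le> S - 1" "0 \<le> real (card A) - 1"
          using A(4) by (auto simp: S_def)
        have W: "L + p j \<le> r / 2 + 2 * S"
        proof -
          have "L + p j \<le> real (\<Sum>j\<in>Y. p j)"
            using A(2) unfolding L_def of_nat_add[symmetric] of_nat_le_iff .
          then show ?thesis using Y A(5) 4 unfolding S_def by linarith
        qed
        \<comment> \<open>One of the \<open>card A\<close> copies of \<open>p j\<close> stays with
          the load, as \<open>L + p j\<close> is bounded by the weight of the cover. Only the others
          are estimated by \<open>r / 2\<close>, and the copy saved in this way cancels the
          \<open>r / 2\<close> that stems from \<open>f 1\<close>.\<close>
        have "(real (card A) - 1) * real (p j) \<le> (S - 1) * (r / 2)"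
          using not_big[OF Xsmall, of j] g(3) S1 by (intro mult_mono) auto
        moreover have "r * S \<le> L + card A * real (p j)" using A(3) by (simp add: L_def S_def)
        moreover have "(S - 1) * (r / 2) = (r * S) / 2 - r / 2" by (simp add: field_simps)
        moreover have "(real (card A) - 1) * real (p j) = card A * real (p j) - real (p j)"
          by (simp add: left_diff_distrib)
        ultimately have "r * S \<le> 4 * S" using W by linarith
        then show False using r S1(1) by simp
      qed
      then show "\<exists>i. allowed (col j) i \<and> load (set xs) \<sigma>1 i + p j \<le> r * C * speed i" .
    qed
    moreover have "feasible \<sigma>1"
      using 4 km assms(3) covX \<sigma>1(2) by (intro greedy_schedule_feasible) auto
    ultimately show ?thesis by (auto simp: r_def C_def)
  qed
qed

end

section \<open>The algorithm as a loop program\<close>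

text \<open>Truth values are numbers, nonzero meaning true, so that products and sums act as
  connectives. The products are harmless, as these conditions are not stored.\<close>

definition Neg :: "aexp \<Rightarrow> aexp" where "Neg e = Monus (Const 1) e"
definition Conj :: "aexp \<Rightarrow> aexp \<Rightarrow> aexp" where "Conj d e = Times d e"
definition Disj :: "aexp \<Rightarrow> aexp \<Rightarrow> aexp" where "Disj d e = Plus d e"
definition Less :: "aexp \<Rightarrow> aexp \<Rightarrow> aexp" where "Less d e = Monus e d"
definition Neq :: "aexp \<Rightarrow> aexp \<Rightarrow> aexp" where "Neq d e = Plus (Monus d e) (Monus e d)"
definition Mod :: "aexp \<Rightarrow> aexp \<Rightarrow> aexp" where "Mod d e = Monus d (Times (Quot d e) e)"

lemma aval_bool [simp]:
  "aval (Neg e) s = (if aval e s = 0 then 1 else 0)"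
  "aval (Conj d e) s = 0 \<longleftrightarrow> aval d s = 0 \<or> aval e s = 0"
  "0 < aval (Conj d e) s \<longleftrightarrow> 0 < aval d s \<and> 0 < aval e s"
  "aval (Disj d e) s = 0 \<longleftrightarrow> aval d s = 0 \<and> aval e s = 0"
  "0 < aval (Disj d e) s \<longleftrightarrow> 0 < aval d s \<or> 0 < aval e s"
  "aval (Less d e) s = 0 \<longleftrightarrow> aval e s \<le> aval d s"
  "0 < aval (Less d e) s \<longleftrightarrow> aval d s < aval e s"
  "aval (Neq d e) s = 0 \<longleftrightarrow> aval d s = aval e s"
  "0 < aval (Neq d e) s \<longleftrightarrow> aval d s \<noteq> aval e s"
  "aval (Mod d e) s = aval d s mod aval e s"
  by (auto simp: Neg_def Conj_def Disj_def Less_def Neq_def Mod_def minus_div_mult_eq_mod)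

lemma additive_bool [simp]: "additive_aexp (Neg e)" "additive_aexp d \<Longrightarrow> additive_aexp (Mod d e)"
  by (auto simp: Neg_def Mod_def)

abbreviation (input) "TOTAL \<equiv> (3 :: nat)"
abbreviation (input) "POWER \<equiv> (4 :: nat)"
abbreviation (input) "AUX \<equiv> (5 :: nat)"
abbreviation (input) "BEST_LOAD \<equiv> (6 :: nat)"
abbreviation (input) "BEST_MACHINE \<equiv> (7 :: nat)"
abbreviation (input) "FOUND \<equiv> (8 :: nat)"
abbreviation (input) "LABEL \<equiv> (10 :: nat)"
abbreviation (input) "COLOR \<equiv> (11 :: nat)"
abbreviation (input) "CLASS \<equiv> (12 :: nat)"
abbreviation (input) "TEMP \<equiv> (13 :: nat)"
abbreviation (input) "RESID \<equiv> (14 :: nat)"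
abbreviation (input) "DELTA \<equiv> (15 :: nat)"
abbreviation (input) "LOAD \<equiv> (16 :: nat)"
abbreviation (input) "PICK \<equiv> (17 :: nat)"
abbreviation (input) "SCHED \<equiv> (18 :: nat)"
abbreviation (input) "VALID \<equiv> (19 :: nat)"
abbreviation (input) "J \<equiv> (20 :: nat)"
abbreviation (input) "K \<equiv> (21 :: nat)"
abbreviation (input) "L \<equiv> (22 :: nat)"
abbreviation (input) "X \<equiv> (23 :: nat)"

text \<open>The offsets of this group follow \<open>encode\<close>; where \<open>n\<close> and
  \<open>m\<close> are needed, they are read from cells \<open>0\<close> and \<open>1\<close> of
  array \<open>2\<close>.\<close>

definition Requirement :: "aexp \<Rightarrow> aexp" where
  "Requirement e = Read 0 (Plus (Const 2) e)"

definition Numerator :: "aexp \<Rightarrow> aexp" where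
  "Numerator e = Read 0 (Plus (Plus (Const 2) (cell 2)) (Times (Const 2) e))"

definition Denominator :: "aexp \<Rightarrow> aexp" where
  "Denominator e = Read 0 (Plus (Plus (Plus (Const 2) (cell 2)) (Times (Const 2) e)) (Const 1))"

definition Edge :: "aexp \<Rightarrow> aexp \<Rightarrow> aexp" where
  "Edge d e = Read 0 (Plus (Plus (Plus (Const 2) (cell 2)) (Times (Const 2) (Read 2 (Const 1))))
     (Plus (Times d (cell 2)) e))"

definition Big :: "aexp \<Rightarrow> aexp" where
  "Big e = Neg (Less (Times (Const 4) (Times (Requirement e) (Requirement e))) (cell TOTAL))"

text \<open>\<open>Faster d x e y\<close>: machine \<open>d\<close> needs less time for load \<open>x\<close> than machine \<open>e\<close> for load \<open>y\<close>.\<close>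

definition Faster :: "aexp \<Rightarrow> aexp \<Rightarrow> aexp \<Rightarrow> aexp \<Rightarrow> aexp" where
  "Faster d x e y = Less (Times (Times x (Denominator d)) (Numerator e))
     (Times (Times y (Denominator e)) (Numerator d))"

lemma additive_input [simp]: "additive_aexp (Requirement e)"
  by (simp add: Requirement_def)

definition sum_requirements :: prog where
  "sum_requirements = For J 0 (Assign TOTAL (Const 0) (Plus (cell TOTAL) (Requirement (cell J))))"

text \<open>Multiplication by \<open>m\<close> is a loop of additions, because products must not be
  stored. The power may be a huge number, but its length stays polynomial.\<close>

definition power_loop :: prog where
  "power_loop = Assign POWER (Const 0) (Const 1) ;;
     For J 0 (Assign AUX (Const 0) (Const 0) ;;
       For K 1 (Assign AUX (Const 0) (Plus (cell AUX) (cell POWER))) ;;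
       Assign POWER (Const 0) (cell AUX))"

text \<open>Cells \<open>0\<close>, \<open>1\<close> and \<open>2\<close> of \<open>TEMP\<close>
  hold the label to be replaced, its replacement, and a number that is zero iff both ends of the
  edge have the same colour, so that the replaced class has to be flipped. Copies are needed since
  the loop overwrites labels and colours.\<close>

definition relabel :: prog where
  "relabel = For L 0
     (Cond (Neq (Read LABEL (cell L)) (Read TEMP (Const 0))) Nop
       (Cond (Read TEMP (Const 2)) Nop
          (Assign COLOR (cell L) (Monus (Const 1) (Read COLOR (cell L)))) ;;
        Assign LABEL (cell L) (Read TEMP (Const 1))))"

definition merge :: prog where
  "merge = Assign TEMP (Const 0) (Read LABEL (cell J)) ;;
     Assign TEMP (Const 1) (Read LABEL (cell K)) ;;
     Assign TEMP (Const 2)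
       (Plus (Monus (Read COLOR (cell J)) (Read COLOR (cell K)))
             (Monus (Read COLOR (cell K)) (Read COLOR (cell J)))) ;;
     relabel"

text \<open>Label classes are merged along edges. Unlike a graph search, this needs only loops with
  limits known in advance. The initial colour 0 comes from the empty memory.\<close>

definition color_graph :: prog where
  "color_graph = For J 0 (Assign LABEL (cell J) (cell J)) ;;
     For J 0 (For K 0
       (Cond (Conj (Edge (cell J) (cell K)) (Neq (Read LABEL (cell J)) (Read LABEL (cell K))))
         merge Nop))"

text \<open>The two colour classes with label l have their weights in cells 2 * l and 2 * l +
  1.\<close>

definition Class :: "aexp \<Rightarrow> aexp \<Rightarrow> aexp" where
  "Class e c = Read CLASS (Plus (Times (Const 2) (Read LABEL e)) c)"

definition class_weights :: prog where
  "class_weights = For J 0 (Assign CLASS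
     (Plus (Times (Const 2) (Read LABEL (cell J))) (Read COLOR (cell J)))
     (Plus (Class (cell J) (Read COLOR (cell J))) (Requirement (cell J))))"

text \<open>The summand \<open>Monus (Const 1) (Read COLOR (cell J))\<close> breaks ties in favour
  of colour 0; without it, two classes of equal weight would both go to machine
  \<open>1\<close>.\<close>

definition two_machines :: prog where
  "two_machines = For J 0 (Cond
     (Less (Class (cell J) (Monus (Const 1) (Read COLOR (cell J))))
       (Plus (Class (cell J) (Read COLOR (cell J))) (Monus (Const 1) (Read COLOR (cell J)))))
     (Assign SCHED (cell J) (Const 0)) (Assign SCHED (cell J) (Const 1)))"

text \<open>The number of the round is read in base \<open>m\<close>, digit \<open>j\<close> being
  the machine of job \<open>j\<close>.\<close>

definition decode :: prog where
  "decode = Assign TEMP (Const 0) (cell X) ;;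
     For J 0 (Assign SCHED (cell J) (Mod (cell TEMP) (Read 2 (Const 1))) ;;
       Assign TEMP (Const 0) (Quot (cell TEMP) (Read 2 (Const 1))))"

definition zero_residuals :: prog where
  "zero_residuals = For J 0 (Assign RESID (cell J) (Const 0))"

text \<open>With truncated subtraction, x - (x - y) is the minimum of x and y. One of the two
  residuals therefore drops to zero.\<close>

definition charge :: prog where
  "charge = Assign DELTA (Const 0) (Monus (Read RESID (cell J))
      (Monus (Read RESID (cell J)) (Read RESID (cell K)))) ;;
    Assign RESID (cell J) (Monus (Read RESID (cell J)) (cell DELTA)) ;;
    Assign RESID (cell K) (Monus (Read RESID (cell K)) (cell DELTA))"

text \<open>The weight \<open>total + 1\<close> of big jobs can never be used up if there is a cover without
  big jobs.\<close>

definition local_ratio :: prog where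
  "local_ratio = For J 0 (Cond (Big (cell J))
       (Assign RESID (cell J) (Plus (cell TOTAL) (Const 1)))
       (Assign RESID (cell J) (Requirement (cell J)))) ;;
     For J 0 (For K 0 (Cond (Edge (cell J) (cell K)) charge Nop))"

text \<open>The value 0 of \<open>PICK\<close> means that no machine has been found yet, which is
  unambiguous since machine \<open>0\<close> is never allowed.\<close>

definition pick_machine :: prog where
  "pick_machine = Assign PICK (Const 0) (Const 0) ;;
     For K 1 (Cond (Conj (Conj (cell K) (Neq (Mod (cell K) (Const 2)) (Read COLOR (cell J))))
         (Disj (Neg (cell PICK))
           (Faster (cell K) (Plus (Read LOAD (cell K)) (Requirement (cell J)))
              (cell PICK) (Plus (Read LOAD (cell PICK)) (Requirement (cell J))))))
       (Assign PICK (Const 0) (cell K)) Nop)"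

definition place :: prog where
  "place = pick_machine ;;
     Assign SCHED (cell J) (cell PICK) ;;
     Assign LOAD (cell PICK) (Plus (Read LOAD (cell PICK)) (Requirement (cell J)))"

text \<open>Residual zero marks the jobs to be distributed. So the same program serves the cover
  left by \<open>local_ratio\<close> and, after \<open>zero_residuals\<close>, the set of all
  jobs.\<close>

definition pass :: "aexp \<Rightarrow> prog" where
  "pass b = For J 0 (Cond (Conj b (Neg (Read RESID (cell J)))) place Nop)"

definition clear_loads :: prog where
  "clear_loads = For K 1 (Assign LOAD (cell K) (Const 0))"

definition greedy_prog :: prog where
  "greedy_prog = For J 0 (Assign SCHED (cell J) (Const 0)) ;; clear_loads ;;
     pass (Big (cell J)) ;; pass (Neg (Big (cell J)))"

text \<open>A decoded assignment can violate any constraint, and with fewer than three machines the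
  constructed candidates can be infeasible as well.\<close>

definition validate :: prog where
  "validate = Assign VALID (Const 0) (Const 1) ;;
     For J 0 (Cond (Less (Read SCHED (cell J)) (Read 2 (Const 1))) Nop
       (Assign VALID (Const 0) (Const 0))) ;;
     For J 0 (For K 0 (Cond
       (Conj (Edge (cell J) (cell K)) (Neg (Neq (Read SCHED (cell J)) (Read SCHED (cell K)))))
       (Assign VALID (Const 0) (Const 0)) Nop))"

definition measure_schedule :: prog where
  "measure_schedule = clear_loads ;;
     For J 0 (Assign LOAD (Read SCHED (cell J))
       (Plus (Read LOAD (Read SCHED (cell J))) (Requirement (cell J)))) ;;
     Assign PICK (Const 0) (Const 0) ;;
     For K 1 (Cond (Faster (cell PICK) (Read LOAD (cell PICK)) (cell K) (Read LOAD (cell K)))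
       (Assign PICK (Const 0) (cell K)) Nop)"

text \<open>A makespan is kept as a machine attaining it together with its load, so that comparing
  two of them remains integer arithmetic.\<close>

definition record_best :: prog where
  "record_best = Cond
     (Conj (cell VALID) (Disj (Neg (cell FOUND))
       (Faster (cell PICK) (Read LOAD (cell PICK)) (cell BEST_MACHINE) (cell BEST_LOAD))))
     (For J 0 (Assign 1 (cell J) (Read SCHED (cell J))) ;;
      Assign BEST_LOAD (Const 0) (Read LOAD (cell PICK)) ;;
      Assign BEST_MACHINE (Const 0) (cell PICK) ;;
      Assign FOUND (Const 0) (Const 1)) Nop"

definition build :: prog where
  "build = Cond (Less (cell TOTAL) (Const 100)) decode
     (Cond (cell X)
       (Cond (Less (cell X) (Const 2)) local_ratio zero_residuals ;; greedy_prog)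
       two_machines)"

definition main_prog :: prog where
  "main_prog = color_graph ;; class_weights ;;
     For X 2 (build ;; validate ;; measure_schedule ;; record_best)"

lemmas prog_defs = sum_requirements_def power_loop_def relabel_def merge_def color_graph_def
  class_weights_def two_machines_def decode_def zero_residuals_def charge_def local_ratio_def
  pick_machine_def place_def pass_def clear_loads_def greedy_prog_def validate_def
  measure_schedule_def record_best_def build_def main_prog_def

lemma wf_progs: "wf_prog (sum_requirements ;; power_loop)" "wf_prog main_prog"
  by (simp_all add: prog_defs Class_def)

lemma writes_prog [simp]:
  "writes relabel = {L, COLOR, LABEL}"
  "writes merge = {TEMP, L, COLOR, LABEL}"
  "writes color_graph = {J, K, TEMP, L, COLOR, LABEL}"
  "writes class_weights = {J, CLASS}"
  "writes two_machines = {J, SCHED}"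
  "writes decode = {J, TEMP, SCHED}"
  "writes zero_residuals = {J, RESID}"
  "writes charge = {DELTA, RESID}"
  "writes local_ratio = {J, K, DELTA, RESID}"
  "writes pick_machine = {K, PICK}"
  "writes place = {K, PICK, SCHED, LOAD}"
  "writes (pass b) = {J, K, PICK, SCHED, LOAD}"
  "writes clear_loads = {K, LOAD}"
  "writes greedy_prog = {J, K, PICK, SCHED, LOAD}"
  "writes validate = {J, K, VALID}"
  "writes measure_schedule = {J, K, PICK, LOAD}"
  "writes record_best = {J, 1, BEST_LOAD, BEST_MACHINE, FOUND}"
  "writes build = {J, K, TEMP, SCHED, DELTA, RESID, PICK, LOAD}"
  by (auto simp: prog_defs)

context scheduling
begin

section \<open>Input layout and comparison of processing times\<close>

definition reads_input :: "store \<Rightarrow> bool" where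
  "reads_input s \<longleftrightarrow> s 2 0 = n \<and> s 2 1 = m \<and> (\<forall>j<n. s 0 (2 + j) = p j) \<and>
    (\<forall>i<m. s 0 (2 + n + 2 * i) = a i \<and> s 0 (2 + n + 2 * i + 1) = b i) \<and>
    (\<forall>u<n. \<forall>v<n. s 0 (2 + n + 2 * m + (u * n + v)) = (if adj u v then 1 else 0))"

lemma reads_input_cong: "s' 0 = s 0 \<Longrightarrow> s' 2 = s 2 \<Longrightarrow> reads_input s \<Longrightarrow> reads_input s'"
  by (simp add: reads_input_def)

definition ready :: "store \<Rightarrow> bool" where
  "ready s \<longleftrightarrow> reads_input s \<and> s TOTAL 0 = total"

lemma ready_cong: "s' 0 = s 0 \<Longrightarrow> s' 2 = s 2 \<Longrightarrow> s' TOTAL = s TOTAL \<Longrightarrow> ready s \<Longrightarrow> ready s'"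
  by (simp add: ready_def reads_input_def)

lemma ready_upd [simp]: "c \<noteq> 0 \<Longrightarrow> c \<noteq> 2 \<Longrightarrow> c \<noteq> TOTAL \<Longrightarrow> ready (upd c i x s) = ready s"
  by (simp add: ready_def reads_input_def)

lemma aval_input:
  assumes "reads_input s"
  shows "s 2 0 = n" "s 2 (Suc 0) = m"
    and "aval e s < n \<Longrightarrow> aval (Requirement e) s = p (aval e s)"
    and "aval e s < m \<Longrightarrow> aval (Numerator e) s = a (aval e s)"
    and "aval e s < m \<Longrightarrow> aval (Denominator e) s = b (aval e s)"
    and "aval d s < n \<Longrightarrow> aval e s < n \<Longrightarrow> aval (Edge d e) s = (if adj (aval d s) (aval e s) then 1 else 0)"
  using assms by (simp_all add: reads_input_def Requirement_def Numerator_def Denominator_def Edge_def)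

lemma less_times_iff:
  assumes "i < m" "k < m"
  shows "x * b i * a k < y * b k * a i \<longleftrightarrow> real x / speed i < real y / speed k"
proof -
  have "real x / speed i < real y / speed k \<longleftrightarrow> real (x * b i * a k) < real (y * b k * a i)"
    using assms a_pos[of i] a_pos[of k] b_pos[of i] b_pos[of k]
    by (simp add: speed_def divide_simps mult_ac)
  then show ?thesis by (simp only: of_nat_less_iff)
qed

lemma aval_ready [simp]:
  assumes "ready s"
  shows "s 2 0 = n" "s 2 (Suc 0) = m" "s TOTAL 0 = total"
    and "aval e s < n \<Longrightarrow> aval (Requirement e) s = p (aval e s)"
    and "aval d s < n \<Longrightarrow> aval e s < n \<Longrightarrow> aval (Edge d e) s = (if adj (aval d s) (aval e s) then 1 else 0)"
    and "aval e s < n \<Longrightarrow> aval (Big e) s = (if big (aval e s) then 1 else 0)"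
    and "aval d s < m \<Longrightarrow> aval e s < m
      \<Longrightarrow> aval (Faster d x e y) s = 0 \<longleftrightarrow> \<not> real (aval x s) / speed (aval d s) < real (aval y s) / speed (aval e s)"
    and "aval d s < m \<Longrightarrow> aval e s < m
      \<Longrightarrow> 0 < aval (Faster d x e y) s \<longleftrightarrow> real (aval x s) / speed (aval d s) < real (aval y s) / speed (aval e s)"
  using assms less_times_iff[of "aval d s" "aval e s" "aval x s" "aval y s"]
  by (auto simp: ready_def aval_input Big_def big_def Faster_def)

lemma run_sum_requirements:
  assumes "reads_input s" "s TOTAL 0 = 0"
  shows "ready (run sum_requirements s)"
proof -
  have "run sum_requirements s TOTAL 0 = (\<Sum>j<n. p j)"
    unfolding sum_requirements_def
  proof (rule run_For_induct[where I = "\<lambda>i s. s TOTAL 0 = (\<Sum>j<i. p j)" and N = n])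
    fix i s'
    assume i: "i < n" "s' TOTAL 0 = (\<Sum>j<i. p j)" "s' J 0 = i"
      and fr: "\<And>c. c \<noteq> J \<Longrightarrow> c \<notin> writes (Assign TOTAL (Const 0) (Plus (cell TOTAL) (Requirement (cell J))))
        \<Longrightarrow> s' c = s c"
    have "reads_input s'" using assms(1) by (simp add: reads_input_def fr)
    then show "run (Assign TOTAL (Const 0) (Plus (cell TOTAL) (Requirement (cell J)))) s' TOTAL 0
        = (\<Sum>j<Suc i. p j)"
      using i by (simp add: aval_input)
  qed (use assms in \<open>auto simp: aval_input\<close>)
  moreover have "run sum_requirements s 0 = s 0" "run sum_requirements s 2 = s 2"
    by (rule run_frame; simp add: sum_requirements_def)+
  then have "reads_input (run sum_requirements s)"
    using assms(1) by (rule reads_input_cong)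
  ultimately show ?thesis by (simp only: ready_def total_def)
qed

lemma run_power_loop:
  assumes "s 2 0 = n" "s 2 1 = m"
  shows "run power_loop s POWER 0 = m ^ n"
proof -
  let ?body = "For K 1 (Assign AUX (Const 0) (Plus (cell AUX) (cell POWER)))"
  have inner: "run ?body s AUX 0 = s AUX 0 + m * s POWER 0" if "s 2 1 = m" for s
  proof (rule run_For_induct[where I = "\<lambda>i s'. s' AUX 0 = s AUX 0 + i * s POWER 0" and N = m])
    fix i s'
    assume "s' AUX 0 = s AUX 0 + i * s POWER 0"
      and "\<And>c. c \<noteq> K \<Longrightarrow> c \<notin> writes (Assign AUX (Const 0) (Plus (cell AUX) (cell POWER))) \<Longrightarrow> s' c = s c"
    then show "run (Assign AUX (Const 0) (Plus (cell AUX) (cell POWER))) s' AUX 0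
        = s AUX 0 + Suc i * s POWER 0" by simp
  qed (use that in auto)
  have *: "run (For J 0 (Assign AUX (Const 0) (Const 0) ;; ?body ;; Assign POWER (Const 0) (cell AUX))) s POWER 0
      = m ^ n" if "s 2 0 = n" "s 2 1 = m" "s POWER 0 = 1" for s
  proof (rule run_For_induct[where I = "\<lambda>i s. s POWER 0 = m ^ i" and N = n])
    fix i s'
    assume i: "s' POWER 0 = m ^ i"
      and fr: "\<And>c. c \<noteq> J \<Longrightarrow> c \<notin> writes (Assign AUX (Const 0) (Const 0) ;; ?body ;;
        Assign POWER (Const 0) (cell AUX)) \<Longrightarrow> s' c = s c"
    have "s' 2 = s 2" by (simp add: fr)
    then show "run (Assign AUX (Const 0) (Const 0) ;; ?body ;; Assign POWER (Const 0) (cell AUX)) s' POWER 0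
        = m ^ Suc i"
      using i that by (simp add: inner[simplified])
  qed (use that in auto)
  show ?thesis unfolding power_loop_def run.simps(3) by (rule *) (use assms in auto)
qed


section \<open>2-colouring by merging label classes\<close>

lemma run_relabel:
  assumes "s 2 0 = n"
  shows "run relabel s LABEL x = (if x < n \<and> s LABEL x = s TEMP 0 then s TEMP 1 else s LABEL x) \<and>
    run relabel s COLOR x = (if x < n \<and> s LABEL x = s TEMP 0 \<and> s TEMP 2 = 0 then 1 - s COLOR x else s COLOR x)"
proof -
  let ?I = "\<lambda>i s'. \<forall>x. s' LABEL x = (if x < i \<and> s LABEL x = s TEMP 0 then s TEMP 1 else s LABEL x) \<and>
    s' COLOR x = (if x < i \<and> s LABEL x = s TEMP 0 \<and> s TEMP 2 = 0 then 1 - s COLOR x else s COLOR x)"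
  have "?I n (run relabel s)"
    unfolding relabel_def
  proof (rule run_For_induct[where I = ?I and N = n], goal_cases)
    case (5 i s')
    have "s' TEMP = s TEMP" by (rule 5(4)) auto
    with 5(1,2,3) show ?case
      by (auto simp: less_Suc_eq)
  qed (use assms in auto)
  then show ?thesis by blast
qed

text \<open>The last condition replaces connectedness of the label classes: on each of them a proper
  colouring is determined up to an exchange of the colours.\<close>

definition merged :: "(nat \<times> nat) set \<Rightarrow> (nat \<Rightarrow> nat) \<Rightarrow> (nat \<Rightarrow> nat) \<Rightarrow> bool" where
  "merged E l c \<longleftrightarrow> (\<forall>j<n. c j \<le> 1 \<and> l j < n) \<and>
    (\<forall>(u, v)\<in>E. u < n \<longrightarrow> v < n \<longrightarrow> adj u v \<longrightarrow> l u = l v \<and> c u \<noteq> c v) \<and>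
    (\<forall>f. proper f \<longrightarrow> (\<forall>x<n. \<forall>y<n. l x = l y \<longrightarrow> (f x = f y \<longleftrightarrow> c x = c y)))"

lemma merged_iff:
  "merged E l c \<Longrightarrow> proper f \<Longrightarrow> x < n \<Longrightarrow> y < n \<Longrightarrow> l x = l y \<Longrightarrow> f x = f y \<longleftrightarrow> c x = c y"
  by (simp add: merged_def)

text \<open>Here bipartiteness rules out odd cycles: some proper colouring separates the ends of the
  edge, and on a label class \<open>c\<close> agrees with it up to an exchange of the
  colours.\<close>

lemma merged_skip:
  assumes "merged E l c" "u < n" "v < n" "adj u v \<Longrightarrow> l u = l v"
  shows "merged (insert (u, v) E) l c"
proof -
  obtain f where f: "proper f" using adj_2colorable unfolding proper_def by blast
  have "c u \<noteq> c v" if "adj u v"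
    using merged_iff[OF assms(1) f assms(2,3)] assms f that by (simp add: proper_def)
  then show ?thesis using assms unfolding merged_def by auto
qed

text \<open>Both classes determine their colourings up to exchange, and the edge forces
  \<open>f u \<noteq> f v\<close> for every proper \<open>f\<close>. So the union determines its
  colouring too, once the class of \<open>u\<close> is flipped if necessary to make the ends of the
  edge differ.\<close>

lemma merged_merge:
  assumes M: "merged E l c" and uv: "u < n" "v < n" "adj u v" "l u \<noteq> l v"
    and l': "\<And>x. x < n \<Longrightarrow> l' x = (if l x = l u then l v else l x)"
    and c': "\<And>x. x < n \<Longrightarrow> c' x = (if l x = l u \<and> c u = c v then 1 - c x else c x)"
  shows "merged (insert (u, v) E) l' c'"
  unfolding merged_def
proof (intro conjI allI impI ballI)
  fix j assume "j < n"
  then show "c' j \<le> 1" "l' j < n" using M uv by (auto simp: l' c' merged_def)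
next
  have c1: "c x \<le> 1" if "x < n" for x using M that by (simp add: merged_def)
  have eq: "f x = f y \<longleftrightarrow> c' x = c' y" if f: "proper f" and xy: "x < n" "y < n" "l' x = l' y" for f x y
  proof -
    have *: "f x = f y \<longleftrightarrow> c x = c y" if "x < n" "y < n" "l x = l y" for x y
      using merged_iff[OF M f that] .
    have uv': "f u \<noteq> f v" using f uv by (simp add: proper_def)
    have bin: "c x = 0 \<or> c x = 1" if "x < n" for x using c1[OF that] by auto
    show ?thesis
    proof (cases "l x = l y")
      case True
      then show ?thesis using *[OF xy(1,2) True] bin[OF xy(1)] bin[OF xy(2)] xy by (auto simp: c')
    next
      case False
      then consider "l x = l u" "l y = l v" | "l y = l u" "l x = l v"
        using xy l'[OF xy(1)] l'[OF xy(2)] by (auto split: if_splits)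
      then show ?thesis
      proof cases
        case 1
        have "f x = f u \<longleftrightarrow> c x = c u" "f y = f v \<longleftrightarrow> c y = c v"
          using *[of x u] *[of y v] 1 xy uv by blast+
        moreover have "c' x = (if c u = c v then 1 - c x else c x)" "c' y = c y"
          using 1 xy uv by (auto simp: c')
        ultimately show ?thesis
          using uv' bin[OF xy(1)] bin[OF xy(2)] bin[OF uv(1)] bin[OF uv(2)] by (elim disjE) auto
      next
        case 2
        have "f y = f u \<longleftrightarrow> c y = c u" "f x = f v \<longleftrightarrow> c x = c v"
          using *[of y u] *[of x v] 2 xy uv by blast+
        moreover have "c' y = (if c u = c v then 1 - c y else c y)" "c' x = c x"
          using 2 xy uv by (auto simp: c')
        ultimately show ?thesis
          using uv' bin[OF xy(1)] bin[OF xy(2)] bin[OF uv(1)] bin[OF uv(2)] by (elim disjE) auto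
      qed
    qed
  qed
  then show "f x = f y \<longleftrightarrow> c' x = c' y" if "proper f" "x < n" "y < n" "l' x = l' y" for f x y
    using that by blast
  obtain f where f: "proper f" using adj_2colorable unfolding proper_def by blast
  fix e assume "e \<in> insert (u, v) E"
  moreover obtain x y where e: "e = (x, y)" by force
  ultimately have "x < n \<Longrightarrow> y < n \<Longrightarrow> adj x y \<Longrightarrow> l' x = l' y"
    using M uv by (auto simp: merged_def l')
  moreover have "x < n \<Longrightarrow> y < n \<Longrightarrow> adj x y \<Longrightarrow> f x \<noteq> f y"
    using f by (simp add: proper_def)
  ultimately show "case e of (u, v) \<Rightarrow> u < n \<longrightarrow> v < n \<longrightarrow> adj u v \<longrightarrow> l' u = l' v \<and> c' u \<noteq> c' v"
    using eq[OF f, of x y] e by auto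
qed

lemma run_merge:
  assumes "ready s" "merged E (s LABEL) (s COLOR)" "s J 0 = u" "s K 0 = v"
    and "u < n" "v < n" "adj u v" "s LABEL u \<noteq> s LABEL v"
  shows "merged (insert (u, v) E) (run merge s LABEL) (run merge s COLOR)"
proof (rule merged_merge[OF assms(2,5-8)])
  define s' where "s' = upd TEMP 2 (s COLOR u - s COLOR v + (s COLOR v - s COLOR u))
    (upd TEMP 1 (s LABEL v) (upd TEMP 0 (s LABEL u) s))"
  have eq: "run merge s = run relabel s'"
    unfolding merge_def s'_def using assms by (simp add: numeral_2_eq_2)
  have "s' 2 0 = n" using assms by (simp add: s'_def)
  then have rel: "run relabel s' LABEL x = (if x < n \<and> s' LABEL x = s' TEMP 0 then s' TEMP 1 else s' LABEL x) \<and>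
      run relabel s' COLOR x = (if x < n \<and> s' LABEL x = s' TEMP 0 \<and> s' TEMP 2 = 0 then 1 - s' COLOR x else s' COLOR x)"
    for x by (rule run_relabel)
  show "run merge s LABEL x = (if s LABEL x = s LABEL u then s LABEL v else s LABEL x)" if "x < n" for x
    unfolding eq using rel[of x] that by (auto simp: s'_def)
  show "run merge s COLOR x = (if s LABEL x = s LABEL u \<and> s COLOR u = s COLOR v then 1 - s COLOR x else s COLOR x)"
    if "x < n" for x
    unfolding eq using rel[of x] that by (auto simp: s'_def)
qed

definition pairs_before :: "nat \<Rightarrow> nat \<Rightarrow> (nat \<times> nat) set" where
  "pairs_before u v = {(x, y). x < n \<and> y < n \<and> (x < u \<or> x = u \<and> y < v)}"

lemma pairs_before_simps:
  "pairs_before 0 0 = {}"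
  "u < n \<Longrightarrow> v < n \<Longrightarrow> pairs_before u (Suc v) = insert (u, v) (pairs_before u v)"
  "pairs_before u n = pairs_before (Suc u) 0"
  "pairs_before n 0 = {..<n} \<times> {..<n}"
  by (auto simp: pairs_before_def less_Suc_eq)

text \<open>The invariant sees only the set of pairs visited so far; the lexicographic order of the
  two loops stays hidden.\<close>

lemma run_pairs_induct:
  assumes "J \<notin> writes q" "K \<notin> writes q" "s 2 0 = n"
    and base: "I {} s"
    and indep: "\<And>E s x. I E (upd J 0 x s) = I E s" "\<And>E s x. I E (upd K 0 x s) = I E s"
    and step: "\<And>E u v s'. u < n \<Longrightarrow> v < n \<Longrightarrow> I E s' \<Longrightarrow> s' J 0 = u \<Longrightarrow> s' K 0 = v
      \<Longrightarrow> (\<And>c. c \<noteq> J \<Longrightarrow> c \<noteq> K \<Longrightarrow> c \<notin> writes q \<Longrightarrow> s' c = s c) \<Longrightarrow> I (insert (u, v) E) (run q s')"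
    and "2 \<notin> writes q"
  shows "I ({..<n} \<times> {..<n}) (run (For J 0 (For K 0 q)) s)"
proof -
  have "I (pairs_before n 0) (run (For J 0 (For K 0 q)) s)"
  proof (rule run_For_induct[where I = "\<lambda>u. I (pairs_before u 0)" and N = n])
    fix u s1
    assume u: "u < n" "I (pairs_before u 0) s1" "s1 J 0 = u"
      and fr1: "\<And>c. c \<noteq> J \<Longrightarrow> c \<notin> writes (For K 0 q) \<Longrightarrow> s1 c = s c"
    have "I (pairs_before u n) (run (For K 0 q) s1)"
    proof (rule run_For_induct[where I = "\<lambda>v. I (pairs_before u v)" and N = n])
      show "s1 2 0 = n" using fr1[of 2] assms by auto
      fix v s2
      assume v: "v < n" "I (pairs_before u v) s2" "s2 K 0 = v"
        and fr2: "\<And>c. c \<noteq> K \<Longrightarrow> c \<notin> writes q \<Longrightarrow> s2 c = s1 c"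
      have "s2 J 0 = u" using fr2[of J] assms(1) u(3) by simp
      then show "I (pairs_before u (Suc v)) (run q s2)"
        unfolding pairs_before_simps(2)[OF u(1) v(1)]
        using u(1) v fr1 fr2 by (intro step) auto
    qed (use u assms in auto)
    then show "I (pairs_before (Suc u) 0) (run (For K 0 q) s1)"
      by (simp add: pairs_before_simps)
  qed (use assms in \<open>auto simp: pairs_before_simps\<close>)
  then show ?thesis by (simp add: pairs_before_simps)
qed

lemma run_color_graph:
  assumes "ready s" "\<And>j. s COLOR j = 0"
  shows "merged ({..<n} \<times> {..<n}) (run color_graph s LABEL) (run color_graph s COLOR)"
proof -
  let ?init = "For J 0 (Assign LABEL (cell J) (cell J))"
  have lab: "\<forall>j<n. run ?init s LABEL j = j"
  proof (rule run_For_induct[where I = "\<lambda>i s. \<forall>j<i. s LABEL j = j" and N = n])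
    fix i :: nat and s' :: store
    assume "\<forall>j<i. s' LABEL j = j" "s' J 0 = i"
    then show "\<forall>j<Suc i. run (Assign LABEL (cell J) (cell J)) s' LABEL j = j"
      by (auto simp: less_Suc_eq)
  qed (use assms(1) in auto)
  have fr: "run ?init s c = s c" if "c \<noteq> J" "c \<noteq> LABEL" for c
    using that by (intro run_frame) auto
  have rd: "ready (run ?init s)"
    using assms(1) by (rule ready_cong[rotated 3]) (simp_all add: fr)
  show ?thesis
    unfolding color_graph_def run.simps(3)
  proof (rule run_pairs_induct[where I = "\<lambda>E s. merged E (s LABEL) (s COLOR)"])
    show "merged {} (run ?init s LABEL) (run ?init s COLOR)"
      using lab assms(2) by (auto simp: merged_def fr)
    fix E u v s'
    let ?p = "Cond (Conj (Edge (cell J) (cell K)) (Neq (Read LABEL (cell J)) (Read LABEL (cell K)))) merge Nop"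
    assume uv: "u < n" "v < n" "merged E (s' LABEL) (s' COLOR)" "s' J 0 = u" "s' K 0 = v"
      and fr': "\<And>c. c \<noteq> J \<Longrightarrow> c \<noteq> K \<Longrightarrow> c \<notin> writes ?p \<Longrightarrow> s' c = run ?init s c"
    have rd': "ready s'"
      using rd by (rule ready_cong[rotated 3]) (simp_all add: fr')
    show "merged (insert (u, v) E) (run ?p s' LABEL) (run ?p s' COLOR)"
      using uv rd' run_merge[OF rd' uv(3,4,5,1,2)] merged_skip[OF uv(3,1,2)] by auto
  qed (use rd in auto)
qed

section \<open>The minority schedule on two machines\<close>

lemma run_class_weights:
  assumes "ready s" "\<And>i. s CLASS i = 0"
  shows "run class_weights s CLASS k = (\<Sum>j\<in>{j\<in>{..<n}. 2 * s LABEL j + s COLOR j = k}. p j)"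
proof -
  let ?I = "\<lambda>i s'. \<forall>k. s' CLASS k = (\<Sum>j\<in>{j\<in>{..<i}. 2 * s LABEL j + s COLOR j = k}. p j)"
  have "?I n (run class_weights s)"
    unfolding class_weights_def
  proof (rule run_For_induct[where I = ?I and N = n], goal_cases)
    case (5 i s')
    have fr: "s' c = s c" if "c \<noteq> J" "c \<noteq> CLASS" for c using that by (intro 5(4)) auto
    have "ready s'"
      using assms(1) by (rule ready_cong[rotated 3]) (simp_all add: fr)
    moreover have "{j\<in>{..<Suc i}. 2 * s LABEL j + s COLOR j = k} =
      (if 2 * s LABEL i + s COLOR i = k then insert i {j\<in>{..<i}. 2 * s LABEL j + s COLOR j = k}
        else {j\<in>{..<i}. 2 * s LABEL j + s COLOR j = k})" for k
      by (auto simp: less_Suc_eq)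
    ultimately show ?case
      using 5(1,2,3) by (simp add: fr Class_def)
  qed (use assms in auto)
  then show ?thesis by blast
qed

text \<open>Labels can be treated separately: within a label class every proper colouring selects
  one of the same two colour classes, and \<open>\<sigma>\<close> selects a lighter one. Summation
  over the labels gives minimality.\<close>

lemma two_machine_schedule_minority:
  assumes M: "merged ({..<n} \<times> {..<n}) l c"
    and w: "\<And>k. w k = (\<Sum>j\<in>{j\<in>{..<n}. 2 * l j + c j = k}. p j)"
    and \<sigma>: "\<And>j. j < n \<Longrightarrow> \<sigma> j = (if w (2 * l j + (1 - c j)) < w (2 * l j + c j) + (1 - c j) then 0 else 1)"
  shows "two_machine_schedule \<sigma>"
proof -
  have c1: "c j \<le> 1" if "j < n" for j using M that by (simp add: merged_def)
  have alt: "(\<sigma> j = 1 \<longleftrightarrow> c j = 1) \<and> w (2 * l j + 1) \<le> w (2 * l j)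
      \<or> (\<sigma> j = 1 \<longleftrightarrow> c j = 0) \<and> w (2 * l j) \<le> w (2 * l j + 1)" if "j < n" for j
  proof -
    consider "c j = 0" | "c j = 1" using c1[OF \<open>j < n\<close>] by linarith
    then show ?thesis using \<sigma>[OF that] by cases auto
  qed
  have \<sigma>1: "\<sigma> j \<le> 1" if "j < n" for j using \<sigma>[OF that] by simp
  have min: "(\<Sum>j\<in>{j\<in>{j\<in>{..<n}. \<sigma> j = 1}. l j = i}. p j) \<le> (\<Sum>j\<in>{j\<in>{j\<in>{..<n}. f j}. l j = i}. p j)"
    if f: "proper f" for f i
  proof (cases "\<exists>x<n. l x = i")
    case False
    then have "{j\<in>{j\<in>{..<n}. \<sigma> j = 1}. l j = i} = {}" by auto
    then show ?thesis by (simp only: sum.empty le0)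
  next
    case True
    then obtain x where x: "x < n" "l x = i" by blast
    have fx: "f y = f x \<longleftrightarrow> c y = c x" if "y < n" "l y = i" for y
      using merged_iff[OF M f that(1) x(1)] that(2) x(2) by simp
    have bin: "c y = 0 \<or> c y = 1" if "y < n" for y using c1[OF that] by auto
    have cls: "2 * l j + c j = 2 * i \<longleftrightarrow> l j = i \<and> c j = 0"
      "2 * l j + c j = 2 * i + 1 \<longleftrightarrow> l j = i \<and> c j = 1"
      "2 * l j + c j = Suc (2 * i) \<longleftrightarrow> l j = i \<and> c j = 1" if "j < n" for j
      using c1[OF that] by presburger+
    have w0: "w (2 * i) = (\<Sum>j\<in>{j\<in>{..<n}. l j = i \<and> c j = 0}. p j)"
      unfolding w by (intro arg_cong[of _ _ "sum p"]) (auto simp: cls)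
    have w1: "w (2 * i + 1) = (\<Sum>j\<in>{j\<in>{..<n}. l j = i \<and> c j = 1}. p j)"
      unfolding w by (intro arg_cong[of _ _ "sum p"]) (auto simp: cls)
    have "(\<Sum>j\<in>{j\<in>{j\<in>{..<n}. \<sigma> j = 1}. l j = i}. p j) = min (w (2 * i)) (w (2 * i + 1))"
    proof (cases "w (2 * i + 1) \<le> w (2 * i)")
      case le: True
      show ?thesis
      proof (cases "w (2 * i) = w (2 * i + 1)")
        case eq: True
        have "\<sigma> j = 1 \<longleftrightarrow> c j = 1" if "j < n" "l j = i" for j
          using \<sigma>[OF that(1)] that(2) eq bin[OF that(1)] by auto
        then have "{j\<in>{j\<in>{..<n}. \<sigma> j = 1}. l j = i} = {j\<in>{..<n}. l j = i \<and> c j = 1}" by auto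
        then show ?thesis using le by (simp only: w1[symmetric] min.absorb2)
      next
        case False
        then have "\<sigma> j = 1 \<longleftrightarrow> c j = 1" if "j < n" "l j = i" for j
          using alt[OF that(1)] that(2) le by auto
        then have "{j\<in>{j\<in>{..<n}. \<sigma> j = 1}. l j = i} = {j\<in>{..<n}. l j = i \<and> c j = 1}" by auto
        then show ?thesis using le by (simp only: w1[symmetric] min.absorb2)
      qed
    next
      case False
      then have "\<sigma> j = 1 \<longleftrightarrow> c j = 0" if "j < n" "l j = i" for j
        using alt[OF that(1)] that(2) by auto
      then have "{j\<in>{j\<in>{..<n}. \<sigma> j = 1}. l j = i} = {j\<in>{..<n}. l j = i \<and> c j = 0}" by auto
      then show ?thesis using False by (simp only: w0[symmetric] min.absorb1 not_le less_imp_le)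
    qed
    moreover have "(\<Sum>j\<in>{j\<in>{j\<in>{..<n}. f j}. l j = i}. p j) \<in> {w (2 * i), w (2 * i + 1)}"
    proof (cases "f x \<longleftrightarrow> c x = 1")
      case True
      then have "f j \<longleftrightarrow> c j = 1" if "j < n" "l j = i" for j
        using fx[OF that] bin[OF that(1)] bin[OF x(1)] by auto
      then have "{j\<in>{j\<in>{..<n}. f j}. l j = i} = {j\<in>{..<n}. l j = i \<and> c j = 1}" by auto
      then show ?thesis by (simp only: w1 insert_iff simp_thms)
    next
      case False
      then have "f j \<longleftrightarrow> c j = 0" if "j < n" "l j = i" for j
        using fx[OF that] bin[OF that(1)] bin[OF x(1)] by auto
      then have "{j\<in>{j\<in>{..<n}. f j}. l j = i} = {j\<in>{..<n}. l j = i \<and> c j = 0}" by auto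
      then show ?thesis by (simp only: w0 insert_iff simp_thms)
    qed
    ultimately show ?thesis by auto
  qed
  have group: "(\<Sum>i<n. \<Sum>j\<in>{j\<in>{j\<in>{..<n}. P j}. l j = i}. p j) = (\<Sum>j\<in>{j\<in>{..<n}. P j}. p j)" for P
    using M by (intro sum.group) (auto simp: merged_def)
  show ?thesis unfolding two_machine_schedule_def
  proof (intro conjI allI impI)
    show "\<sigma> j \<le> 1" if "j < n" for j using \<sigma>1[OF that] .
    show "\<sigma> u \<noteq> \<sigma> v" if "u < n" "v < n" "adj u v" for u v
    proof -
      have "l u = l v" "c u \<noteq> c v" using M that by (auto simp: merged_def)
      moreover have "c u = 0 \<or> c u = 1" "c v = 0 \<or> c v = 1"
        using c1[OF that(1)] c1[OF that(2)] by auto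
      ultimately show ?thesis
        using \<sigma>[OF that(1)] \<sigma>[OF that(2)] by auto
    qed
    show "load {..<n} \<sigma> 1 \<le> (\<Sum>j\<in>{j. j < n \<and> f j}. p j)" if "proper f" for f
    proof -
      have "load {..<n} \<sigma> 1 = (\<Sum>i<n. \<Sum>j\<in>{j\<in>{j\<in>{..<n}. \<sigma> j = 1}. l j = i}. p j)"
        unfolding load_def by (simp only: group)
      also have "\<dots> \<le> (\<Sum>i<n. \<Sum>j\<in>{j\<in>{j\<in>{..<n}. f j}. l j = i}. p j)"
        by (intro sum_mono min that)
      also have "\<dots> = (\<Sum>j\<in>{j\<in>{..<n}. f j}. p j)" by (rule group)
      finally show ?thesis by simp
    qed
  qed
qed

lemma run_two_machines:
  assumes "ready s" "merged ({..<n} \<times> {..<n}) (s LABEL) (s COLOR)"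
    and "\<And>k. s CLASS k = (\<Sum>j\<in>{j\<in>{..<n}. 2 * s LABEL j + s COLOR j = k}. p j)"
  shows "two_machine_schedule (run two_machines s SCHED)"
proof (rule two_machine_schedule_minority[OF assms(2,3)])
  let ?\<sigma> = "\<lambda>j. if s CLASS (2 * s LABEL j + (1 - s COLOR j)) < s CLASS (2 * s LABEL j + s COLOR j) + (1 - s COLOR j)
    then 0 else 1"
  have "\<forall>j<n. run two_machines s SCHED j = ?\<sigma> j"
    unfolding two_machines_def
  proof (rule run_For_induct[where I = "\<lambda>i s'. \<forall>j<i. s' SCHED j = ?\<sigma> j" and N = n], goal_cases)
    case (5 i s')
    have fr: "s' c = s c" if "c \<noteq> J" "c \<noteq> SCHED" for c using that by (intro 5(4)) auto
    show ?case using 5(1,2,3) by (auto simp: fr Class_def less_Suc_eq)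
  qed (use assms in auto)
  then show "run two_machines s SCHED j = ?\<sigma> j" if "j < n" for j using that by blast
qed

lemma run_decode:
  assumes "ready s" "s X 0 = x"
  shows "\<forall>j<n. run decode s SCHED j = (x div m ^ j) mod m"
proof -
  let ?I = "\<lambda>i s'. s' TEMP 0 = x div m ^ i \<and> (\<forall>j<i. s' SCHED j = (x div m ^ j) mod m)"
  have "?I n (run decode s)"
    unfolding decode_def run.simps(3)
  proof (rule run_For_induct[where I = ?I and N = n], goal_cases)
    case (5 i s')
    have fr: "s' c = s c" if "c \<noteq> J" "c \<noteq> SCHED" "c \<noteq> TEMP" for c
      using that 5(4)[of c] by auto
    show ?case using 5(1,2,3) assms by (auto simp: fr less_Suc_eq div_mult2_eq power_Suc2 simp del: power_Suc)
  qed (use assms in auto)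
  then show ?thesis by blast
qed


section \<open>The local ratio cover\<close>

text \<open>Both ends of an edge are reduced by the same amount, so the two colour classes are charged
  equally; every cover pays for each reduction at least once.\<close>

definition charged :: "(nat \<Rightarrow> nat) \<Rightarrow> (nat \<Rightarrow> nat) \<Rightarrow> (nat \<times> nat) set \<Rightarrow> (nat \<Rightarrow> nat) \<Rightarrow> bool" where
  "charged col w0 E w \<longleftrightarrow> (\<forall>j<n. w j \<le> w0 j) \<and>
    (\<forall>u<n. \<forall>v<n. (u, v) \<in> E \<longrightarrow> adj u v \<longrightarrow> w u = 0 \<or> w v = 0) \<and>
    (\<exists>D. (\<forall>c\<le>1. sum w0 {j\<in>{..<n}. col j = c} = D + sum w {j\<in>{..<n}. col j = c}) \<and>
      (\<forall>Y. cover Y \<longrightarrow> D + sum w Y \<le> sum w0 Y))"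

lemma charged_zero:
  "charged col w0 E w \<Longrightarrow> u < n \<Longrightarrow> v < n \<Longrightarrow> (u, v) \<in> E \<Longrightarrow> adj u v \<Longrightarrow> w u = 0 \<or> w v = 0"
  by (simp add: charged_def)

lemma charged_skip:
  assumes "charged col w0 E w" "\<not> adj u v"
  shows "charged col w0 (insert (u, v) E) w"
proof -
  have zero: "w x = 0 \<or> w y = 0" if "x < n" "y < n" "(x, y) \<in> insert (u, v) E" "adj x y" for x y
    using charged_zero[OF assms(1) that(1,2) _ that(4)] that(3,4) assms(2) by auto
  show ?thesis
    unfolding charged_def
  proof (intro conjI)
    show "\<forall>x<n. \<forall>y<n. (x, y) \<in> insert (u, v) E \<longrightarrow> adj x y \<longrightarrow> w x = 0 \<or> w y = 0"
      by (intro allI impI) (rule zero)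
  qed (use assms(1) in \<open>simp_all add: charged_def\<close>)
qed

lemma sum_reduce:
  fixes w :: "nat \<Rightarrow> nat"
  assumes "finite A" "u \<noteq> v" "d \<le> w u" "d \<le> w v"
  shows "sum w A = sum (w(u := w u - d, v := w v - d)) A + (if u \<in> A then d else 0) + (if v \<in> A then d else 0)"
proof -
  have "sum w A = (\<Sum>j\<in>A. (w(u := w u - d, v := w v - d)) j + ((if j = u then d else 0) + (if j = v then d else 0)))"
    using assms by (intro sum.cong) auto
  then show ?thesis using assms(1) by (simp add: sum.distrib)
qed

lemma charged_charge:
  assumes "charged col w0 E w" "coloring col" "u < n" "v < n" "adj u v"
    and "d = min (w u) (w v)"
  shows "charged col w0 (insert (u, v) E) (w(u := w u - d, v := w v - d))"
proof -
  let ?w = "w(u := w u - d, v := w v - d)"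
  obtain D where D: "\<And>c. c \<le> 1 \<Longrightarrow> sum w0 {j\<in>{..<n}. col j = c} = D + sum w {j\<in>{..<n}. col j = c}"
    "\<And>Y. cover Y \<Longrightarrow> D + sum w Y \<le> sum w0 Y"
    using assms(1) unfolding charged_def by blast
  have uv: "col u \<noteq> col v" "u \<noteq> v" "col u \<le> 1" "col v \<le> 1"
    using assms(2-5) by (auto simp: coloring_def)
  have d: "d \<le> w u" "d \<le> w v" using assms(6) by auto
  show ?thesis
    unfolding charged_def
  proof (intro conjI exI[of _ "D + d"] allI impI)
    show "?w j \<le> w0 j" if "j < n" for j
      using assms(1) that by (auto simp: charged_def intro: le_trans[OF diff_le_self])
    show "?w x = 0 \<or> ?w y = 0" if "x < n" "y < n" "(x, y) \<in> insert (u, v) E" "adj x y" for x y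
    proof (cases "(x, y) = (u, v)")
      case True
      then show ?thesis using assms(6) by (auto simp: min_def)
    next
      case False
      then have "(x, y) \<in> E" using that(3) by auto
      then have "w x = 0 \<or> w y = 0" by (intro charged_zero[OF assms(1) that(1,2) _ that(4)])
      then show ?thesis by auto
    qed
    show "sum w0 {j\<in>{..<n}. col j = c} = D + d + sum ?w {j\<in>{..<n}. col j = c}" if "c \<le> 1" for c
    proof -
      have "col u = c \<and> col v \<noteq> c \<or> col u \<noteq> c \<and> col v = c" using uv that by linarith
      then have "sum w {j\<in>{..<n}. col j = c} = sum ?w {j\<in>{..<n}. col j = c} + d"
        using sum_reduce[of "{j\<in>{..<n}. col j = c}" u v d w] uv(2) d assms(3,4) by auto
      then show ?thesis using D(1)[OF that] by simp
    qed
    show "D + d + sum ?w Y \<le> sum w0 Y" if "cover Y" for Y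
    proof -
      have "u \<in> Y \<or> v \<in> Y" "finite Y"
        using that assms(3-5) by (auto simp: cover_def intro: finite_subset)
      then show ?thesis using D(2)[OF that] sum_reduce[of Y u v d w] uv(2) d by auto
    qed
  qed
qed

text \<open>Each colour class loses exactly \<open>D\<close> in total. Jobs with residual zero have
  lost all their weight, so those of one colour weigh at most \<open>D\<close>, which in turn is at
  most the weight of any cover.\<close>

lemma charged_balanced_cover:
  assumes "coloring col" "charged col w0 ({..<n} \<times> {..<n}) w"
    and w0: "\<And>j. j < n \<Longrightarrow> w0 j = (if big j then total + 1 else p j)"
  shows "balanced_cover col {j\<in>{..<n}. w j = 0}"
proof -
  let ?X = "{j\<in>{..<n}. w j = 0}"
  obtain D where D: "\<And>c. c \<le> 1 \<Longrightarrow> sum w0 {j\<in>{..<n}. col j = c} = D + sum w {j\<in>{..<n}. col j = c}"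
    "\<And>Y. cover Y \<Longrightarrow> D + sum w Y \<le> sum w0 Y"
    using assms(2) unfolding charged_def by blast
  have le: "w j \<le> w0 j" if "j < n" for j using assms(2) that by (simp add: charged_def)
  show ?thesis
    unfolding balanced_cover_def
  proof (intro conjI allI impI ballI; (elim conjE)?)
    show "cover ?X" using assms(2) by (auto simp: charged_def cover_def)
    fix Y assume Y: "cover Y" "\<forall>j\<in>Y. \<not> big j"
    then have Yn: "Y \<subseteq> {..<n}" by (simp add: cover_def)
    have "sum w0 Y = sum p Y" using Y(2) Yn by (intro sum.cong) (auto simp: w0)
    then have DY: "D \<le> sum p Y" using D(2)[OF Y(1)] by simp
    also have "\<dots> \<le> total" unfolding total_def using Yn by (intro sum_p_mono) auto
    finally have Dt: "D \<le> total" .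
    \<comment> \<open>If a big job were used up, its colour class would have lost at least
      \<open>total + 1\<close>, but it loses only \<open>D\<close>, which is at most
      \<open>total\<close>.\<close>
    show small: "\<not> big j" if "j \<in> ?X" for j
    proof
      assume "big j"
      let ?A = "{i\<in>{..<n}. col i = col j}"
      have j: "j < n" "w j = 0" using that by auto
      then have "sum w0 ?A = w0 j + sum w0 (?A - {j})" "sum w ?A = w j + sum w (?A - {j})"
        by (intro sum.remove; use j in simp)+
      moreover have "sum w (?A - {j}) \<le> sum w0 (?A - {j})" by (rule sum_mono) (use le in auto)
      moreover have "sum w0 ?A = D + sum w ?A"
        using D(1)[of "col j"] assms(1) j by (simp add: coloring_def)
      ultimately show False using w0[OF j(1)] j(2) \<open>big j\<close> Dt by simp
    qed
    show "(\<Sum>j\<in>{j\<in>?X. col j = c}. p j) \<le> (\<Sum>j\<in>Y. p j)" if "c \<le> 1" for c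
    proof -
      let ?A = "{j\<in>{..<n}. col j = c}" and ?B = "{j\<in>?X. col j = c}"
      have sub: "?B \<subseteq> ?A" "finite ?A" by auto
      have "sum p ?B = sum w0 ?B" using small by (intro sum.cong) (auto simp: w0)
      moreover have "sum w0 ?A = sum w0 ?B + sum w0 (?A - ?B)" "sum w ?A = sum w ?B + sum w (?A - ?B)"
        using sum.subset_diff[OF sub, of w0] sum.subset_diff[OF sub, of w] by simp_all
      moreover have "sum w (?A - ?B) \<le> sum w0 (?A - ?B)" by (rule sum_mono) (use le in auto)
      moreover have "sum w ?B = 0" by simp
      ultimately show ?thesis using D(1)[OF that] DY by linarith
    qed
  qed
qed

lemma run_local_ratio:
  assumes "ready s" "coloring (s COLOR)"
  shows "balanced_cover (s COLOR) {j\<in>{..<n}. run local_ratio s RESID j = 0}"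
proof -
  define w0 where "w0 j = (if big j then total + 1 else p j)" for j
  let ?body = "Cond (Big (cell J)) (Assign RESID (cell J) (Plus (cell TOTAL) (Const 1)))
    (Assign RESID (cell J) (Requirement (cell J)))"
  define s0 where "s0 = run (For J 0 ?body) s"
  have w: "\<forall>j<n. s0 RESID j = w0 j"
    unfolding s0_def
  proof (rule run_For_induct[where I = "\<lambda>i s. \<forall>j<i. s RESID j = w0 j" and N = n], goal_cases)
    case (5 i s')
    have "ready s'" using assms(1) by (rule ready_cong[rotated 3]) (simp_all add: 5(4))
    then show ?case using 5(1,2,3) by (auto simp: less_Suc_eq w0_def)
  qed (use assms(1) in auto)
  have rd: "ready s0"
    using assms(1) unfolding s0_def by (rule ready_cong[rotated 3]; intro run_frame) simp_all
  have "charged (s COLOR) w0 ({..<n} \<times> {..<n}) (run local_ratio s RESID)"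
    unfolding local_ratio_def run.simps(3) s0_def[symmetric]
  proof (rule run_pairs_induct[where I = "\<lambda>E s'. charged (s COLOR) w0 E (s' RESID)"])
    have eq: "sum (s0 RESID) Y = sum w0 Y" if "Y \<subseteq> {..<n}" for Y
      using w that by (intro sum.cong) auto
    show "charged (s COLOR) w0 {} (s0 RESID)"
      unfolding charged_def using w
      by (intro conjI exI[of _ 0]) (auto simp: eq cover_def)
    fix E u v s'
    let ?p = "Cond (Edge (cell J) (cell K)) charge Nop"
    assume uv: "u < n" "v < n" "charged (s COLOR) w0 E (s' RESID)" "s' J 0 = u" "s' K 0 = v"
      and fr': "\<And>c. c \<noteq> J \<Longrightarrow> c \<noteq> K \<Longrightarrow> c \<notin> writes ?p \<Longrightarrow> s' c = s0 c"
    have rd': "ready s'"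
      using rd by (rule ready_cong[rotated 3]) (simp_all add: fr')
    show "charged (s COLOR) w0 (insert (u, v) E) (run ?p s' RESID)"
    proof (cases "adj u v")
      case True
      define d where "d = min (s' RESID u) (s' RESID v)"
      have "s COLOR u \<noteq> s COLOR v" using True uv(1,2) assms(2) by (simp add: coloring_def)
      then have "u \<noteq> v" by auto
      then have "run ?p s' RESID = (s' RESID)(u := s' RESID u - d, v := s' RESID v - d)"
        using rd' uv True by (simp add: charge_def d_def min_def)
      then show ?thesis using charged_charge[OF uv(3) assms(2) uv(1,2) True d_def] by simp
    next
      case False
      have "charged (s COLOR) w0 (insert (u, v) E) (s' RESID)"
        using uv(3) False by (rule charged_skip)
      then show ?thesis using rd' uv False by simp
    qed
  qed (use rd in auto)
  then show ?thesis
    by (rule charged_balanced_cover[OF assms(2)]) (simp add: w0_def)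
qed

section \<open>Execution of the greedy distribution\<close>

lemma run_zero_residuals:
  assumes "ready s"
  shows "\<forall>j<n. run zero_residuals s RESID j = 0"
  unfolding zero_residuals_def
proof (rule run_For_induct[where I = "\<lambda>i s. \<forall>j<i. s RESID j = 0" and N = n], goal_cases)
  case (5 i s')
  then show ?case by (auto simp: less_Suc_eq)
qed (use assms in auto)

lemma run_clear_loads:
  assumes "ready s"
  shows "\<forall>i<m. run clear_loads s LOAD i = 0"
  unfolding clear_loads_def
proof (rule run_For_induct[where I = "\<lambda>i s. \<forall>j<i. s LOAD j = 0" and N = m], goal_cases)
  case (5 i s')
  then show ?case by (auto simp: less_Suc_eq)
qed (use assms in auto)

text \<open>Placing a job changes one cell of the schedule. What was greedy before remains so,
  because only the values on the listed jobs matter.\<close>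

lemma greedy_cong:
  "greedy col \<sigma> zs \<Longrightarrow> (\<And>j. j \<in> set zs \<Longrightarrow> \<sigma>' j = \<sigma> j) \<Longrightarrow> greedy col \<sigma>' zs"
proof (induction rule: greedy.induct)
  case Nil
  show ?case by (rule greedy.Nil)
next
  case (snoc xs j)
  have "load (set xs) \<sigma>' i = load (set xs) \<sigma> i" for i
    unfolding load_def by (intro sum.cong) (use snoc.prems in auto)
  then show ?case using snoc by (intro greedy.snoc) auto
qed

lemma run_pick_machine:
  assumes "ready s" "j < n" "s J 0 = j" "s COLOR j = c"
  shows "run pick_machine s PICK 0 < m"
    and "(\<exists>i. allowed c i) \<longrightarrow> allowed c (run pick_machine s PICK 0) \<and> (\<forall>i. allowed c i \<longrightarrow>
      (real (s LOAD (run pick_machine s PICK 0)) + p j) / speed (run pick_machine s PICK 0)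
        \<le> (real (s LOAD i) + p j) / speed i)"
proof -
  define t where "t i = (real (s LOAD i) + p j) / speed i" for i
  define I where "I i k \<longleftrightarrow> (k = 0 \<and> (\<forall>i'<i. \<not> allowed c i')) \<or>
    (allowed c k \<and> (\<forall>i'<i. allowed c i' \<longrightarrow> t k \<le> t i'))" for i k
  have "I m (run pick_machine s PICK 0)"
    unfolding pick_machine_def run.simps(3)
  proof (rule run_For_induct[where I = "\<lambda>i s. I i (s PICK 0)" and N = m], goal_cases)
    case (5 i s')
    have fr: "s' d = s d" if "d \<noteq> K" "d \<noteq> PICK" for d
      using that 5(4)[of d] by auto
    have rd: "ready s'" using assms(1) by (rule ready_cong[rotated 3]) (simp_all add: fr)
    have al: "allowed c i \<longleftrightarrow> 0 < i \<and> i mod 2 \<noteq> c" using 5(1) by (simp add: allowed_def)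
    have pm: "s' PICK 0 < m" using 5(2) m_pos by (auto simp: I_def allowed_def)
    have ndef: "\<not> allowed c 0" by (simp add: allowed_def)
    have run_eq: "run (Cond (Conj (Conj (cell K) (Neq (Mod (cell K) (Const 2)) (Read COLOR (cell J))))
         (Disj (Neg (cell PICK))
           (Faster (cell K) (Plus (Read LOAD (cell K)) (Requirement (cell J)))
              (cell PICK) (Plus (Read LOAD (cell PICK)) (Requirement (cell J))))))
       (Assign PICK (Const 0) (cell K)) Nop) s' PICK 0 =
       (if allowed c i \<and> (s' PICK 0 = 0 \<or> t i < t (s' PICK 0)) then i else s' PICK 0)"
      using rd 5(1,3) pm assms by (auto simp: al fr t_def)
    show ?case unfolding run_eq
      using 5(2) ndef by (auto simp: I_def less_Suc_eq) 
  qed (use assms(1) in \<open>auto simp: I_def\<close>)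
  then show "run pick_machine s PICK 0 < m"
    "(\<exists>i. allowed c i) \<longrightarrow> allowed c (run pick_machine s PICK 0) \<and> (\<forall>i. allowed c i \<longrightarrow>
      (real (s LOAD (run pick_machine s PICK 0)) + p j) / speed (run pick_machine s PICK 0)
        \<le> (real (s LOAD i) + p j) / speed i)"
    unfolding t_def[symmetric] using m_pos by (auto simp: I_def allowed_def)
qed

definition greedy_state :: "(nat \<Rightarrow> nat) \<Rightarrow> nat list \<Rightarrow> store \<Rightarrow> bool" where
  "greedy_state col zs s \<longleftrightarrow> greedy col (s SCHED) zs \<and>
    (\<forall>i<m. s LOAD i = load (set zs) (s SCHED) i) \<and> (\<forall>j<n. j \<notin> set zs \<longrightarrow> s SCHED j = 0)"

lemma run_place:
  assumes "ready s" "j < n" "s J 0 = j" "j \<notin> set zs" "greedy_state (s COLOR) zs s"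
  shows "greedy_state (s COLOR) (zs @ [j]) (run place s)"
proof -
  define k where "k = run pick_machine s PICK 0"
  have fr: "run pick_machine s d = s d" if "d \<noteq> K" "d \<noteq> PICK" for d
    using that by (intro run_frame) auto
  have rd: "ready (run pick_machine s)"
    using assms(1) by (rule ready_cong[rotated 3]) (simp_all add: fr)
  have km: "k < m" unfolding k_def by (rule run_pick_machine(1)[OF assms(1-3) refl])
  have S: "run place s SCHED = (s SCHED)(j := k)"
    and Ld: "run place s LOAD = (s LOAD)(k := s LOAD k + p j)"
    unfolding place_def using rd assms(2,3) by (simp_all add: fr k_def fun_eq_iff)
  have st: "greedy (s COLOR) (s SCHED) zs" "\<And>i. i < m \<Longrightarrow> s LOAD i = load (set zs) (s SCHED) i"
    "\<And>j. j < n \<Longrightarrow> j \<notin> set zs \<Longrightarrow> s SCHED j = 0"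
    using assms(5) by (auto simp: greedy_state_def)
  have ld: "load (set zs) ((s SCHED)(j := k)) i = load (set zs) (s SCHED) i" for i
    unfolding load_def using assms(4) by (intro sum.cong) auto
  have pick: "(\<exists>i. allowed (s COLOR j) i) \<longrightarrow> allowed (s COLOR j) k \<and> (\<forall>i. allowed (s COLOR j) i \<longrightarrow>
      (real (s LOAD k) + p j) / speed k \<le> (real (s LOAD i) + p j) / speed i)"
    unfolding k_def by (rule run_pick_machine(2)[OF assms(1-3) refl])
  have "greedy (s COLOR) ((s SCHED)(j := k)) (zs @ [j])"
  proof (rule greedy.snoc)
    show "greedy (s COLOR) ((s SCHED)(j := k)) zs"
      using st(1) assms(4) by (auto intro: greedy_cong)
    show "j \<notin> set zs" by (rule assms(4))
    show "(\<exists>i. allowed (s COLOR j) i) \<longrightarrow> allowed (s COLOR j) (((s SCHED)(j := k)) j) \<and>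
      (\<forall>i. allowed (s COLOR j) i \<longrightarrow>
        (load (set zs) ((s SCHED)(j := k)) (((s SCHED)(j := k)) j) + p j) / speed (((s SCHED)(j := k)) j)
        \<le> (load (set zs) ((s SCHED)(j := k)) i + p j) / speed i)"
      using pick km unfolding ld by (auto simp: st(2) allowed_def)
  qed
  moreover have "load (set (zs @ [j])) ((s SCHED)(j := k)) i = load (set zs) (s SCHED) i + (if k = i then p j else 0)" for i
    using assms(4) load_insert[of "set zs" j "(s SCHED)(j := k)" i] by (simp add: ld)
  ultimately show ?thesis
    unfolding greedy_state_def S Ld using st(2,3) km by auto
qed

text \<open>\<open>P\<close> is abstract so as to cover both passes. The second pass extends the
  list \<open>xs\<close> left by the first, whose loads are still in memory.\<close>

lemma run_pass:
  assumes "ready s" "greedy_state (s COLOR) xs s" "\<And>j. j \<in> set xs \<Longrightarrow> \<not> P j"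
    and e: "\<And>s j. ready s \<Longrightarrow> s J 0 = j \<Longrightarrow> j < n \<Longrightarrow> aval e s \<noteq> 0 \<longleftrightarrow> P j"
  shows "\<exists>ys. set ys = {j\<in>{..<n}. s RESID j = 0 \<and> P j} \<and> greedy_state (s COLOR) (xs @ ys) (run (pass e) s)"
proof -
  let ?I = "\<lambda>i s'. \<exists>ys. set ys = {j\<in>{..<i}. s RESID j = 0 \<and> P j} \<and> greedy_state (s COLOR) (xs @ ys) s'"
  have "?I n (run (pass e) s)"
    unfolding pass_def
  proof (rule run_For_induct[where I = ?I and N = n], goal_cases)
    case (5 i s')
    have fr: "s' d = s d" if "d \<noteq> J" "d \<noteq> K" "d \<noteq> PICK" "d \<noteq> SCHED" "d \<noteq> LOAD" for d
      using that 5(4)[of d] by auto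
    have rd: "ready s'" using assms(1) by (rule ready_cong[rotated 3]) (simp_all add: fr)
    have col: "s' COLOR = s COLOR" by (simp add: fr)
    obtain ys where ys: "set ys = {j\<in>{..<i}. s RESID j = 0 \<and> P j}" "greedy_state (s COLOR) (xs @ ys) s'"
      using 5(2) by blast
    have run_eq: "run (Cond (Conj e (Neg (Read RESID (cell J)))) place Nop) s' =
        (if s RESID i = 0 \<and> P i then run place s' else s')"
      using e[OF rd 5(3,1)] 5(3) by (simp add: fr)
    show ?case
    proof (cases "s RESID i = 0 \<and> P i")
      case True
      then have "i \<notin> set (xs @ ys)" using ys(1) assms(3)[of i] by auto
      from run_place[OF rd 5(1,3) this] ys(2)
      have "greedy_state (s COLOR) (xs @ (ys @ [i])) (run place s')"
        by (simp add: col)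
      moreover have "set (ys @ [i]) = {j\<in>{..<Suc i}. s RESID j = 0 \<and> P j}"
        using True ys(1) by (auto simp: less_Suc_eq)
      ultimately show ?thesis unfolding run_eq using True by (intro exI[of _ "ys @ [i]"]) simp
    next
      case False
      then have "{j\<in>{..<Suc i}. s RESID j = 0 \<and> P j} = {j\<in>{..<i}. s RESID j = 0 \<and> P j}"
        by (auto simp: less_Suc_eq)
      then show ?thesis
        unfolding run_eq if_not_P[OF False] using ys by (intro exI[of _ ys]) simp
    qed
  next
    case 3
    show ?case by (rule exI[of _ "[]"]) (use assms(2) in simp)
  next
    case 4
    show ?case by (simp add: greedy_state_def)
  qed (use assms(1) in simp_all)
  then show ?thesis .
qed

lemma run_greedy_prog:
  assumes "ready s"
  shows "greedy_schedule (s COLOR) {j\<in>{..<n}. s RESID j = 0} (run greedy_prog s SCHED)"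
proof -
  let ?init = "For J 0 (Assign SCHED (cell J) (Const 0))"
  define s1 where "s1 = run clear_loads (run ?init s)"
  define s2 where "s2 = run (pass (Big (cell J))) s1"
  define s3 where "s3 = run (pass (Neg (Big (cell J)))) s2"
  have s3: "run greedy_prog s = s3"
    by (simp add: greedy_prog_def s1_def s2_def s3_def)
  have fr0: "run ?init s d = s d" if "d \<noteq> J" "d \<noteq> SCHED" for d
    using that by (intro run_frame) auto
  have fr1: "run clear_loads s d = s d" if "d \<noteq> K" "d \<noteq> LOAD" for d s
    using that by (intro run_frame) auto
  have fr2: "run (pass e) s d = s d" if "d \<noteq> J" "d \<noteq> K" "d \<noteq> PICK" "d \<noteq> SCHED" "d \<noteq> LOAD" for d e s
    using that by (intro run_frame) auto
  have rd0: "ready (run ?init s)" using assms by (rule ready_cong[rotated 3]) (simp_all add: fr0)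
  then have rd1: "ready s1" unfolding s1_def by (rule ready_cong[rotated 3]) (simp_all add: fr1)
  then have rd2: "ready s2" unfolding s2_def by (rule ready_cong[rotated 3]) (simp_all add: fr2)
  have "\<forall>j<n. run ?init s SCHED j = 0"
  proof (rule run_For_induct[where I = "\<lambda>i s. \<forall>j<i. s SCHED j = 0" and N = n], goal_cases)
    case (5 i s')
    then show ?case by (auto simp: less_Suc_eq)
  qed (use assms in auto)
  then have "greedy_state (s1 COLOR) [] s1"
    using run_clear_loads[OF rd0] by (auto simp: greedy_state_def s1_def fr1 load_def intro: greedy.Nil)
  then have "\<exists>ys. set ys = {j\<in>{..<n}. s1 RESID j = 0 \<and> big j} \<and> greedy_state (s1 COLOR) ([] @ ys) s2"
    unfolding s2_def by (intro run_pass[OF rd1]) simp_all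
  then obtain xs where xs: "set xs = {j\<in>{..<n}. s1 RESID j = 0 \<and> big j}" "greedy_state (s1 COLOR) xs s2"
    by auto
  have same: "s2 COLOR = s1 COLOR" "s2 RESID = s1 RESID" "s1 COLOR = s COLOR" "s1 RESID = s RESID"
    by (simp_all add: s2_def s1_def fr0 fr1 fr2)
  have "\<exists>ys. set ys = {j\<in>{..<n}. s2 RESID j = 0 \<and> \<not> big j} \<and> greedy_state (s2 COLOR) (xs @ ys) s3"
    unfolding s3_def using xs by (intro run_pass[OF rd2]) (simp_all add: same)
  then obtain ys where "set ys = {j\<in>{..<n}. s RESID j = 0 \<and> \<not> big j}" "greedy_state (s COLOR) (xs @ ys) s3"
    by (auto simp: same)
  then show ?thesis
    using xs(1) unfolding greedy_schedule_def greedy_state_def s3 same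
    by (intro conjI exI[of _ xs] exI[of _ ys]) auto
qed


section \<open>Validation, makespan and the best schedule so far\<close>

lemma load_cong: "(\<And>j. j \<in> Y \<Longrightarrow> \<sigma> j = \<tau> j) \<Longrightarrow> load Y \<sigma> i = load Y \<tau> i"
  unfolding load_def by (intro sum.cong) auto

lemma cmax_cong: "(\<And>j. j < n \<Longrightarrow> \<sigma> j = \<tau> j) \<Longrightarrow> cmax \<sigma> = cmax \<tau>"
  unfolding cmax_def using load_cong[of "{..<n}" \<sigma> \<tau>] by simp

lemma feasible_cong: "(\<And>j. j < n \<Longrightarrow> \<sigma> j = \<tau> j) \<Longrightarrow> feasible \<sigma> = feasible \<tau>"
  unfolding feasible_def by simp

lemma cmax_nonneg: "cmax \<sigma> \<ge> 0"
proof -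
  have "load {..<n} \<sigma> 0 \<le> cmax \<sigma> * speed 0"
    using cmax_le_iff[of \<sigma> "cmax \<sigma>"] m_pos by simp
  then have "0 \<le> cmax \<sigma> * speed 0" by (meson of_nat_0_le_iff order_trans)
  then show ?thesis using speed_pos[OF m_pos] by (simp add: zero_le_mult_iff)
qed

lemma run_validate:
  assumes "ready s"
  shows "run validate s VALID 0 \<noteq> 0 \<longleftrightarrow> feasible (s SCHED)"
proof -
  let ?b1 = "Cond (Less (Read SCHED (cell J)) (Read 2 (Const 1))) Nop (Assign VALID (Const 0) (Const 0))"
  let ?b2 = "Cond (Conj (Edge (cell J) (cell K)) (Neg (Neq (Read SCHED (cell J)) (Read SCHED (cell K)))))
    (Assign VALID (Const 0) (Const 0)) Nop"
  define s1 where "s1 = upd VALID 0 1 s"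
  define s2 where "s2 = run (For J 0 ?b1) s1"
  have rd1: "ready s1" using assms by (simp add: s1_def)
  have S1: "s1 SCHED = s SCHED" by (simp add: s1_def)
  have V2: "s2 VALID 0 \<noteq> 0 \<longleftrightarrow> (\<forall>j<n. s SCHED j < m)"
    unfolding s2_def
  proof (rule run_For_induct[where I = "\<lambda>i s'. s' VALID 0 \<noteq> 0 \<longleftrightarrow> (\<forall>j<i. s SCHED j < m)" and N = n], goal_cases)
    case (5 i s')
    have rd: "ready s'" using rd1 by (rule ready_cong[rotated 3]) (simp_all add: 5(4))
    have "s' SCHED = s SCHED" using 5(4)[of SCHED] by (simp add: S1)
    then show ?case using rd 5(2,3) by (auto simp: less_Suc_eq)
  qed (use assms in \<open>auto simp: s1_def\<close>)
  have fr: "s2 d = s1 d" if "d \<noteq> J" "d \<noteq> VALID" for d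
    unfolding s2_def using that by (intro run_frame) auto
  have rd2: "ready s2" using rd1 by (rule ready_cong[rotated 3]) (simp_all add: fr)
  let ?I = "\<lambda>E s'. s' VALID 0 \<noteq> 0 \<longleftrightarrow> (\<forall>j<n. s SCHED j < m) \<and>
    (\<forall>(u, v)\<in>E. adj u v \<longrightarrow> s SCHED u \<noteq> s SCHED v)"
  have "?I ({..<n} \<times> {..<n}) (run (For J 0 (For K 0 ?b2)) s2)"
  proof (rule run_pairs_induct[where I = ?I])
    fix E u v s'
    assume uv: "u < n" "v < n" "?I E s'" "s' J 0 = u" "s' K 0 = v"
      and fr': "\<And>c. c \<noteq> J \<Longrightarrow> c \<noteq> K \<Longrightarrow> c \<notin> writes ?b2 \<Longrightarrow> s' c = s2 c"
    have rd: "ready s'" using rd2 by (rule ready_cong[rotated 3]) (simp_all add: fr')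
    have "s' SCHED = s SCHED" using fr'[of SCHED] by (simp add: fr S1)
    then have "run ?b2 s' VALID 0 = (if adj u v \<and> s SCHED u = s SCHED v then 0 else s' VALID 0)"
      using rd uv by simp
    then show "?I (insert (u, v) E) (run ?b2 s')" using uv(3) by auto
  qed (use rd2 V2 in auto)
  moreover have "run validate s = run (For J 0 (For K 0 ?b2)) s2"
    by (simp only: validate_def run.simps(2,3) aval.simps s1_def s2_def)
  ultimately show ?thesis by (auto simp: feasible_def)
qed

lemma run_measure_schedule:
  fixes s defines "s' \<equiv> run measure_schedule s"
  assumes "ready s"
  shows "s' PICK 0 < m" "cmax (s SCHED) = s' LOAD (s' PICK 0) / speed (s' PICK 0)"
proof -
  let ?b1 = "Assign LOAD (Read SCHED (cell J)) (Plus (Read LOAD (Read SCHED (cell J))) (Requirement (cell J)))"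
  let ?b2 = "Cond (Faster (cell PICK) (Read LOAD (cell PICK)) (cell K) (Read LOAD (cell K)))
    (Assign PICK (Const 0) (cell K)) Nop"
  define s1 where "s1 = run clear_loads s"
  define s2 where "s2 = run (For J 0 ?b1) s1"
  define s3 where "s3 = upd PICK 0 0 s2"
  define t where "t i = load {..<n} (s SCHED) i / speed i" for i
  have fr1: "s1 d = s d" if "d \<noteq> K" "d \<noteq> LOAD" for d
    unfolding s1_def using that by (intro run_frame) auto
  have rd1: "ready s1" using assms(2) by (rule ready_cong[rotated 3]) (simp_all add: fr1)
  have ld: "\<forall>i<m. s2 LOAD i = load {..<n} (s SCHED) i"
    unfolding s2_def
  proof (rule run_For_induct[where I = "\<lambda>j s'. \<forall>i<m. s' LOAD i = load {..<j} (s SCHED) i" and N = n], goal_cases)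
    case 3
    then show ?case using run_clear_loads[OF assms(2)] by (simp add: s1_def load_def)
  next
    case (5 i s')
    have rd: "ready s'" using rd1 by (rule ready_cong[rotated 3]) (simp_all add: 5(4))
    have "s' SCHED = s SCHED" using 5(4)[of SCHED] by (simp add: fr1)
    then show ?case using rd 5(1-3) by (simp add: lessThan_Suc load_insert)
  qed (use rd1 in auto)
  have fr2: "s2 d = s1 d" if "d \<noteq> J" "d \<noteq> LOAD" for d
    unfolding s2_def using that by (intro run_frame) auto
  have rd2: "ready s2" using rd1 by (rule ready_cong[rotated 3]) (simp_all add: fr2)
  then have rd3: "ready s3" by (simp add: s3_def)
  have s': "s' = run (For K 1 ?b2) s3"
    by (simp only: s'_def measure_schedule_def run.simps(2,3) aval.simps s1_def s2_def s3_def)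
  have L3: "s3 LOAD = s2 LOAD" by (simp add: s3_def)
  have "s' PICK 0 < m \<and> (\<forall>i<m. t i \<le> t (s' PICK 0))"
    unfolding s'
  proof (rule run_For_induct[where I = "\<lambda>k s'. s' PICK 0 < m \<and> (\<forall>i<k. t i \<le> t (s' PICK 0))" and N = m], goal_cases)
    case (5 k s')
    have rd: "ready s'" using rd3 by (rule ready_cong[rotated 3]) (simp_all add: 5(4))
    have L: "s' LOAD = s2 LOAD" using 5(4)[of LOAD] by (simp add: L3)
    have "run ?b2 s' PICK 0 = (if t (s' PICK 0) < t k then k else s' PICK 0)"
      using rd 5(1-3) ld by (simp add: L t_def)
    then show ?case using 5(1,2) by (auto simp: less_Suc_eq)
  qed (use rd3 m_pos in \<open>auto simp: s3_def\<close>)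
  then have pk: "s' PICK 0 < m" "\<And>i. i < m \<Longrightarrow> t i \<le> t (s' PICK 0)" by auto
  show "s' PICK 0 < m" by (rule pk)
  have "cmax (s SCHED) = t (s' PICK 0)"
    unfolding cmax_def t_def[symmetric] using pk by (intro Max_eqI) auto
  moreover have "s' LOAD = s2 LOAD"
    unfolding s' L3[symmetric] by (rule run_frame) simp
  ultimately show "cmax (s SCHED) = s' LOAD (s' PICK 0) / speed (s' PICK 0)"
    using ld pk(1) by (simp add: t_def)
qed

definition best_recorded :: "store \<Rightarrow> bool" where
  "best_recorded s \<longleftrightarrow> (s FOUND 0 \<noteq> 0 \<longrightarrow> feasible (s 1) \<and> s BEST_MACHINE 0 < m \<and>
    cmax (s 1) = s BEST_LOAD 0 / speed (s BEST_MACHINE 0))"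

lemma run_record_best:
  fixes s defines "s' \<equiv> run record_best s"
  assumes "ready s" "best_recorded s"
    and valid: "s VALID 0 \<noteq> 0 \<longleftrightarrow> feasible (s SCHED)"
    and pick: "s PICK 0 < m" "cmax (s SCHED) = s LOAD (s PICK 0) / speed (s PICK 0)"
  shows "best_recorded s'"
    and "s FOUND 0 \<noteq> 0 \<Longrightarrow> s' FOUND 0 \<noteq> 0 \<and> cmax (s' 1) \<le> cmax (s 1)"
    and "feasible (s SCHED) \<Longrightarrow> s' FOUND 0 \<noteq> 0 \<and> cmax (s' 1) \<le> cmax (s SCHED)"
proof -
  let ?b = "Conj (cell VALID) (Disj (Neg (cell FOUND))
       (Faster (cell PICK) (Read LOAD (cell PICK)) (cell BEST_MACHINE) (cell BEST_LOAD)))"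
  let ?copy = "For J 0 (Assign 1 (cell J) (Read SCHED (cell J)))"
  define q where "q = run ?copy s"
  have fr: "q d = s d" if "d \<noteq> J" "d \<noteq> 1" for d
    unfolding q_def using that by (intro run_frame) auto
  have copy: "q 1 j = s SCHED j" if "j < n" for j
  proof -
    have "\<forall>j<n. q 1 j = s SCHED j"
      unfolding q_def
    proof (rule run_For_induct[where I = "\<lambda>i s'. \<forall>j<i. s' 1 j = s SCHED j" and N = n], goal_cases)
      case (5 i s')
      have "s' SCHED = s SCHED" by (rule 5(4)) auto
      then show ?case using 5(2,3) by (auto simp: less_Suc_eq)
    qed (use assms(2) in auto)
    then show ?thesis using that by blast
  qed
  have cond: "aval ?b s \<noteq> 0 \<longleftrightarrow> feasible (s SCHED) \<and> (s FOUND 0 = 0 \<or> cmax (s SCHED) < cmax (s 1))"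
    using assms(2,3) pick valid by (cases "s FOUND 0 = 0") (simp_all add: best_recorded_def)
  show "best_recorded s'" "s FOUND 0 \<noteq> 0 \<Longrightarrow> s' FOUND 0 \<noteq> 0 \<and> cmax (s' 1) \<le> cmax (s 1)"
    "feasible (s SCHED) \<Longrightarrow> s' FOUND 0 \<noteq> 0 \<and> cmax (s' 1) \<le> cmax (s SCHED)"
  proof (atomize (full), cases "aval ?b s \<noteq> 0")
    case True
    then have "s' = upd FOUND 0 1 (upd BEST_MACHINE 0 (s PICK 0) (upd BEST_LOAD 0 (s LOAD (s PICK 0)) q))"
      by (simp add: s'_def record_best_def q_def[symmetric, simplified] fr)
    moreover have "cmax (q 1) = cmax (s SCHED)" "feasible (q 1) = feasible (s SCHED)"
      by (intro cmax_cong feasible_cong copy; assumption)+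
    ultimately show "best_recorded s' \<and> (s FOUND 0 \<noteq> 0 \<longrightarrow> s' FOUND 0 \<noteq> 0 \<and> cmax (s' 1) \<le> cmax (s 1)) \<and>
      (feasible (s SCHED) \<longrightarrow> s' FOUND 0 \<noteq> 0 \<and> cmax (s' 1) \<le> cmax (s SCHED))"
      using True pick unfolding cond by (auto simp: best_recorded_def)
  next
    case False
    then have "s' = s" by (simp add: s'_def record_best_def)
    then show "best_recorded s' \<and> (s FOUND 0 \<noteq> 0 \<longrightarrow> s' FOUND 0 \<noteq> 0 \<and> cmax (s' 1) \<le> cmax (s 1)) \<and>
      (feasible (s SCHED) \<longrightarrow> s' FOUND 0 \<noteq> 0 \<and> cmax (s' 1) \<le> cmax (s SCHED))"
      using False assms(3) unfolding cond by auto
  qed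
qed

section \<open>The main loop\<close>

definition prepared :: "store \<Rightarrow> bool" where
  "prepared s \<longleftrightarrow> ready s \<and> merged ({..<n} \<times> {..<n}) (s LABEL) (s COLOR) \<and>
    (\<forall>k. s CLASS k = (\<Sum>j\<in>{j\<in>{..<n}. 2 * s LABEL j + s COLOR j = k}. p j))"

lemma prepared_cong:
  assumes "prepared s" "\<And>d. d \<in> {0, 2, TOTAL, LABEL, COLOR, CLASS} \<Longrightarrow> s' d = s d"
  shows "prepared s'"
proof -
  have "s' 0 = s 0" "s' 2 = s 2" "s' TOTAL = s TOTAL" "s' LABEL = s LABEL" "s' COLOR = s COLOR"
    "s' CLASS = s CLASS"
    by (rule assms(2); simp)+
  then show ?thesis using assms(1) ready_cong[of s' s] by (simp add: prepared_def)
qed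

lemma merged_coloring: "merged ({..<n} \<times> {..<n}) l c \<Longrightarrow> coloring c"
  by (auto simp: merged_def coloring_def)

definition candidate :: "(nat \<Rightarrow> nat) \<Rightarrow> nat \<Rightarrow> (nat \<Rightarrow> nat) \<Rightarrow> bool" where
  "candidate col x \<sigma> \<longleftrightarrow> (if total < 100 then \<forall>j<n. \<sigma> j = (x div m ^ j) mod m
    else if x = 0 then two_machine_schedule \<sigma>
    else if x = 1 then \<exists>Y. balanced_cover col Y \<and> greedy_schedule col Y \<sigma>
    else greedy_schedule col {..<n} \<sigma>)"

lemma run_build:
  assumes "prepared s" "s X 0 = x"
  shows "candidate (s COLOR) x (run build s SCHED)"
proof -
  have rd: "ready s" and col: "coloring (s COLOR)"
    using assms(1) by (auto simp: prepared_def merged_coloring)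
  consider "total < 100" | "total \<ge> 100" "x = 0" | "total \<ge> 100" "x = 1" | "total \<ge> 100" "x \<ge> 2"
    by linarith
  then show ?thesis
  proof cases
    case 1
    then show ?thesis using rd run_decode[OF rd assms(2)] by (simp add: build_def candidate_def)
  next
    case 2
    then show ?thesis
      using rd assms run_two_machines[OF rd] by (simp add: build_def candidate_def prepared_def)
  next
    case 3
    define q where "q = run local_ratio s"
    have fr: "q d = s d" if "d \<notin> {J, K, DELTA, RESID}" for d
      unfolding q_def using that by (intro run_frame) auto
    have rdq: "ready q" using rd by (rule ready_cong[rotated 3]) (simp_all add: fr)
    have "run build s = run greedy_prog q"
      using 3 rd assms(2) by (simp add: build_def q_def)
    then have "greedy_schedule (s COLOR) {j\<in>{..<n}. q RESID j = 0} (run build s SCHED)"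
      using run_greedy_prog[OF rdq] by (simp add: fr)
    moreover have "balanced_cover (s COLOR) {j\<in>{..<n}. q RESID j = 0}"
      unfolding q_def by (rule run_local_ratio[OF rd col])
    ultimately show ?thesis using 3 by (auto simp: candidate_def)
  next
    case 4
    define q where "q = run zero_residuals s"
    have fr: "q d = s d" if "d \<notin> {J, RESID}" for d
      unfolding q_def using that by (intro run_frame) auto
    have rdq: "ready q" using rd by (rule ready_cong[rotated 3]) (simp_all add: fr)
    have "run build s = run greedy_prog q"
      using 4 rd assms(2) by (simp add: build_def q_def)
    moreover have "{j\<in>{..<n}. q RESID j = 0} = {..<n}"
      using run_zero_residuals[OF rd] by (auto simp: q_def)
    ultimately have "greedy_schedule (s COLOR) {..<n} (run build s SCHED)"
      using run_greedy_prog[OF rdq] by (simp add: fr)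
    then show ?thesis using 4 by (simp add: candidate_def)
  qed
qed

text \<open>One colouring serves all rounds, as the comparison of the three candidates requires. The
  candidates are only claimed to exist, since each round overwrites the schedule of the previous
  one.\<close>

lemma run_main_prog:
  fixes s defines "s' \<equiv> run main_prog s"
  assumes "ready s" "\<And>d i. d \<in> {FOUND, COLOR, CLASS} \<Longrightarrow> s d i = 0" "s 2 2 = N"
  shows "\<exists>col. coloring col \<and> (\<forall>x<N. \<exists>\<sigma>. candidate col x \<sigma> \<and>
    (feasible \<sigma> \<longrightarrow> feasible (s' 1) \<and> cmax (s' 1) \<le> cmax \<sigma>))"
proof -
  let ?body = "build ;; validate ;; measure_schedule ;; record_best"
  define s1 where "s1 = run color_graph s"
  define s2 where "s2 = run class_weights s1"
  have fr1: "s1 d = s d" if "d \<notin> {J, K, TEMP, L, COLOR, LABEL}" for d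
    unfolding s1_def using that by (intro run_frame) auto
  have fr2: "s2 d = s1 d" if "d \<notin> {J, CLASS}" for d
    unfolding s2_def using that by (intro run_frame) auto
  have rd1: "ready s1" using assms(2) by (rule ready_cong[rotated 3]) (simp_all add: fr1)
  then have rd2: "ready s2" by (rule ready_cong[rotated 3]) (simp_all add: fr2)
  have "merged ({..<n} \<times> {..<n}) (s1 LABEL) (s1 COLOR)"
    unfolding s1_def using assms(2,3) by (intro run_color_graph) auto
  moreover have "s2 CLASS k = (\<Sum>j\<in>{j\<in>{..<n}. 2 * s1 LABEL j + s1 COLOR j = k}. p j)" for k
    unfolding s2_def by (rule run_class_weights[OF rd1]) (simp add: fr1 assms(3))
  ultimately have prep: "prepared s2" using rd2 by (simp add: prepared_def fr2)
  define col where "col = s2 COLOR"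
  define I where "I k s' \<longleftrightarrow> best_recorded s' \<and> (\<forall>x<k. \<exists>\<sigma>. candidate col x \<sigma> \<and>
    (feasible \<sigma> \<longrightarrow> s' FOUND 0 \<noteq> 0 \<and> cmax (s' 1) \<le> cmax \<sigma>))" for k s'
  have s': "s' = run (For X 2 ?body) s2"
    by (simp only: s'_def main_prog_def s1_def s2_def run.simps(3))
  have "I N s'"
    unfolding s'
  proof (rule run_For_induct[where I = I and N = N], goal_cases)
    case 2
    then show ?case using assms(4) by (simp add: fr1 fr2)
  next
    case 3
    then show ?case by (simp add: I_def best_recorded_def fr1 fr2 assms(3))
  next
    case 4
    then show ?case by (simp add: I_def best_recorded_def)
  next
    case (5 x q)
    have frq: "q d = s2 d" if "d \<in> {0, 2, TOTAL, LABEL, COLOR, CLASS}" for d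
      using that by (intro 5(4)) auto
    have pq: "prepared q" by (rule prepared_cong[OF prep frq])
    define q1 where "q1 = run build q"
    define q2 where "q2 = run validate q1"
    define q3 where "q3 = run measure_schedule q2"
    have f1: "q1 d = q d" if "d \<notin> {J, K, TEMP, SCHED, DELTA, RESID, PICK, LOAD}" for d
      unfolding q1_def using that by (intro run_frame) auto
    have f2: "q2 d = q1 d" if "d \<notin> {J, K, VALID}" for d
      unfolding q2_def using that by (intro run_frame) auto
    have f3: "q3 d = q2 d" if "d \<notin> {J, K, PICK, LOAD}" for d
      unfolding q3_def using that by (intro run_frame) auto
    have r0: "ready q" using pq by (simp add: prepared_def)
    then have r1: "ready q1" by (rule ready_cong[rotated 3]) (simp_all add: f1)
    then have r2: "ready q2" by (rule ready_cong[rotated 3]) (simp_all add: f2)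
    then have r3: "ready q3" by (rule ready_cong[rotated 3]) (simp_all add: f3)
    have same: "q3 FOUND = q FOUND" "q3 1 = q 1" "q3 BEST_MACHINE = q BEST_MACHINE"
      "q3 BEST_LOAD = q BEST_LOAD" "q3 SCHED = q1 SCHED" "q2 SCHED = q1 SCHED" "q3 VALID = q2 VALID"
      by (simp_all add: f1 f2 f3)
    have b3: "best_recorded q3" using 5(2) unfolding I_def best_recorded_def same by (rule conjunct1)
    have v3: "q3 VALID 0 \<noteq> 0 \<longleftrightarrow> feasible (q3 SCHED)"
      unfolding same q2_def by (rule run_validate[OF r1])
    have m3: "q3 PICK 0 < m" "cmax (q3 SCHED) = q3 LOAD (q3 PICK 0) / speed (q3 PICK 0)"
      using run_measure_schedule[OF r2] unfolding q3_def[symmetric] same by auto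
    note rec = run_record_best[OF r3 b3 v3 m3]
    have cand: "candidate col x (q3 SCHED)"
      using run_build[OF pq 5(3)] frq[of COLOR] by (simp add: same q1_def col_def)
    have run_eq: "run ?body q = run record_best q3"
      by (simp only: q1_def q2_def q3_def run.simps(3))
    have "\<exists>\<sigma>. candidate col y \<sigma> \<and> (feasible \<sigma> \<longrightarrow>
        run record_best q3 FOUND 0 \<noteq> 0 \<and> cmax (run record_best q3 1) \<le> cmax \<sigma>)" if "y < Suc x" for y
    proof (cases "y = x")
      case True
      then show ?thesis using cand rec(3) by blast
    next
      case False
      then have "y < x" using that by simp
      then obtain \<sigma> where "candidate col y \<sigma>" "feasible \<sigma> \<Longrightarrow> q FOUND 0 \<noteq> 0 \<and> cmax (q 1) \<le> cmax \<sigma>"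
        using 5(2) unfolding I_def by blast
      then show ?thesis using rec(2) unfolding same by (meson order_trans)
    qed
    then show ?case unfolding run_eq I_def using rec(1) by blast
  qed simp
  moreover have "coloring col"
    unfolding col_def using prep by (auto simp: prepared_def merged_coloring)
  ultimately show ?thesis unfolding I_def best_recorded_def by (intro exI[of _ col] conjI) meson+
qed

text \<open>Job \<open>0\<close> is the least significant digit. Dividing the code by
  \<open>m\<close> shifts the assignment by one job, so the induction needs an arbitrary
  \<open>\<tau>\<close>.\<close>

lemma exists_code: "(\<And>j. j < k \<Longrightarrow> \<tau> j < m) \<Longrightarrow> \<exists>x<m ^ k. \<forall>j<k. (x div m ^ j) mod m = \<tau> j"
proof (induction k arbitrary: \<tau>)
  case 0
  then show ?case by simp
next
  case (Suc k)
  obtain x where x: "x < m ^ k" "\<forall>j<k. (x div m ^ j) mod m = \<tau> (Suc j)"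
    using Suc.IH[of "\<lambda>j. \<tau> (Suc j)"] Suc.prems by auto
  have t0: "\<tau> 0 < m" using Suc.prems by simp
  show ?case
  proof (intro exI conjI allI impI)
    have "\<tau> 0 + m * x < m * Suc x" using t0 by simp
    also have "\<dots> \<le> m * m ^ k" using x(1) by (intro mult_le_mono2) simp
    finally show "\<tau> 0 + m * x < m ^ Suc k" by simp
    show "((\<tau> 0 + m * x) div m ^ j) mod m = \<tau> j" if "j < Suc k" for j
      using that x(2) t0 by (cases j) (simp_all add: div_mult2_eq)
  qed
qed

theorem run_main_prog_approximates:
  assumes "ready s" "\<And>d i. d \<in> {FOUND, COLOR, CLASS} \<Longrightarrow> s d i = 0"
    and "s 2 2 = (if total < 100 then m ^ n else 3)" "feasible \<tau>"
  shows "feasible (run main_prog s 1) \<and> cmax (run main_prog s 1) \<le> sqrt total * cmax \<tau>"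
proof -
  obtain col where col: "coloring col"
    and cand: "\<And>x. x < s 2 2 \<Longrightarrow> \<exists>\<sigma>. candidate col x \<sigma> \<and>
      (feasible \<sigma> \<longrightarrow> feasible (run main_prog s 1) \<and> cmax (run main_prog s 1) \<le> cmax \<sigma>)"
    using run_main_prog[OF assms(1,2) refl] by auto
  show ?thesis
  proof (cases "total < 100")
    case True
    obtain x where x: "x < m ^ n" "\<forall>j<n. (x div m ^ j) mod m = \<tau> j"
      using exists_code[of n \<tau>] assms(4) by (auto simp: feasible_def)
    then obtain \<sigma> where \<sigma>: "candidate col x \<sigma>"
      "feasible \<sigma> \<Longrightarrow> feasible (run main_prog s 1) \<and> cmax (run main_prog s 1) \<le> cmax \<sigma>"
      using cand[of x] assms(3) True by auto
    have eq: "\<sigma> j = \<tau> j" if "j < n" for j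
      using \<sigma>(1) x(2) True that by (simp add: candidate_def)
    have res: "feasible (run main_prog s 1)" "cmax (run main_prog s 1) \<le> cmax \<tau>"
      using \<sigma>(2) feasible_cong[of \<sigma> \<tau>] cmax_cong[of \<sigma> \<tau>] eq assms(4) by auto
    show ?thesis
    \<comment> \<open>Matching \<open>\<tau>\<close> suffices if the factor is at least 1. Without
      jobs the factor is 0, but then every makespan is 0 too.\<close>
    proof (cases "total = 0")
      case True
      then have "load {..<n} \<sigma> i = 0" for \<sigma> i
        using load_le_total[of \<sigma> i] by simp
      then have "cmax (run main_prog s 1) \<le> 0"
        using cmax_le_iff[of "run main_prog s 1" 0] by simp
      then show ?thesis using True res by simp
    next
      case False
      then have "1 * cmax \<tau> \<le> sqrt total * cmax \<tau>"
        by (intro mult_right_mono cmax_nonneg) simp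
      then show ?thesis using res by simp
    qed
  next
    case False
    then obtain \<sigma>0 \<sigma>1 \<sigma>2 where c: "candidate col 0 \<sigma>0" "candidate col 1 \<sigma>1" "candidate col 2 \<sigma>2"
      and best: "\<And>\<sigma>. \<sigma> \<in> {\<sigma>0, \<sigma>1, \<sigma>2} \<Longrightarrow> feasible \<sigma>
        \<Longrightarrow> feasible (run main_prog s 1) \<and> cmax (run main_prog s 1) \<le> cmax \<sigma>"
      using cand[of 0] cand[of 1] cand[of 2] assms(3) by auto
    obtain Y where Y: "balanced_cover col Y" "greedy_schedule col Y \<sigma>1"
      using c(2) False by (auto simp: candidate_def)
    have "\<exists>\<sigma>\<in>{\<sigma>0, \<sigma>1, \<sigma>2}. feasible \<sigma> \<and> cmax \<sigma> \<le> sqrt total * cmax \<tau>"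
      using candidates_approximate[OF _ assms(4) col _ Y, of \<sigma>0 \<sigma>2] c False by (simp add: candidate_def)
    then show ?thesis using best by force
  qed
qed

end

section \<open>Encoded instances\<close>

context scheduling
begin

lemma ready_upd_bound:
  assumes "ready s"
  shows "ready (upd 2 2 x s)"
proof -
  have eqs: "upd 2 2 x s 0 = s 0" "upd 2 2 x s 2 0 = s 2 0" "upd 2 2 x s 2 1 = s 2 1"
    "upd 2 2 x s TOTAL = s TOTAL"
    by simp_all
  show ?thesis using assms unfolding ready_def reads_input_def eqs .
qed

end

lemma concat_uniform:
  assumes "\<And>ys. ys \<in> set yss \<Longrightarrow> length ys = k"
  shows "length (concat yss) = length yss * k"
    and "i < length yss \<Longrightarrow> j < k \<Longrightarrow> concat yss ! (i * k + j) = yss ! i ! j"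
  using assms
proof (induction yss arbitrary: i)
  case (Cons ys yss)
  {
    case 1
    then show ?case using Cons.IH(1) by simp
  next
    case 2
    then show ?case using Cons.IH(2)[of "i - 1"] by (cases i) (auto simp: nth_append)
  }
qed simp_all

abbreviation (input) job_num :: "sched_inst \<Rightarrow> nat" where
  "job_num I \<equiv> length (requirements I)"

abbreviation (input) machine_num :: "sched_inst \<Rightarrow> nat" where
  "machine_num I \<equiv> length (speeds I)"

definition speed_num :: "sched_inst \<Rightarrow> nat \<Rightarrow> nat" where
  "speed_num I i = nat (fst (quotient_of (speeds I ! i)))"

definition speed_den :: "sched_inst \<Rightarrow> nat \<Rightarrow> nat" where
  "speed_den I i = nat (snd (quotient_of (speeds I ! i)))"

definition incompatible :: "sched_inst \<Rightarrow> nat \<Rightarrow> nat \<Rightarrow> bool" where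
  "incompatible I u v \<longleftrightarrow> {u, v} \<in> incompat I"

lemma encode_nth:
  fixes I defines "n \<equiv> job_num I" and "m \<equiv> machine_num I"
  shows "length (encode I) = 2 + n + 2 * m + n * n"
    and "encode I ! 0 = n" "encode I ! 1 = m"
    and "j < n \<Longrightarrow> encode I ! (2 + j) = requirements I ! j"
    and "i < m \<Longrightarrow> encode I ! (2 + n + 2 * i) = speed_num I i"
    and "i < m \<Longrightarrow> encode I ! (2 + n + 2 * i + 1) = speed_den I i"
    and "u < n \<Longrightarrow> v < n \<Longrightarrow> encode I ! (2 + n + 2 * m + (u * n + v)) = (if incompatible I u v then 1 else 0)"
proof -
  define S where "S = map (\<lambda>v. let (a, b) = quotient_of v in [nat a, nat b]) (speeds I)"
  define M where "M = map (\<lambda>u. map (\<lambda>v. if {u, v} \<in> incompat I then (1 :: nat) else 0) [0..<n]) [0..<n]"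
  have enc: "encode I = [n, m] @ requirements I @ concat S @ concat M"
    by (simp add: encode_def n_def m_def S_def M_def Let_def)
  have S2: "length ys = 2" if "ys \<in> set S" for ys
    using that by (auto simp: S_def split: prod.splits)
  have Mn: "length ys = n" if "ys \<in> set M" for ys
    using that by (auto simp: M_def)
  have len: "length S = m" "length M = n" by (simp_all add: S_def m_def M_def)
  have lS: "length (concat S) = m * 2"
    unfolding len(1)[symmetric] by (rule concat_uniform(1)) (rule S2)
  have lM: "length (concat M) = n * n"
    using concat_uniform(1)[of M n] Mn len(2) by simp
  show "length (encode I) = 2 + n + 2 * m + n * n" by (simp add: enc lS lM n_def)
  show "encode I ! 0 = n" "encode I ! 1 = m" by (simp_all add: enc)
  show "j < n \<Longrightarrow> encode I ! (2 + j) = requirements I ! j" by (simp add: enc nth_append n_def)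
  have S: "encode I ! (2 + n + 2 * i + d) = S ! i ! d" if "i < m" "d < 2" for i d
  proof -
    have "encode I ! (2 + n + 2 * i + d) = concat S ! (i * 2 + d)"
      using that by (simp add: enc nth_append n_def[symmetric] lS add.assoc mult.commute)
    also have "\<dots> = S ! i ! d"
      using that by (intro concat_uniform(2) S2) (auto simp: len)
    finally show ?thesis .
  qed
  show "encode I ! (2 + n + 2 * i) = speed_num I i" if "i < m"
    using S[OF that, of 0] that by (simp add: S_def m_def speed_num_def split: prod.splits)
  show "encode I ! (2 + n + 2 * i + 1) = speed_den I i" if "i < m"
    using S[OF that, of 1] that by (simp add: S_def m_def speed_den_def split: prod.splits)
  show "encode I ! (2 + n + 2 * m + (u * n + v)) = (if incompatible I u v then 1 else 0)" if "u < n" "v < n"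
  proof -
    have "encode I ! (2 + n + 2 * m + (u * n + v)) = concat M ! (u * n + v)"
      by (simp add: enc nth_append n_def[symmetric] lS add.assoc mult.commute)
    also have "\<dots> = M ! u ! v"
      using that by (intro concat_uniform(2) Mn) (auto simp: len)
    finally show ?thesis using that by (simp add: M_def incompatible_def)
  qed
qed

lemma speed_fraction:
  assumes "bipartite_instance I" "i < machine_num I"
  shows "speed_num I i > 0" "speed_den I i > 0"
    and "real (speed_num I i) / real (speed_den I i) = real_of_rat (speeds I ! i)"
proof -
  obtain x y where xy: "quotient_of (speeds I ! i) = (x, y)" by force
  have y: "y > 0" using quotient_of_denom_pos[OF xy] .
  have v: "speeds I ! i = of_int x / of_int y" by (rule quotient_of_div[OF xy])
  have rv: "real_of_rat (speeds I ! i) = real_of_int x / real_of_int y"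
    unfolding v by (simp add: of_rat_divide)
  have "speeds I ! i \<ge> 1" using assms by (auto simp: bipartite_instance_def)
  then have x: "x > 0" using y unfolding v by (simp add: le_divide_eq)
  show "speed_num I i > 0" "speed_den I i > 0"
    using xy x y by (simp_all add: speed_num_def speed_den_def)
  show "real (speed_num I i) / real (speed_den I i) = real_of_rat (speeds I ! i)"
    using xy x y rv by (simp add: speed_num_def speed_den_def)
qed

lemma bipartite_edges:
  assumes "bipartite_instance I"
  shows "\<exists>A. \<forall>e\<in>incompat I. \<exists>u v. e = {u, v} \<and> u < job_num I \<and> v < job_num I \<and> u \<in> A \<and> v \<notin> A"
proof -
  obtain A B where AB: "A \<union> B = jobs I" "A \<inter> B = {}" "\<forall>e\<in>incompat I. \<exists>a\<in>A. \<exists>b\<in>B. e = {a, b}"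
    using assms by (auto simp: bipartite_instance_def bipartite_graph_def)
  show ?thesis
  proof (intro exI[of _ A] ballI)
    fix e assume "e \<in> incompat I"
    then obtain u v where uv: "u \<in> A" "v \<in> B" "e = {u, v}" using AB(3) by blast
    then have "u \<in> jobs I" "v \<in> jobs I" "v \<notin> A" using AB(1,2) by auto
    then show "\<exists>u v. e = {u, v} \<and> u < job_num I \<and> v < job_num I \<and> u \<in> A \<and> v \<notin> A"
      using uv by (auto simp: jobs_def)
  qed
qed

lemma scheduling_instance:
  assumes "bipartite_instance I"
  shows "scheduling (job_num I) (machine_num I) ((!) (requirements I)) (speed_num I) (speed_den I) (incompatible I)"
proof
  show "0 < requirements I ! j" if "j < job_num I" for j
    using assms that by (auto simp: bipartite_instance_def)
  show "0 < machine_num I" using assms by (auto simp: bipartite_instance_def)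
  show "0 < speed_num I i" "0 < speed_den I i" if "i < machine_num I" for i
    using speed_fraction[OF assms that] by auto
  show "speed_num I k * speed_den I i \<le> speed_num I i * speed_den I k" if "i \<le> k" "k < machine_num I" for i k
  proof -
    have "speeds I ! k \<le> speeds I ! i"
      using assms that sorted_wrt_nth_less[of "(\<ge>)" "speeds I" i k]
      by (cases "i = k") (auto simp: bipartite_instance_def)
    then have "real (speed_num I k) / real (speed_den I k) \<le> real (speed_num I i) / real (speed_den I i)"
      using speed_fraction(3)[OF assms] that by (simp add: of_rat_less_eq)
    then have "real (speed_num I k * speed_den I i) \<le> real (speed_num I i * speed_den I k)"
      using speed_fraction(2)[OF assms, of i] speed_fraction(2)[OF assms, of k] that
      by (simp add: divide_simps mult_ac)
    then show ?thesis by (simp only: of_nat_le_iff)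
  qed
  show "incompatible I v u" if "incompatible I u v" for u v
    using that by (simp add: incompatible_def insert_commute)
  obtain A where A: "\<forall>e\<in>incompat I. \<exists>u v. e = {u, v} \<and> u < job_num I \<and> v < job_num I \<and> u \<in> A \<and> v \<notin> A"
    using bipartite_edges[OF assms] by blast
  have "(u \<in> A) \<noteq> (v \<in> A)" if uv: "incompatible I u v" for u v
  proof -
    obtain x y where "{u, v} = {x, y}" "x \<in> A" "y \<notin> A"
      using A uv unfolding incompatible_def by meson
    then show ?thesis by (auto simp: doubleton_eq_iff)
  qed
  then show "\<exists>f :: nat \<Rightarrow> bool. \<forall>u<job_num I. \<forall>v<job_num I. incompatible I u v \<longrightarrow> f u \<noteq> f v"
    by (intro exI[of _ "\<lambda>u. u \<in> A"]) blast
qed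

lemma feasible_schedules_iff:
  assumes "bipartite_instance I"
  shows "\<sigma> \<in> feasible_schedules I \<longleftrightarrow> length \<sigma> = job_num I \<and>
    scheduling.feasible (job_num I) (machine_num I) (incompatible I) ((!) \<sigma>)"
proof -
  interpret scheduling "job_num I" "machine_num I" "(!) (requirements I)" "speed_num I" "speed_den I" "incompatible I"
    by (rule scheduling_instance[OF assms])
  obtain A where A: "\<forall>e\<in>incompat I. \<exists>u v. e = {u, v} \<and> u < job_num I \<and> v < job_num I \<and> u \<in> A \<and> v \<notin> A"
    using bipartite_edges[OF assms] by blast
  have "(\<forall>i\<in>machines I. independent_set (incompat I) (jobs_on I \<sigma> i)) \<longleftrightarrow>
      (\<forall>u<job_num I. \<forall>v<job_num I. incompatible I u v \<longrightarrow> \<sigma> ! u \<noteq> \<sigma> ! v)"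
    if "\<And>j. j < job_num I \<Longrightarrow> \<sigma> ! j < machine_num I"
  proof
    assume *: "\<forall>i\<in>machines I. independent_set (incompat I) (jobs_on I \<sigma> i)"
    show "\<forall>u<job_num I. \<forall>v<job_num I. incompatible I u v \<longrightarrow> \<sigma> ! u \<noteq> \<sigma> ! v"
    proof (intro allI impI notI)
      fix u v assume uv: "u < job_num I" "v < job_num I" "incompatible I u v" "\<sigma> ! u = \<sigma> ! v"
      have "\<sigma> ! u \<in> machines I" using that[OF uv(1)] by (simp add: machines_def)
      then have "\<not> {u, v} \<subseteq> jobs_on I \<sigma> (\<sigma> ! u)"
        using * uv(3) unfolding independent_set_def incompatible_def by blast
      then show False using uv by (auto simp: jobs_on_def jobs_def)
    qed
  next
    assume *: "\<forall>u<job_num I. \<forall>v<job_num I. incompatible I u v \<longrightarrow> \<sigma> ! u \<noteq> \<sigma> ! v"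
    show "\<forall>i\<in>machines I. independent_set (incompat I) (jobs_on I \<sigma> i)"
      unfolding independent_set_def
    proof (intro ballI notI)
      fix i e assume e: "e \<in> incompat I" "e \<subseteq> jobs_on I \<sigma> i"
      obtain u v where uv: "e = {u, v}" "u < job_num I" "v < job_num I"
        using A e(1) by blast
      have "\<sigma> ! u = \<sigma> ! v" using e(2) uv(1) by (simp add: jobs_on_def)
      moreover have "incompatible I u v" using e(1) uv(1) by (simp add: incompatible_def)
      ultimately show False using * uv(2,3) by blast
    qed
  qed
  moreover have "set \<sigma> \<subseteq> machines I \<longleftrightarrow> (\<forall>j<job_num I. \<sigma> ! j < machine_num I)" if "length \<sigma> = job_num I"
    using that by (auto simp: machines_def in_set_conv_nth subset_iff)
  ultimately show ?thesis
    unfolding feasible_schedules_def feasible_def by auto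
qed

lemma makespan_eq_cmax:
  assumes "bipartite_instance I"
  shows "makespan I \<sigma> = scheduling.cmax (job_num I) (machine_num I) ((!) (requirements I)) (speed_num I) (speed_den I) ((!) \<sigma>)"
proof -
  interpret scheduling "job_num I" "machine_num I" "(!) (requirements I)" "speed_num I" "speed_den I" "incompatible I"
    by (rule scheduling_instance[OF assms])
  have "(\<Sum>j\<in>jobs_on I \<sigma> i. real (requirements I ! j) / real_of_rat (speeds I ! i))
      = load {..<job_num I} ((!) \<sigma>) i / speed i" if "i < machine_num I" for i
    using speed_fraction(3)[OF assms that]
    by (simp add: load_def speed_def jobs_on_def jobs_def sum_divide_distrib)
  then show ?thesis
    unfolding makespan_def cmax_def machines_def by simp
qed

section \<open>The complete algorithm and its running time\<close>

lemma length_le_input_size: "length xs \<le> input_size xs"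
  unfolding input_size_def by (induction xs) (auto simp: bits_def)

lemma nth_le_input_size: "i < length xs \<Longrightarrow> xs ! i \<le> 2 ^ input_size xs"
proof -
  assume i: "i < length xs"
  have "bits (xs ! i) \<le> input_size xs"
    unfolding input_size_def using i by (intro member_le_sum_list) auto
  then have "(2 :: nat) ^ bits (xs ! i) \<le> 2 ^ input_size xs"
    by (intro power_increasing) auto
  then show ?thesis by (rule less_imp_le[OF less_le_trans[OF less_two_power_bits]])
qed

definition preprocessing :: prog where
  "preprocessing = sum_requirements ;; power_loop"

text \<open>Loop programs cannot set loop limits, so these are written in between. The third limit,
  the number of candidates, is known only after the total and the power have been computed.\<close>

definition algorithm :: com where
  "algorithm = Seq (Write 2 (Const 0) (Read 0 (Const 0)))
    (Seq (Write 2 (Const 1) (Read 0 (Const 1)))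
    (Seq (compile preprocessing)
    (Seq (If (Less (cell TOTAL) (Const 100)) (Write 2 (Const 2) (cell POWER)) (Write 2 (Const 2) (Const 3)))
    (compile main_prog))))"

text \<open>The loop limits are covered by \<open>z ^ 99\<close>, as \<open>total < 100\<close>
  leaves at most 99 jobs, by \<open>z\<close> for \<open>n\<close> and \<open>m\<close>, and by 3
  for the three candidates. The summand 2 in the memory length makes room for storing that 3. The
  factor 500 pays for the comparison with 100, whose cost \<open>aexp_cost\<close> measures in
  unary.\<close>

definition algorithm_time :: "nat \<Rightarrow> nat" where
  "algorithm_time z = 20 * z + run_time preprocessing z * z + 500 * (z + growth preprocessing z)
    + run_time main_prog (z ^ 99 + z + 3) * (z + growth preprocessing z + 2)"

lemma poly_bounded_algorithm_time: "poly_bounded algorithm_time"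
proof -
  have "poly_bounded (\<lambda>z. run_time main_prog (z ^ 99 + z + 3))"
    by (rule poly_bounded_compose[of "run_time main_prog"]) (intro poly_bounded_run_time poly_bounded_add
      poly_bounded_power poly_bounded_id poly_bounded_const)+
  then show ?thesis
    unfolding algorithm_time_def
    by (intro poly_bounded_run_time poly_bounded_growth poly_bounded_add poly_bounded_mult
      poly_bounded_id poly_bounded_const)
qed

text \<open>The time bound also covers instances without a feasible schedule, where the optimal
  makespan is unspecified.\<close>

lemma exec_algorithm:
  assumes "bipartite_instance I"
  shows "\<exists>t s. exec algorithm (input_store (encode I)) t s \<and> t \<le> algorithm_time (input_size (encode I)) \<and>
    (feasible_schedules I \<noteq> {} \<longrightarrow> output_word (job_num I) s \<in> feasible_schedules I \<and>
      makespan I (output_word (job_num I) s) \<le> sqrt (p_sum I) * opt_makespan I)"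
proof -
  interpret scheduling "job_num I" "machine_num I" "(!) (requirements I)" "speed_num I" "speed_den I" "incompatible I"
    by (rule scheduling_instance[OF assms])
  define n where "n = job_num I"
  define m where "m = machine_num I"
  define z where "z = input_size (encode I)"
  define s0 where "s0 = input_store (encode I)"
  define s1 where "s1 = upd 2 1 m (upd 2 0 n s0)"
  define s2 where "s2 = run preprocessing s1"
  define k where "k = (if total < 100 then m ^ n else 3)"
  define s3 where "s3 = upd 2 2 k s2"
  define g where "g = growth preprocessing z"
  note enc = encode_nth[where I = I, folded n_def m_def]
  \<comment> \<open>The encoding has an entry for each job and two for each machine, so
    \<open>n\<close> and \<open>m\<close> are bounded by the input size in value and not just in
    length. This keeps the loops polynomial.\<close>
  have len: "2 + n + 2 * m + n * n \<le> z"
    using length_le_input_size[of "encode I"] unfolding enc(1) z_def .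
  then have z1: "z \<ge> 1" "n \<le> z" "m \<le> z" by auto
  have nz: "n \<le> 2 ^ z" "m \<le> 2 ^ z"
    using z1 less_exp[of z] by linarith+
  have s0_0: "s0 0 i = encode I ! i" if "i < 2 + n + 2 * m + n * n" for i
    using that by (simp add: s0_def input_store_def enc(1))
  have s0_a: "s0 d i = 0" if "d \<noteq> 0" for d i
    using that by (simp add: s0_def input_store_def)
  have b0: "bounded_store z s0"
    unfolding bounded_store_def s0_def input_store_def z_def by (auto intro: nth_le_input_size)
  then have b0': "bounded_store z (upd 2 0 n s0)" using nz by (intro bounded_store_upd)
  then have b1: "bounded_store z s1" unfolding s1_def using nz(2) by (rule bounded_store_upd)
  have lim1: "s1 2 c \<le> z" for c using z1 by (simp add: s1_def s0_a)
  have "s1 0 = s0 0" by (simp add: s1_def)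
  have "s1 2 0 = n \<and> s1 2 1 = m \<and> (\<forall>j<n. s1 0 (2 + j) = requirements I ! j) \<and>
    (\<forall>i<m. s1 0 (2 + n + 2 * i) = speed_num I i \<and> s1 0 (2 + n + 2 * i + 1) = speed_den I i) \<and>
    (\<forall>u<n. \<forall>v<n. s1 0 (2 + n + 2 * m + (u * n + v)) = (if incompatible I u v then 1 else 0))"
  proof (intro conjI allI impI)
    show "s1 2 0 = n" "s1 2 1 = m" by (simp_all add: s1_def)
    show "s1 0 (2 + j) = requirements I ! j" if "j < n" for j
      using that enc(4)[of j] s0_0[of "2 + j"] unfolding \<open>s1 0 = s0 0\<close> by linarith
    show "s1 0 (2 + n + 2 * i) = speed_num I i" if "i < m" for i
      using that enc(5)[of i] s0_0[of "2 + n + 2 * i"] unfolding \<open>s1 0 = s0 0\<close> by linarith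
    show "s1 0 (2 + n + 2 * i + 1) = speed_den I i" if "i < m" for i
      using that enc(6)[of i] s0_0[of "2 + n + 2 * i + 1"] unfolding \<open>s1 0 = s0 0\<close> by linarith
    show "s1 0 (2 + n + 2 * m + (u * n + v)) = (if incompatible I u v then 1 else 0)"
      if "u < n" "v < n" for u v
    proof -
      have "u * n + v < Suc u * n" using that by simp
      also have "\<dots> \<le> n * n" using that by (intro mult_le_mono1) simp
      finally show ?thesis
        using enc(7)[OF that] s0_0[of "2 + n + 2 * m + (u * n + v)"] unfolding \<open>s1 0 = s0 0\<close> by linarith
    qed
  qed
  then have reads: "reads_input s1"
    unfolding reads_input_def n_def m_def .
  have wf: "wf_prog preprocessing" "wf_prog main_prog"
    using wf_progs by (auto simp: preprocessing_def)
  obtain t1 where t1: "exec (compile preprocessing) s1 t1 s2" "t1 \<le> run_time preprocessing z * z"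
    and b2: "bounded_store (z + g) s2"
    using exec_compile[OF wf(1) b1 z1(1) lim1] unfolding s2_def g_def by blast
  have s2: "s2 = run power_loop (run sum_requirements s1)"
    by (simp add: s2_def preprocessing_def)
  have rd1: "ready (run sum_requirements s1)"
    by (rule run_sum_requirements[OF reads]) (simp add: s1_def s0_a)
  have fr2: "s2 d = run sum_requirements s1 d" if "d \<notin> {J, K, AUX, POWER}" for d
    unfolding s2 using that by (intro run_frame) (auto simp: power_loop_def)
  have fr1: "run sum_requirements s1 d = s1 d" if "d \<notin> {J, TOTAL}" for d
    using that by (intro run_frame) (auto simp: sum_requirements_def)
  have rd2: "ready s2" using rd1 by (rule ready_cong[rotated 3]) (simp_all add: fr2)
  have pow: "s2 POWER 0 = m ^ n"
    unfolding s2 m_def n_def by (rule run_power_loop) (use rd1 in simp_all)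
  have rd3: "ready s3"
    unfolding s3_def using rd2 by (rule ready_upd_bound)
  have zero: "s3 d i = 0" if "d \<in> {FOUND, COLOR, CLASS}" for d i
  proof -
    have "s3 d = s1 d" using that by (auto simp: s3_def fr2 fr1)
    moreover have "s1 d i = 0" using that by (auto simp: s1_def s0_a)
    ultimately show ?thesis by simp
  qed
  have n_total: "n \<le> total"
  proof -
    have "(\<Sum>j<n. 1) \<le> (\<Sum>j<n. requirements I ! j)"
      using p_pos by (intro sum_mono) (simp add: n_def Suc_le_eq)
    then show ?thesis by (simp add: total_def n_def)
  qed
  have kz: "k \<le> z ^ 99 + 3"
  proof (cases "total < 100")
    case True
    have "m ^ n \<le> z ^ n" using z1 by (intro power_mono) auto
    also have "\<dots> \<le> z ^ 99" using z1 n_total True by (intro power_increasing) auto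
    finally show ?thesis using True by (simp add: k_def)
  qed (simp add: k_def)
  have b2': "bounded_store (z + g + 2) s2" using b2 by (rule bounded_store_mono) simp
  have "k \<le> 2 ^ (z + g + 2)"
  proof (cases "total < 100")
    case True
    then show ?thesis using b2' pow unfolding k_def bounded_store_def by metis
  next
    case False
    have "(3 :: nat) \<le> 2 ^ 2" by simp
    also have "\<dots> \<le> 2 ^ (z + g + 2)" by (intro power_increasing) auto
    finally show ?thesis using False by (simp add: k_def)
  qed
  then have b3: "bounded_store (z + g + 2) s3" unfolding s3_def using b2' by (intro bounded_store_upd)
  have lim3: "s3 2 c \<le> z ^ 99 + z + 3" for c
    using kz z1 lim1[of c] by (simp add: s3_def fr2 fr1)
  obtain t3 where t3: "exec (compile main_prog) s3 t3 (run main_prog s3)"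
    "t3 \<le> run_time main_prog (z ^ 99 + z + 3) * (z + g + 2)"
    using exec_compile[OF wf(2) b3 _ lim3] by auto
  obtain t2 where t2: "exec (If (Less (cell TOTAL) (Const 100)) (Write 2 (Const 2) (cell POWER))
      (Write 2 (Const 2) (Const 3))) s2 t2 s3" "t2 \<le> 500 * (z + g)"
  proof -
    have c: "acost e s2 \<le> aexp_cost e * (z + g)" for e
      using acost_le[OF b2] z1 by simp
    show thesis
    proof (cases "total < 100")
      case True
      have "exec (If (Less (cell TOTAL) (Const 100)) (Write 2 (Const 2) (cell POWER))
        (Write 2 (Const 2) (Const 3))) s2 (acost (Less (cell TOTAL) (Const 100)) s2 +
          (acost (Const 2) s2 + acost (cell POWER) s2)) s3"
        using rd2 True by (intro exec.IfTrue exec_Write) (simp_all add: s3_def k_def pow)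
      then show thesis
        by (rule that) (use c[of "Less (cell TOTAL) (Const 100)"] c[of "Const 2"] c[of "cell POWER"]
          in \<open>simp add: Less_def\<close>)
    next
      case False
      have "exec (If (Less (cell TOTAL) (Const 100)) (Write 2 (Const 2) (cell POWER))
        (Write 2 (Const 2) (Const 3))) s2 (acost (Less (cell TOTAL) (Const 100)) s2 +
          (acost (Const 2) s2 + acost (Const 3) s2)) s3"
        using rd2 False by (intro exec.IfFalse exec_Write) (simp_all add: s3_def k_def)
      then show thesis
        by (rule that) (use c[of "Less (cell TOTAL) (Const 100)"] c[of "Const 2"] c[of "Const 3"]
          in \<open>simp add: Less_def\<close>)
    qed
  qed
  obtain u1 where u1: "exec (Write 2 (Const 0) (Read 0 (Const 0))) s0 u1 (upd 2 0 n s0)" "u1 \<le> 6 * z"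
  proof (rule that)
    show "exec (Write 2 (Const 0) (Read 0 (Const 0))) s0
        (acost (Const 0) s0 + acost (Read 0 (Const 0)) s0) (upd 2 0 n s0)"
      using s0_0[of 0] enc(2) by (intro exec_Write) simp_all
    show "acost (Const 0) s0 + acost (Read 0 (Const 0)) s0 \<le> 6 * z"
      using acost_le[OF b0 z1(1), of "Const 0"] acost_le[OF b0 z1(1), of "Read 0 (Const 0)"] by simp
  qed
  obtain u2 where u2: "exec (Write 2 (Const 1) (Read 0 (Const 1))) (upd 2 0 n s0) u2 s1" "u2 \<le> 8 * z"
  proof (rule that)
    let ?s = "upd 2 0 n s0"
    show "exec (Write 2 (Const 1) (Read 0 (Const 1))) ?s
        (acost (Const 1) ?s + acost (Read 0 (Const 1)) ?s) s1"
      using s0_0[of 1] enc(3) by (intro exec_Write) (simp_all add: s1_def)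
    show "acost (Const 1) ?s + acost (Read 0 (Const 1)) ?s \<le> 8 * z"
      using acost_le[OF b0' z1(1), of "Const 1"] acost_le[OF b0' z1(1), of "Read 0 (Const 1)"] by simp
  qed
  have ex: "exec algorithm s0 (u1 + (u2 + (t1 + (t2 + t3)))) (run main_prog s3)"
    unfolding algorithm_def 
    by (rule exec.Seq[OF u1(1) exec.Seq[OF u2(1) exec.Seq[OF t1(1) exec.Seq[OF t2(1) t3(1)]]]])
  have time: "u1 + (u2 + (t1 + (t2 + t3))) \<le> algorithm_time z"
    using u1(2) u2(2) t1(2) t2(2) t3(2) unfolding algorithm_time_def g_def by linarith
  have "output_word n (run main_prog s3) \<in> feasible_schedules I \<and>
      makespan I (output_word n (run main_prog s3)) \<le> sqrt (p_sum I) * opt_makespan I"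
    if ne: "feasible_schedules I \<noteq> {}"
  proof -
    obtain \<tau> where \<tau>: "\<tau> \<in> feasible_schedules I" "makespan I \<tau> = opt_makespan I"
      using opt_makespan_attained[OF ne] by metis
    have "feasible ((!) \<tau>)" using \<tau>(1) feasible_schedules_iff[OF assms] by simp
    moreover have "s3 2 2 = (if total < 100 then machine_num I ^ job_num I else 3)"
      by (simp add: s3_def k_def n_def m_def)
    ultimately have res: "feasible (run main_prog s3 1)"
      "cmax (run main_prog s3 1) \<le> sqrt total * cmax ((!) \<tau>)"
      using run_main_prog_approximates[OF rd3 zero] by blast+
    have out: "output_word n (run main_prog s3) ! j = run main_prog s3 1 j" if "j < job_num I" for j
      using that by (simp add: output_word_def n_def)
    have "total = p_sum I"
      by (simp add: total_def p_sum_def sum_list_sum_nth atLeast0LessThan)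
    then show ?thesis
      using res \<tau>(2) feasible_cong[OF out] cmax_cong[OF out]
      by (simp add: feasible_schedules_iff[OF assms] makespan_eq_cmax[OF assms] output_word_def n_def)
  qed
  then show ?thesis
    using ex time unfolding s0_def z_def n_def by blast
qed

theorem theorem9:
  shows "\<exists>alg :: com.
    polynomial_time_on (encode ` {I. bipartite_instance I}) alg \<and>
    (\<forall>I :: sched_inst. bipartite_instance I \<and> feasible_schedules I \<noteq> {} \<longrightarrow>
      (\<exists>t s. exec alg (input_store (encode I)) t s \<and>
        (let \<sigma> = output_word (length (requirements I)) s in
          \<sigma> \<in> feasible_schedules I \<and>
          makespan I \<sigma> \<le> sqrt (real (p_sum I)) * opt_makespan I)))"
proof (intro exI[of _ algorithm] conjI allI impI)
  obtain q where "\<And>z. algorithm_time z \<le> poly q z"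
    using poly_bounded_algorithm_time unfolding poly_bounded_def by blast
  then show "polynomial_time_on (encode ` {I. bipartite_instance I}) algorithm"
    unfolding polynomial_time_on_def
    using exec_algorithm by (intro exI[of _ q]) (auto, meson order_trans)
  fix I :: sched_inst
  assume "bipartite_instance I \<and> feasible_schedules I \<noteq> {}"
  then show "\<exists>t s. exec algorithm (input_store (encode I)) t s \<and>
        (let \<sigma> = output_word (length (requirements I)) s in
          \<sigma> \<in> feasible_schedules I \<and>
          makespan I \<sigma> \<le> sqrt (real (p_sum I)) * opt_makespan I)"
    using exec_algorithm[of I] by (auto simp: Let_def)
qed

end
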